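(* Let $d\ge1$, $0<s<1$, $a=1-2s$. For every $u_0\in\mathscr S_-(\mathbb R^{d+1})$ the Poisson lifting $\mathcal P_su_0$ satisfies $$\|\mathcal P_su_0\|^2_{L^2_a(\mathbb R^{d+1}_+)}=Q_s(u_0),\qquad Q_s(u_0):=\frac{2^{1-2s}}{\Gamma(s)^2}\int_{\mathbb R^d}\int_0^\infty\omega^s\,|\mathscr G_\xi(\omega)|^2\,d\omega\,d\xi .$$ Moreover, denoting by $\mathcal H^s$ the completion of $\mathscr S_-(\mathbb R^{d+1})$ with respect to the norm $Q_s^{1/2}$, the Poisson lifting extends uniquely to an isometry $$\mathcal P_s:\mathcal H^s\longrightarrow L^2_a(\mathbb R^{d+1}_+).$$
   Context: $\mathscr S_-(\mathbb R^{d+1})$ is the space of restrictions to $\mathbb R^d\times(-\infty,0]$ of Schwartz functions on $\mathbb R^{d+1}=\mathbb R^d_x\times\mathbb R_t$. $\mathbb R^{d+1}_+=\{X=(x,z):x\in\mathbb R^d,z>0\}$ and $L^2_a(\mathbb R^{d+1}_+)=L^2(\mathbb R^{d+1}_+,z^a\,dx\,dz)$. The Poisson lifting of a history $u_0\in\mathscr S_-(\mathbb R^{d+1})$ is $$\mathcal P_su_0(x,z)=\int_0^\infty\int_{\mathbb R^d}P_a(z,\sigma)\,S(x,y,\sigma)\,u_0(y,-\sigma)\,dy\,d\sigma,$$ with $S(x,y,\sigma)=(4\pi i\sigma)^{-d/2}e^{i\frac{|x-y|^2}{4\sigma}}$ (kernel of $e^{i\sigma\Delta_x}$) and $P_a(z,\sigma)=\frac{e^{i\frac{(a-1)\pi}{4}}}{2^{1-a}\Gamma(\frac{1-a}2)}\frac{z^{1-a}}{\sigma^{\frac{3-a}2}}e^{i\frac{z^2}{4\sigma}}$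 for $\sigma>0$; the $y$-integral is taken first and the $\sigma$-integral is improper at $\sigma=0$. For $u_0\in\mathscr S_-(\mathbb R^{d+1})$, let $\widehat{u_0}(\xi,t)=\int_{\mathbb R^d}e^{-2\pi i\langle\xi,x\rangle}u_0(x,t)\,dx$ for $t\le0$, and set $$g_\xi(\sigma)=e^{-4\pi^2i\sigma|\xi|^2}\,\widehat{u_0}(\xi,-\sigma)\,\mathbf 1_{(0,\infty)}(\sigma),\qquad \mathscr G_\xi(\omega)=\int_{\mathbb R}e^{-i\omega\sigma}g_\xi(\sigma)\,d\sigma .$$ $Q_s$ is a quadratic form (with the evident polarization) and $Q_s^{1/2}$ is a norm on $\mathscr S_-(\mathbb R^{d+1})$. *)

theory Defs
  imports "HOL-Analysis.Analysis"
begin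

section \<open>Complex normed spaces with explicit carriers\<close>

text \<open>The spaces below depend on real parameters, so they are records with a carrier set
  rather than types.\<close>

record 'v normed_cspace =
  vcarrier :: "'v set"
  vadd :: "'v \<Rightarrow> 'v \<Rightarrow> 'v"
  vscale :: "complex \<Rightarrow> 'v \<Rightarrow> 'v"
  vnorm :: "'v \<Rightarrow> real"

definition vdist :: "'v normed_cspace \<Rightarrow> 'v \<Rightarrow> 'v \<Rightarrow> real" where
  "vdist E u v = vnorm E (vadd E u (vscale E (-1) v))"

definition linear_map :: "'v normed_cspace \<Rightarrow> 'w normed_cspace \<Rightarrow> ('v \<Rightarrow> 'w) \<Rightarrow> bool" where
  "linear_map E F T \<longleftrightarrow>
     T \<in> vcarrier E \<rightarrow> vcarrier F \<and>
     (\<forall>u\<in>vcarrier E. \<forall>v\<in>vcarrier E. T (vadd E u v) = vadd F (T u) (T v)) \<and>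
     (\<forall>c. \<forall>u\<in>vcarrier E. T (vscale E c u) = vscale F c (T u))"

text \<open>Isometries are extensional, so that two of them are equal as soon as they agree on the
  carrier. Linearity is not part of the notion.\<close>

definition isometric_map :: "'v normed_cspace \<Rightarrow> 'w normed_cspace \<Rightarrow> ('v \<Rightarrow> 'w) \<Rightarrow> bool" where
  "isometric_map E F T \<longleftrightarrow>
     T \<in> vcarrier E \<rightarrow>\<^sub>E vcarrier F \<and>
     (\<forall>u\<in>vcarrier E. \<forall>v\<in>vcarrier E. vdist F (T u) (T v) = vdist E u v)"

subsection \<open>Completion\<close>

definition cauchy_seqs :: "'v normed_cspace \<Rightarrow> (nat \<Rightarrow> 'v) set" where
  "cauchy_seqs E =
     {f. range f \<subseteq> vcarrier E \<and>
         (\<forall>e>0. \<exists>N. \<forall>m\<ge>N. \<forall>n\<ge>N. vdist E (f m) (f n) < e)}"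

definition cauchy_rel :: "'v normed_cspace \<Rightarrow> ((nat \<Rightarrow> 'v) \<times> (nat \<Rightarrow> 'v)) set" where
  "cauchy_rel E =
     {(f, g). f \<in> cauchy_seqs E \<and> g \<in> cauchy_seqs E \<and>
              (\<lambda>n. vdist E (f n) (g n)) \<longlonglongrightarrow> 0}"

definition completion :: "'v normed_cspace \<Rightarrow> (nat \<Rightarrow> 'v) set normed_cspace" where
  "completion E =
     \<lparr> vcarrier = cauchy_seqs E // cauchy_rel E,
       vadd = (\<lambda>A B. \<Union>f\<in>A. \<Union>g\<in>B. cauchy_rel E `` {\<lambda>n. vadd E (f n) (g n)}),
       vscale = (\<lambda>c A. \<Union>f\<in>A. cauchy_rel E `` {\<lambda>n. vscale E c (f n)}),
       vnorm = (\<lambda>A. the_elem ((\<lambda>f. lim (\<lambda>n. vnorm E (f n))) ` A)) \<rparr>"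

definition to_completion :: "'v normed_cspace \<Rightarrow> 'v \<Rightarrow> (nat \<Rightarrow> 'v) set" where
  "to_completion E u = cauchy_rel E `` {\<lambda>_. u}"

subsection \<open>Square-integrable functions modulo almost everywhere equality\<close>

definition l2_norm_sq :: "'x measure \<Rightarrow> ('x \<Rightarrow> complex) \<Rightarrow> ennreal" where
  "l2_norm_sq M f = (\<integral>\<^sup>+ x. ennreal ((cmod (f x))\<^sup>2) \<partial>M)"

definition l2_funs :: "'x measure \<Rightarrow> ('x \<Rightarrow> complex) set" where
  "l2_funs M = {f \<in> borel_measurable M. l2_norm_sq M f < \<infinity>}"

definition l2_rel :: "'x measure \<Rightarrow> (('x \<Rightarrow> complex) \<times> ('x \<Rightarrow> complex)) set" where
  "l2_rel M = {(f, g). f \<in> l2_funs M \<and> g \<in> l2_funs M \<and> (AE x in M. f x = g x)}"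

definition L2_space :: "'x measure \<Rightarrow> ('x \<Rightarrow> complex) set normed_cspace" where
  "L2_space M =
     \<lparr> vcarrier = l2_funs M // l2_rel M,
       vadd = (\<lambda>A B. \<Union>f\<in>A. \<Union>g\<in>B. l2_rel M `` {\<lambda>x. f x + g x}),
       vscale = (\<lambda>c A. \<Union>f\<in>A. l2_rel M `` {\<lambda>x. c * f x}),
       vnorm = (\<lambda>A. the_elem ((\<lambda>f. sqrt (enn2real (l2_norm_sq M f))) ` A)) \<rparr>"

definition half_space_measure :: "real \<Rightarrow> ((real ^ 'd) \<times> real) measure" where
  "half_space_measure a =
     density (restrict_space lborel {X. snd X > 0}) (\<lambda>X. ennreal (snd X powr a))"

section \<open>Schwartz functions\<close>

fun iterated_deriv :: "'a list \<Rightarrow> ('a::euclidean_space \<Rightarrow> complex) \<Rightarrow> 'a \<Rightarrow> complex" where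
  "iterated_deriv [] f = f"
| "iterated_deriv (b # bs) f = (\<lambda>x. frechet_derivative (iterated_deriv bs f) (at x) b)"

text \<open>A list of basis vectors plays the role of a multi-index. Requiring every iterated partial
  derivative to be differentiable everywhere amounts to smoothness.\<close>

definition schwartz :: "('a::euclidean_space \<Rightarrow> complex) set" where
  "schwartz =
     {f. \<forall>bs\<in>lists Basis.
           (\<forall>x. iterated_deriv bs f differentiable (at x)) \<and>
           (\<forall>k. bounded (range (\<lambda>x. norm x ^ k *\<^sub>R iterated_deriv bs f x)))}"

text \<open>The restriction of a function to nonpositive times is represented by its extension by zero;
  this makes the pointwise operations the vector space operations.\<close>

definition schwartz_minus :: "((real ^ 'd) \<times> real \<Rightarrow> complex) set" where
  "schwartz_minus = (\<lambda>\<phi> X. if snd X \<le> 0 then \<phi> X else 0) ` schwartz"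

section \<open>Poisson lifting\<close>

text \<open>The complex power is the principal branch.\<close>

definition schrodinger_kernel :: "real ^ 'd \<Rightarrow> real ^ 'd \<Rightarrow> real \<Rightarrow> complex" where
  "schrodinger_kernel x y \<sigma> =
     (4 * of_real pi * \<i> * of_real \<sigma>) powr (- of_nat CARD('d) / 2) *
     cis ((norm (x - y))\<^sup>2 / (4 * \<sigma>))"

definition poisson_kernel :: "real \<Rightarrow> real \<Rightarrow> real \<Rightarrow> complex" where
  "poisson_kernel a z \<sigma> =
     cis ((a - 1) * pi / 4) / of_real (2 powr (1 - a) * Gamma ((1 - a) / 2)) *
     of_real (z powr (1 - a) / \<sigma> powr ((3 - a) / 2)) * cis (z\<^sup>2 / (4 * \<sigma>))"

definition poisson_integrand ::
    "real \<Rightarrow> ((real ^ 'd) \<times> real \<Rightarrow> complex) \<Rightarrow> real ^ 'd \<Rightarrow> real \<Rightarrow> real \<Rightarrow> real ^ 'd \<Rightarrow> complex" where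
  "poisson_integrand s u x z \<sigma> y =
     poisson_kernel (1 - 2 * s) z \<sigma> * schrodinger_kernel x y \<sigma> * u (y, - \<sigma>)"

definition truncated_poisson_lifting ::
    "real \<Rightarrow> ((real ^ 'd) \<times> real \<Rightarrow> complex) \<Rightarrow> real ^ 'd \<Rightarrow> real \<Rightarrow> real \<Rightarrow> complex" where
  "truncated_poisson_lifting s u x z \<epsilon> =
     (LINT \<sigma>:{\<epsilon><..}|lborel. LINT y|lborel. poisson_integrand s u x z \<sigma> y)"

definition poisson_lifting ::
    "real \<Rightarrow> ((real ^ 'd) \<times> real \<Rightarrow> complex) \<Rightarrow> (real ^ 'd) \<times> real \<Rightarrow> complex" where
  "poisson_lifting s u = (\<lambda>(x, z). Lim (at_right 0) (truncated_poisson_lifting s u x z))"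

text \<open>All integrals in the definition of the lifting exist, and so does the improper one;
  without this, the values of the integral and limit operators would be meaningless.\<close>

definition poisson_integral_exists ::
    "real \<Rightarrow> ((real ^ 'd) \<times> real \<Rightarrow> complex) \<Rightarrow> real ^ 'd \<Rightarrow> real \<Rightarrow> bool" where
  "poisson_integral_exists s u x z \<longleftrightarrow>
     (\<forall>\<sigma>>0. integrable lborel (poisson_integrand s u x z \<sigma>)) \<and>
     (\<forall>\<epsilon>>0. set_integrable lborel {\<epsilon><..} (\<lambda>\<sigma>. LINT y|lborel. poisson_integrand s u x z \<sigma> y)) \<and>
     (\<exists>w. (truncated_poisson_lifting s u x z \<longlongrightarrow> w) (at_right 0))"

section \<open>The quadratic form\<close>

definition fourier_space ::
    "((real ^ 'd) \<times> real \<Rightarrow> complex) \<Rightarrow> real ^ 'd \<Rightarrow> real \<Rightarrow> complex" where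
  "fourier_space u \<xi> t = (LINT x|lborel. cis (- 2 * pi * (\<xi> \<bullet> x)) * u (x, t))"

definition g_fun :: "((real ^ 'd) \<times> real \<Rightarrow> complex) \<Rightarrow> real ^ 'd \<Rightarrow> real \<Rightarrow> complex" where
  "g_fun u \<xi> \<sigma> =
     cis (- 4 * pi\<^sup>2 * \<sigma> * (norm \<xi>)\<^sup>2) * fourier_space u \<xi> (- \<sigma>) * indicator {0<..} \<sigma>"

definition G_fun :: "((real ^ 'd) \<times> real \<Rightarrow> complex) \<Rightarrow> real ^ 'd \<Rightarrow> real \<Rightarrow> complex" where
  "G_fun u \<xi> \<omega> = (LINT \<sigma>|lborel. cis (- \<omega> * \<sigma>) * g_fun u \<xi> \<sigma>)"

definition Q_form :: "real \<Rightarrow> ((real ^ 'd) \<times> real \<Rightarrow> complex) \<Rightarrow> ennreal" where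
  "Q_form s u =
     ennreal (2 powr (1 - 2 * s) / (Gamma s)\<^sup>2) *
     (\<integral>\<^sup>+ \<xi>. (\<integral>\<^sup>+ \<omega>\<in>{0<..}. ennreal (\<omega> powr s * (cmod (G_fun u \<xi> \<omega>))\<^sup>2) \<partial>lborel) \<partial>lborel)"

definition schwartz_minus_space ::
    "real \<Rightarrow> ((real ^ 'd) \<times> real \<Rightarrow> complex) normed_cspace" where
  "schwartz_minus_space s =
     \<lparr> vcarrier = schwartz_minus,
       vadd = (\<lambda>u v X. u X + v X),
       vscale = (\<lambda>c u X. c * u X),
       vnorm = (\<lambda>u. sqrt (enn2real (Q_form s u))) \<rparr>"

abbreviation H_space ::
    "real \<Rightarrow> (nat \<Rightarrow> (real ^ 'd) \<times> real \<Rightarrow> complex) set normed_cspace" where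
  "H_space s \<equiv> completion (schwartz_minus_space s)"

definition extends_poisson_lifting ::
    "real \<Rightarrow> ((nat \<Rightarrow> (real ^ 'd) \<times> real \<Rightarrow> complex) set \<Rightarrow> ((real ^ 'd) \<times> real \<Rightarrow> complex) set) \<Rightarrow> bool"
  where
  "extends_poisson_lifting s T \<longleftrightarrow>
     (\<forall>u\<in>schwartz_minus.
        T (to_completion (schwartz_minus_space s) u) =
        l2_rel (half_space_measure (1 - 2 * s)) `` {poisson_lifting s u})"

end

theory Submission
  imports Defs "HOL-Probability.Characteristic_Functions" "HOL-Probability.Sinc_Integral" "HOL-Real_Asymp.Real_Asymp"
begin

text \<open>Taking the Fourier transform in \<open>x\<close> separates the frequencies \<open>\<xi>\<close>. The Schrodinger kernel acts on a
  mode as the multiplier \<open>exp (- 4 \<pi>\<^sup>2 \<i> \<sigma> |\<xi>|\<^sup>2)\<close>, so that with \<open>r = z\<^sup>2 / 4\<close> and \<open>g = g\<^sub>\<xi>\<close> the lifting has at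
  frequency \<open>\<xi>\<close> the value \<open>c z\<^sup>2\<^sup>s F(r)\<close> with \<open>F(r) = \<integral>\<^sub>0 \<sigma>\<^sup>-\<^sup>1\<^sup>-\<^sup>s exp (\<i> r / \<sigma>) g(\<sigma>) d\<sigma>\<close> and
  \<open>|c| = 1 / (2\<^sup>2\<^sup>s \<Gamma>(s))\<close>. By Plancherel's theorem in \<open>x\<close> and the substitution \<open>r = z\<^sup>2 / 4\<close>, the claim for a
  single history becomes the identity \<open>\<integral>\<^sub>0 r\<^sup>s |F(r)|\<^sup>2 dr = \<integral>\<^sub>0 \<omega>\<^sup>s |G(\<omega>)|\<^sup>2 d\<omega>\<close> for every \<open>\<xi>\<close>, where
  \<open>G(\<omega>) = \<integral>\<^sub>0 exp (- \<i> \<omega> \<sigma>) g(\<sigma>) d\<sigma>\<close>; this is \<open>mode_identity\<close>.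

  Both sides are quadratic forms in \<open>g\<close>. With the factors \<open>exp (- \<eta> \<omega>)\<close> and \<open>exp (- \<eta> r)\<close> inserted, the
  Laplace transform of a power shows that, up to the same factor \<open>\<Gamma>(1 + s)\<close>, they have the kernels
  \<open>(\<eta> + \<i> (\<sigma> - \<sigma>'))\<^sup>-\<^sup>1\<^sup>-\<^sup>s\<close> and \<open>(\<sigma> \<sigma>')\<^sup>-\<^sup>1\<^sup>-\<^sup>s (\<eta> + \<i> (1 / \<sigma>' - 1 / \<sigma>))\<^sup>-\<^sup>1\<^sup>-\<^sup>s\<close>. As \<open>1 / \<sigma>' - 1 / \<sigma>\<close> is
  \<open>(\<sigma> - \<sigma>') / (\<sigma> \<sigma>')\<close>, the second kernel is \<open>(\<eta> \<sigma> \<sigma>' + \<i> (\<sigma> - \<sigma>'))\<^sup>-\<^sup>1\<^sup>-\<^sup>s\<close>, and as \<open>\<eta> \<rightarrow> 0\<close> both become the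
  same distribution in \<open>\<sigma> - \<sigma>'\<close>. To pass to the limit, one integration by parts in \<open>\<sigma>\<close> replaces the exponent
  by \<open>- s\<close>, after which \<open>|\<sigma> - \<sigma>'|\<^sup>-\<^sup>s\<close> is an integrable majorant (\<open>quadratic_form_limit\<close>,
  \<open>truncated_identity\<close>). All this is done for \<open>g\<close> cut off to \<open>\<sigma> > e\<close>, where \<open>F\<close> converges absolutely. A
  second integration by parts, against \<open>exp (\<i> r / \<sigma>)\<close>, shows that the improper integral \<open>F\<close> exists and
  bounds the truncated transforms by multiples of \<open>r\<^sup>-\<^sup>s\<close> near \<open>0\<close> and of \<open>1 / r\<close> near \<open>\<infinity>\<close>, uniformly in
  \<open>e\<close>, so that the truncation can be removed.

  The lifting is linear and preserves the norm, so the completion of its domain embeds in \<open>L\<^sup>2\<close>: the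
  extension sends a Cauchy sequence to the limit of its liftings, which exists because \<open>L\<^sup>2\<close> is
  complete, and it is the only one by density.\<close>

section \<open>Square-integrable functions\<close>

definition l2_norm :: "'x measure \<Rightarrow> ('x \<Rightarrow> complex) \<Rightarrow> real" where
  "l2_norm M f = sqrt (enn2real (l2_norm_sq M f))"

lemma l2_norm_nonneg [simp]: "0 \<le> l2_norm M f"
  by (simp add: l2_norm_def)

lemma l2_funsD:
  assumes "f \<in> l2_funs M"
  shows "f \<in> borel_measurable M" "l2_norm_sq M f < \<infinity>"
  using assms by (auto simp: l2_funs_def)

lemma l2_norm_sq_eq:
  assumes "f \<in> l2_funs M"
  shows "l2_norm_sq M f = ennreal ((l2_norm M f)\<^sup>2)"
  using l2_funsD[OF assms] by (simp add: l2_norm_def less_top)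

lemma l2_norm_le_iff:
  assumes "f \<in> l2_funs M" "0 \<le> c"
  shows "l2_norm M f \<le> c \<longleftrightarrow> l2_norm_sq M f \<le> ennreal (c\<^sup>2)"
  using assms(2) by (simp add: l2_norm_sq_eq[OF assms(1)] ennreal_le_iff power_mono_iff)

lemma l2_norm_sq_cong_AE:
  assumes "AE x in M. f x = g x"
  shows "l2_norm_sq M f = l2_norm_sq M g"
  unfolding l2_norm_sq_def by (rule nn_integral_cong_AE) (use assms in auto)

lemma l2_norm_cong_AE:
  assumes "AE x in M. f x = g x"
  shows "l2_norm M f = l2_norm M g"
  unfolding l2_norm_def l2_norm_sq_cong_AE[OF assms] ..

lemma l2_norm_sq_scale:
  assumes [measurable]: "f \<in> borel_measurable M"
  shows "l2_norm_sq M (\<lambda>x. c * f x) = ennreal ((cmod c)\<^sup>2) * l2_norm_sq M f"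
  unfolding l2_norm_sq_def
  by (subst nn_integral_cmult[symmetric]) (auto simp: norm_mult power_mult_distrib ennreal_mult)

lemma l2_funs_scale: "f \<in> l2_funs M \<Longrightarrow> (\<lambda>x. c * f x) \<in> l2_funs M"
  by (auto simp: l2_funs_def l2_norm_sq_scale ennreal_mult_less_top)

lemma l2_norm_uminus: "l2_norm M (\<lambda>x. - f x) = l2_norm M f"
  by (simp add: l2_norm_def l2_norm_sq_def)

text \<open>Young's inequality for the mixed term. Integrating it and choosing the weight \<open>t\<close> afterwards gives the
  triangle inequality in \<open>L\<^sup>2\<close>.\<close>

lemma norm_add_sq_le_weighted:
  fixes u v :: complex
  assumes "0 < t"
  shows "(cmod (u + v))\<^sup>2 \<le> (1 + t) * (cmod u)\<^sup>2 + (1 + 1 / t) * (cmod v)\<^sup>2"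
proof -
  have "(cmod (u + v))\<^sup>2 \<le> (cmod u + cmod v)\<^sup>2"
    by (intro power_mono norm_triangle_ineq) auto
  also have "\<dots> = (cmod u)\<^sup>2 + (cmod v)\<^sup>2 + 2 * cmod u * cmod v"
    by (simp add: power2_sum)
  also have "\<dots> \<le> (1 + t) * (cmod u)\<^sup>2 + (1 + 1 / t) * (cmod v)\<^sup>2"
  proof -
    have "0 \<le> (t * cmod u - cmod v)\<^sup>2 / t"
      using assms by simp
    also have "\<dots> = t * (cmod u)\<^sup>2 + (cmod v)\<^sup>2 / t - 2 * cmod u * cmod v"
      using assms by (simp add: power2_eq_square field_simps)
    finally show ?thesis by (simp add: algebra_simps)
  qed
  finally show ?thesis .
qed

lemma l2_norm_sq_add_le_weighted:
  assumes [measurable]: "f \<in> borel_measurable M" "g \<in> borel_measurable M" and t: "0 < t"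
  shows "l2_norm_sq M (\<lambda>x. f x + g x) \<le>
           ennreal (1 + t) * l2_norm_sq M f + ennreal (1 + 1 / t) * l2_norm_sq M g"
proof -
  have "l2_norm_sq M (\<lambda>x. f x + g x) \<le>
      (\<integral>\<^sup>+x. ennreal (1 + t) * ennreal ((cmod (f x))\<^sup>2) + ennreal (1 + 1 / t) * ennreal ((cmod (g x))\<^sup>2) \<partial>M)"
    unfolding l2_norm_sq_def
  proof (intro nn_integral_mono)
    fix x
    show "ennreal ((cmod (f x + g x))\<^sup>2) \<le>
       ennreal (1 + t) * ennreal ((cmod (f x))\<^sup>2) + ennreal (1 + 1 / t) * ennreal ((cmod (g x))\<^sup>2)"
      using norm_add_sq_le_weighted[OF t, of "f x" "g x"] t
      by (subst (1 2) ennreal_mult[symmetric]) (auto simp flip: ennreal_plus intro!: ennreal_leI)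
  qed
  also have "\<dots> = ennreal (1 + t) * l2_norm_sq M f + ennreal (1 + 1 / t) * l2_norm_sq M g"
    unfolding l2_norm_sq_def by (subst nn_integral_add) (auto simp: nn_integral_cmult)
  finally show ?thesis .
qed

lemma l2_funs_add:
  assumes "f \<in> l2_funs M" "g \<in> l2_funs M"
  shows "(\<lambda>x. f x + g x) \<in> l2_funs M"
proof -
  note [measurable] = l2_funsD(1)[OF assms(1)] l2_funsD(1)[OF assms(2)]
  have "ennreal (1 + 1) * l2_norm_sq M f + ennreal (1 + 1 / 1) * l2_norm_sq M g < \<infinity>"
    using l2_funsD(2)[OF assms(1)] l2_funsD(2)[OF assms(2)] by (auto simp: ennreal_mult_less_top)
  then show ?thesis
    using l2_norm_sq_add_le_weighted[of f M g 1] l2_funsD(1)[OF assms(1)] l2_funsD(1)[OF assms(2)]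
    by (auto simp: l2_funs_def intro: le_less_trans)
qed

lemma l2_funs_diff:
  assumes "f \<in> l2_funs M" "g \<in> l2_funs M"
  shows "(\<lambda>x. f x - g x) \<in> l2_funs M"
  using l2_funs_add[OF assms(1) l2_funs_scale[OF assms(2), of "-1"]] by simp

lemma l2_norm_triangle:
  assumes f: "f \<in> l2_funs M" and g: "g \<in> l2_funs M"
  shows "l2_norm M (\<lambda>x. f x + g x) \<le> l2_norm M f + l2_norm M g"
proof (rule field_le_epsilon)
  fix e :: real assume e: "0 < e"
  define a b where "a = l2_norm M f + e / 2" and "b = l2_norm M g + e / 2"
  have pos: "0 < a" "0 < b"
    using e by (auto simp: a_def b_def intro: add_nonneg_pos)
  \<comment> \<open>This weight makes the two squares recombine to the square of the sum; shifting by \<open>e / 2\<close> keeps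
     it positive.\<close>
  have "l2_norm_sq M (\<lambda>x. f x + g x) \<le>
      ennreal (1 + b / a) * l2_norm_sq M f + ennreal (1 + 1 / (b / a)) * l2_norm_sq M g"
    using pos l2_funsD(1)[OF f] l2_funsD(1)[OF g] by (intro l2_norm_sq_add_le_weighted) auto
  also have "\<dots> = ennreal ((1 + b / a) * (l2_norm M f)\<^sup>2 + (1 + a / b) * (l2_norm M g)\<^sup>2)"
    using pos by (simp add: l2_norm_sq_eq[OF f] l2_norm_sq_eq[OF g] ennreal_mult ennreal_plus)
  also have "\<dots> \<le> ennreal ((1 + b / a) * a\<^sup>2 + (1 + a / b) * b\<^sup>2)"
    using pos e by (intro ennreal_leI add_mono mult_left_mono power_mono) (auto simp: a_def b_def)
  also have "(1 + b / a) * a\<^sup>2 + (1 + a / b) * b\<^sup>2 = (a + b)\<^sup>2"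
    using pos by (simp add: power2_eq_square field_simps)
  finally have "l2_norm M (\<lambda>x. f x + g x) \<le> a + b"
    using pos by (subst l2_norm_le_iff[OF l2_funs_add[OF f g]]) auto
  then show "l2_norm M (\<lambda>x. f x + g x) \<le> l2_norm M f + l2_norm M g + e"
    by (simp add: a_def b_def)
qed

lemma l2_norm_diff_commute: "l2_norm M (\<lambda>x. f x - g x) = l2_norm M (\<lambda>x. g x - f x)"
  using l2_norm_uminus[of M "\<lambda>x. f x - g x"] by simp

lemma l2_norm_diff_triangle:
  assumes "f \<in> l2_funs M" "g \<in> l2_funs M" "h \<in> l2_funs M"
  shows "l2_norm M (\<lambda>x. f x - h x) \<le> l2_norm M (\<lambda>x. f x - g x) + l2_norm M (\<lambda>x. g x - h x)"
  using l2_norm_triangle[OF l2_funs_diff[OF assms(1,2)] l2_funs_diff[OF assms(2,3)]] by simp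

lemma l2_norm_eq_0_iff:
  assumes "f \<in> l2_funs M" "g \<in> l2_funs M"
  shows "l2_norm M (\<lambda>x. f x - g x) = 0 \<longleftrightarrow> (AE x in M. f x = g x)"
proof -
  have d: "(\<lambda>x. f x - g x) \<in> l2_funs M" by (rule l2_funs_diff[OF assms])
  note [measurable] = l2_funsD(1)[OF d]
  have "l2_norm M (\<lambda>x. f x - g x) = 0 \<longleftrightarrow> l2_norm_sq M (\<lambda>x. f x - g x) = 0"
    by (simp add: l2_norm_sq_eq[OF d])
  also have "\<dots> \<longleftrightarrow> (AE x in M. ennreal ((cmod (f x - g x))\<^sup>2) = 0)"
    unfolding l2_norm_sq_def by (rule nn_integral_0_iff_AE) measurable
  also have "\<dots> \<longleftrightarrow> (AE x in M. f x = g x)"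
    by simp
  finally show ?thesis .
qed

text \<open>Completeness. Along a subsequence whose increments \<open>d\<^sub>k\<close> have norm below \<open>2\<^sup>-\<^sup>k\<close>, the function
  \<open>\<Sum> 2\<^sup>k |d\<^sub>k|\<^sup>2\<close> is integrable, hence finite almost everywhere; as \<open>2 |d\<^sub>k| \<le> 2\<^sup>k |d\<^sub>k|\<^sup>2 + 2\<^sup>-\<^sup>k\<close>, the
  subsequence converges almost everywhere, and Fatou's lemma turns the pointwise limit into a limit
  in norm.\<close>

lemma l2_complete:
  assumes f: "\<And>n. f n \<in> l2_funs M"
    and cauchy: "\<And>e. e > 0 \<Longrightarrow> \<exists>N. \<forall>m\<ge>N. \<forall>n\<ge>N. l2_norm M (\<lambda>x. f m x - f n x) < e"
  shows "\<exists>F\<in>l2_funs M. (\<lambda>n. l2_norm M (\<lambda>x. f n x - F x)) \<longlonglongrightarrow> 0"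
proof -
  have [measurable]: "f n \<in> borel_measurable M" for n using l2_funsD(1)[OF f] .
  have "\<forall>k. \<exists>N. \<forall>m\<ge>N. \<forall>n\<ge>N. l2_norm M (\<lambda>x. f m x - f n x) < (1/2)^k"
    using cauchy by simp
  then obtain N where N: "\<And>k m n. m \<ge> N k \<Longrightarrow> n \<ge> N k \<Longrightarrow> l2_norm M (\<lambda>x. f m x - f n x) < (1/2)^k"
    by metis
  define r where "r k = k + (\<Sum>j\<le>k. N j)" for k
  have rN: "N k \<le> r k" for k
    using member_le_sum[of k "{..k}" N] by (simp add: r_def trans_le_add2)
  have r_mono: "r k \<le> r (Suc k)" for k
    by (simp add: r_def)
  have r_ge: "k \<le> r k" for k by (simp add: r_def)
  define d where "d k x = f (r (Suc k)) x - f (r k) x" for k x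
  have d: "d k \<in> l2_funs M" for k
    unfolding d_def[abs_def] by (intro l2_funs_diff f)
  have [measurable]: "d k \<in> borel_measurable M" for k using l2_funsD(1)[OF d] .
  have dn: "l2_norm_sq M (d k) \<le> ennreal ((1/4)^k)" for k
  proof -
    have "l2_norm M (d k) < (1/2)^k"
      unfolding d_def[abs_def] by (rule N) (use rN r_mono order_trans in blast)+
    then have "(l2_norm M (d k))\<^sup>2 \<le> ((1/2)^k)\<^sup>2"
      by (intro power_mono) auto
    also have "((1/2::real)^k)\<^sup>2 = (1/4)^k"
      by (simp add: power2_eq_square flip: power_mult_distrib)
    finally show ?thesis by (simp add: l2_norm_sq_eq[OF d])
  qed
  have "(\<integral>\<^sup>+x. (\<Sum>k. ennreal (2^k) * ennreal ((cmod (d k x))\<^sup>2)) \<partial>M) =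
      (\<Sum>k. \<integral>\<^sup>+x. ennreal (2^k) * ennreal ((cmod (d k x))\<^sup>2) \<partial>M)"
    by (rule nn_integral_suminf) measurable
  also have "\<dots> = (\<Sum>k. ennreal (2^k) * l2_norm_sq M (d k))"
    unfolding l2_norm_sq_def by (subst nn_integral_cmult) auto
  also have "\<dots> \<le> (\<Sum>k. ennreal ((1/2)^k))"
  proof (intro suminf_le allI)
    fix k
    have "ennreal (2^k) * l2_norm_sq M (d k) \<le> ennreal (2^k) * ennreal ((1/4)^k)"
      by (intro mult_left_mono dn) auto
    also have "\<dots> = ennreal ((1/2)^k)"
      by (subst ennreal_mult[symmetric]) (auto simp flip: power_mult_distrib)
    finally show "ennreal (2^k) * l2_norm_sq M (d k) \<le> ennreal ((1/2)^k)" .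
  qed auto
  also have "\<dots> < \<infinity>"
    by (subst suminf_ennreal2) (auto intro: summable_geometric)
  finally have "AE x in M. (\<Sum>k. ennreal (2^k) * ennreal ((cmod (d k x))\<^sup>2)) \<noteq> \<infinity>"
    by (intro nn_integral_PInf_AE) auto
  then have AE_conv: "AE x in M. convergent (\<lambda>k. f (r k) x)"
  proof eventually_elim
    case (elim x)
    have "summable (\<lambda>k. 2^k * (cmod (d k x))\<^sup>2)"
      using elim by (intro summable_suminf_not_top) (auto simp: ennreal_mult)
    then have "summable (\<lambda>k. (2^k * (cmod (d k x))\<^sup>2 + (1/2)^k))"
      by (intro summable_add summable_geometric) auto
    then have "summable (\<lambda>k. d k x)"
    proof (rule summable_comparison_test[rotated], intro exI allI impI)
      fix k :: nat
      have "0 \<le> (2^k * cmod (d k x) - 1)\<^sup>2 / 2^k" by simp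
      also have "\<dots> = 2^k * (cmod (d k x))\<^sup>2 + (1/2)^k - 2 * cmod (d k x)"
        by (simp add: power2_eq_square field_simps)
      finally show "norm (d k x) \<le> 2^k * (cmod (d k x))\<^sup>2 + (1/2)^k"
        using norm_ge_zero[of "d k x"] by linarith
    qed
    then have "convergent (\<lambda>n. (\<Sum>k<n. d k x))"
      by (simp add: summable_iff_convergent)
    moreover have "(\<Sum>k<n. d k x) = f (r n) x - f (r 0) x" for n
      unfolding d_def by (rule sum_lessThan_telescope)
    ultimately show ?case
      using convergent_diff_const_right_iff[of "\<lambda>n. f (r n) x"] by simp
  qed
  define F where "F x = lim (\<lambda>k. f (r k) x)" for x
  have [measurable]: "F \<in> borel_measurable M"
    unfolding F_def[abs_def] by (rule borel_measurable_lim_metric) measurable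
  have lim: "AE x in M. (\<lambda>k. f (r k) x) \<longlonglongrightarrow> F x"
    using AE_conv by eventually_elim (simp add: F_def convergent_LIMSEQ_iff)
  have key: "\<exists>n0. \<forall>n\<ge>n0. l2_norm_sq M (\<lambda>x. f n x - F x) \<le> ennreal (e\<^sup>2)" if "e > 0" for e
  proof -
    obtain n0 where n0: "\<And>m n. m \<ge> n0 \<Longrightarrow> n \<ge> n0 \<Longrightarrow> l2_norm M (\<lambda>x. f m x - f n x) < e"
      using cauchy[OF \<open>e > 0\<close>] by blast
    have "l2_norm_sq M (\<lambda>x. f n x - F x) \<le> ennreal (e\<^sup>2)" if n: "n \<ge> n0" for n
    proof -
      have "l2_norm_sq M (\<lambda>x. f n x - F x) =
          (\<integral>\<^sup>+x. liminf (\<lambda>k. ennreal ((cmod (f n x - f (r k) x))\<^sup>2)) \<partial>M)"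
        unfolding l2_norm_sq_def
      proof (rule nn_integral_cong_AE, use lim in eventually_elim)
        case (elim x)
        then have "(\<lambda>k. ennreal ((cmod (f n x - f (r k) x))\<^sup>2)) \<longlonglongrightarrow> ennreal ((cmod (f n x - F x))\<^sup>2)"
          by (intro tendsto_intros) auto
        then show ?case by (rule lim_imp_Liminf[OF trivial_limit_sequentially, symmetric])
      qed
      also have "\<dots> \<le> liminf (\<lambda>k. l2_norm_sq M (\<lambda>x. f n x - f (r k) x))"
        unfolding l2_norm_sq_def by (rule nn_integral_liminf) measurable
      also have "\<dots> \<le> limsup (\<lambda>k. l2_norm_sq M (\<lambda>x. f n x - f (r k) x))"
        by (rule Liminf_le_Limsup) simp
      also have "\<dots> \<le> ennreal (e\<^sup>2)"
      proof (rule Limsup_bounded)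
        show "\<forall>\<^sub>F k in sequentially. l2_norm_sq M (\<lambda>x. f n x - f (r k) x) \<le> ennreal (e\<^sup>2)"
          using eventually_ge_at_top[of n0]
        proof eventually_elim
          case (elim k)
          then have "l2_norm M (\<lambda>x. f n x - f (r k) x) < e"
            using n0[OF n, of "r k"] r_ge[of k] by simp
          then show ?case
            using l2_norm_le_iff[OF l2_funs_diff[OF f f], of e n "r k"] \<open>e > 0\<close> by simp
        qed
      qed
      finally show ?thesis .
    qed
    then show ?thesis by blast
  qed
  have diffn: "\<exists>n. (\<lambda>x. f n x - F x) \<in> l2_funs M"
    using key[of 1] by (auto simp: l2_funs_def intro!: le_less_trans[OF _ ennreal_one_less_top])
  then obtain n where n: "(\<lambda>x. f n x - F x) \<in> l2_funs M" by blast
  have F: "F \<in> l2_funs M"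
    using l2_funs_diff[OF f[of n] n] by simp
  have "(\<lambda>n. l2_norm M (\<lambda>x. f n x - F x)) \<longlonglongrightarrow> 0"
  proof (rule LIMSEQ_I)
    fix e :: real assume "0 < e"
    then obtain n0 where "\<forall>n\<ge>n0. l2_norm_sq M (\<lambda>x. f n x - F x) \<le> ennreal ((e/2)\<^sup>2)"
      using key[of "e/2"] by auto
    then have "\<forall>n\<ge>n0. l2_norm M (\<lambda>x. f n x - F x) \<le> e/2"
      using \<open>0 < e\<close> by (simp add: l2_norm_le_iff[OF l2_funs_diff[OF f F]] del: le_divide_eq_numeral1)
    then show "\<exists>n0. \<forall>n\<ge>n0. norm (l2_norm M (\<lambda>x. f n x - F x) - 0) < e"
      using \<open>0 < e\<close> by (intro exI[of _ n0]) (fastforce simp: abs_of_nonneg)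
  qed
  then show ?thesis using F by blast
qed

subsection \<open>The space of classes\<close>

abbreviation l2_class :: "'x measure \<Rightarrow> ('x \<Rightarrow> complex) \<Rightarrow> ('x \<Rightarrow> complex) set" where
  "l2_class M f \<equiv> l2_rel M `` {f}"

lemma equiv_l2_rel: "equiv (l2_funs M) (l2_rel M)"
proof (rule equivI)
  show "l2_rel M \<subseteq> l2_funs M \<times> l2_funs M" by (auto simp: l2_rel_def)
  show "refl_on (l2_funs M) (l2_rel M)" by (auto simp: refl_on_def l2_rel_def)
  show "sym (l2_rel M)" by (auto simp: sym_def l2_rel_def)
  show "trans (l2_rel M)" by (auto simp: trans_def l2_rel_def)
qed

lemma l2_class_eq_iff:
  assumes "f \<in> l2_funs M" "g \<in> l2_funs M"
  shows "l2_class M f = l2_class M g \<longleftrightarrow> (AE x in M. f x = g x)"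
  using eq_equiv_class_iff[OF equiv_l2_rel assms] assms by (auto simp: l2_rel_def)

lemma l2_class_self: "f \<in> l2_funs M \<Longrightarrow> f \<in> l2_class M f"
  by (auto simp: l2_rel_def)

lemma l2_class_carrier: "f \<in> l2_funs M \<Longrightarrow> l2_class M f \<in> vcarrier (L2_space M)"
  by (auto simp: L2_space_def intro: quotientI)

lemma L2_space_cases:
  assumes "A \<in> vcarrier (L2_space M)"
  obtains f where "f \<in> l2_funs M" "A = l2_class M f"
  using assms by (auto simp: L2_space_def elim: quotientE)

lemma vadd_l2_class:
  assumes "f \<in> l2_funs M" "g \<in> l2_funs M"
  shows "vadd (L2_space M) (l2_class M f) (l2_class M g) = l2_class M (\<lambda>x. f x + g x)"
proof -
  have "l2_class M (\<lambda>x. f' x + g' x) = l2_class M (\<lambda>x. f x + g x)"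
    if "f' \<in> l2_class M f" "g' \<in> l2_class M g" for f' g'
    using that by (subst l2_class_eq_iff) (auto simp: l2_rel_def intro: l2_funs_add)
  then have "(\<Union>f'\<in>l2_class M f. \<Union>g'\<in>l2_class M g. l2_class M (\<lambda>x. f' x + g' x)) =
      l2_class M (\<lambda>x. f x + g x)"
    using l2_class_self[OF assms(1)] l2_class_self[OF assms(2)] by (intro SUP_eq_const) blast+
  then show ?thesis by (simp add: L2_space_def)
qed

lemma vscale_l2_class:
  assumes "f \<in> l2_funs M"
  shows "vscale (L2_space M) c (l2_class M f) = l2_class M (\<lambda>x. c * f x)"
proof -
  have "l2_class M (\<lambda>x. c * f' x) = l2_class M (\<lambda>x. c * f x)" if "f' \<in> l2_class M f" for f'
  proof -
    from that have f': "f' \<in> l2_funs M" "AE x in M. f x = f' x" by (auto simp: l2_rel_def)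
    from f'(2) have "AE x in M. c * f' x = c * f x" by eventually_elim simp
    then show ?thesis
      by (simp add: l2_class_eq_iff l2_funs_scale f' assms)
  qed
  then have "(\<Union>f'\<in>l2_class M f. l2_class M (\<lambda>x. c * f' x)) = l2_class M (\<lambda>x. c * f x)"
    using l2_class_self[OF assms] by (intro SUP_eq_const) blast+
  then show ?thesis by (simp add: L2_space_def)
qed

lemma vnorm_l2_class:
  assumes "f \<in> l2_funs M"
  shows "vnorm (L2_space M) (l2_class M f) = l2_norm M f"
proof -
  have "(\<lambda>f. sqrt (enn2real (l2_norm_sq M f))) ` l2_class M f = {l2_norm M f}"
  proof -
    have "sqrt (enn2real (l2_norm_sq M f')) = l2_norm M f" if "f' \<in> l2_class M f" for f'
      using that l2_norm_cong_AE[where M = M and f = f and g = f'] by (auto simp: l2_rel_def l2_norm_def)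
    then show ?thesis
      using l2_class_self[OF assms] by auto
  qed
  then show ?thesis by (simp add: L2_space_def)
qed

lemma vdist_l2_class:
  assumes "f \<in> l2_funs M" "g \<in> l2_funs M"
  shows "vdist (L2_space M) (l2_class M f) (l2_class M g) = l2_norm M (\<lambda>x. f x - g x)"
proof -
  have m: "(\<lambda>x. - g x) \<in> l2_funs M" using l2_funs_scale[OF assms(2), of "-1"] by simp
  show ?thesis
    unfolding vdist_def
    by (simp add: vscale_l2_class vadd_l2_class vnorm_l2_class assms m l2_funs_diff)
qed

section \<open>Extending an isometry to the completion\<close>

text \<open>A complex vector space whose norm is pulled back from an \<open>L\<^sup>2\<close> norm along a map \<open>J\<close> that is linear up
  to null sets. Every property of the norm, such as the triangle inequality, is inherited from \<open>L\<^sup>2\<close>, and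
  so is every limit: a Cauchy sequence in the space is a sequence whose image under \<open>J\<close> converges.\<close>

locale l2_valued_isometry =
  fixes E :: "'v normed_cspace" and M :: "'x measure" and J :: "'v \<Rightarrow> 'x \<Rightarrow> complex"
  assumes J_l2: "u \<in> vcarrier E \<Longrightarrow> J u \<in> l2_funs M"
    and vadd_closed: "u \<in> vcarrier E \<Longrightarrow> v \<in> vcarrier E \<Longrightarrow> vadd E u v \<in> vcarrier E"
    and vscale_closed: "u \<in> vcarrier E \<Longrightarrow> vscale E c u \<in> vcarrier E"
    and J_add: "u \<in> vcarrier E \<Longrightarrow> v \<in> vcarrier E \<Longrightarrow> AE x in M. J (vadd E u v) x = J u x + J v x"
    and J_scale: "u \<in> vcarrier E \<Longrightarrow> AE x in M. J (vscale E c u) x = c * J u x"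
    and vnorm_J: "u \<in> vcarrier E \<Longrightarrow> vnorm E u = l2_norm M (J u)"
begin

lemma vdist_J:
  assumes "u \<in> vcarrier E" "v \<in> vcarrier E"
  shows "vdist E u v = l2_norm M (\<lambda>x. J u x - J v x)"
proof -
  have v: "vscale E (-1) v \<in> vcarrier E" by (rule vscale_closed[OF assms(2)])
  have "AE x in M. J (vadd E u (vscale E (-1) v)) x = J u x - J v x"
    using J_add[OF assms(1) v] J_scale[OF assms(2), of "-1"] by eventually_elim simp
  then show ?thesis
    unfolding vdist_def by (simp add: vnorm_J vadd_closed assms v l2_norm_cong_AE)
qed

lemma cauchy_seqsD: "f \<in> cauchy_seqs E \<Longrightarrow> f n \<in> vcarrier E"
  by (auto simp: cauchy_seqs_def)

text \<open>Only the class of this function modulo null sets is determined, so that all statements about it hold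
  almost everywhere.\<close>

definition limit_fun :: "(nat \<Rightarrow> 'v) \<Rightarrow> 'x \<Rightarrow> complex" where
  "limit_fun f = (SOME F. F \<in> l2_funs M \<and> (\<lambda>n. l2_norm M (\<lambda>x. J (f n) x - F x)) \<longlonglongrightarrow> 0)"

lemma limit_fun:
  assumes f: "f \<in> cauchy_seqs E"
  shows "limit_fun f \<in> l2_funs M" "(\<lambda>n. l2_norm M (\<lambda>x. J (f n) x - limit_fun f x)) \<longlonglongrightarrow> 0"
proof -
  have "\<exists>F\<in>l2_funs M. (\<lambda>n. l2_norm M (\<lambda>x. J (f n) x - F x)) \<longlonglongrightarrow> 0"
  proof (rule l2_complete)
    show "J (f n) \<in> l2_funs M" for n by (intro J_l2 cauchy_seqsD f)
    show "\<exists>N. \<forall>m\<ge>N. \<forall>n\<ge>N. l2_norm M (\<lambda>x. J (f m) x - J (f n) x) < e" if "e > 0" for e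
      using f that by (auto simp: cauchy_seqs_def vdist_J image_subset_iff)
  qed
  then have "\<exists>F. F \<in> l2_funs M \<and> (\<lambda>n. l2_norm M (\<lambda>x. J (f n) x - F x)) \<longlonglongrightarrow> 0" by blast
  from someI_ex[OF this]
  show "limit_fun f \<in> l2_funs M" "(\<lambda>n. l2_norm M (\<lambda>x. J (f n) x - limit_fun f x)) \<longlonglongrightarrow> 0"
    unfolding limit_fun_def by blast+
qed

lemma tendsto_vdist_limit_fun:
  assumes f: "f \<in> cauchy_seqs E" and g: "g \<in> cauchy_seqs E"
  shows "(\<lambda>n. vdist E (f n) (g n)) \<longlonglongrightarrow> l2_norm M (\<lambda>x. limit_fun f x - limit_fun g x)"
proof -
  let ?F = "limit_fun f" and ?G = "limit_fun g"
  note F = limit_fun[OF f] and G = limit_fun[OF g]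
  have J: "J (f n) \<in> l2_funs M" "J (g n) \<in> l2_funs M" for n
    by (auto intro: J_l2 cauchy_seqsD f g)
  let ?b = "\<lambda>n. l2_norm M (\<lambda>x. J (f n) x - ?F x) + l2_norm M (\<lambda>x. J (g n) x - ?G x)"
  have "?b \<longlonglongrightarrow> 0"
    using tendsto_add[OF F(2) G(2)] by simp
  moreover have "\<forall>\<^sub>F n in sequentially. norm (vdist E (f n) (g n) - l2_norm M (\<lambda>x. ?F x - ?G x)) \<le> ?b n"
  proof (intro always_eventually allI)
    fix n
    have "l2_norm M (\<lambda>x. J (f n) x - J (g n) x) \<le>
        l2_norm M (\<lambda>x. J (f n) x - ?F x) + (l2_norm M (\<lambda>x. ?F x - ?G x) + l2_norm M (\<lambda>x. ?G x - J (g n) x))"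
      using l2_norm_diff_triangle[OF J(1)[of n] F(1) J(2)[of n]]
        l2_norm_diff_triangle[OF F(1) G(1) J(2)[of n]] by linarith
    moreover have "l2_norm M (\<lambda>x. ?F x - ?G x) \<le>
        l2_norm M (\<lambda>x. ?F x - J (f n) x) + (l2_norm M (\<lambda>x. J (f n) x - J (g n) x) + l2_norm M (\<lambda>x. J (g n) x - ?G x))"
      using l2_norm_diff_triangle[OF F(1) J(1)[of n] G(1)]
        l2_norm_diff_triangle[OF J(1)[of n] J(2)[of n] G(1)] by linarith
    ultimately show "norm (vdist E (f n) (g n) - l2_norm M (\<lambda>x. ?F x - ?G x)) \<le> ?b n"
      using l2_norm_diff_commute[of M "J (f n)" ?F] l2_norm_diff_commute[of M "J (g n)" ?G]
      by (simp add: vdist_J cauchy_seqsD[OF f] cauchy_seqsD[OF g] abs_le_iff)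
  qed
  ultimately have "(\<lambda>n. vdist E (f n) (g n) - l2_norm M (\<lambda>x. ?F x - ?G x)) \<longlonglongrightarrow> 0"
    by (rule Lim_null_comparison[rotated])
  then show ?thesis by (rule LIM_zero_cancel)
qed

abbreviation cauchy_class :: "(nat \<Rightarrow> 'v) \<Rightarrow> (nat \<Rightarrow> 'v) set" where
  "cauchy_class f \<equiv> cauchy_rel E `` {f}"

lemma cauchy_rel_iff:
  "(f, g) \<in> cauchy_rel E \<longleftrightarrow>
     f \<in> cauchy_seqs E \<and> g \<in> cauchy_seqs E \<and> (AE x in M. limit_fun f x = limit_fun g x)"
proof (cases "f \<in> cauchy_seqs E \<and> g \<in> cauchy_seqs E")
  case True
  then have "(\<lambda>n. vdist E (f n) (g n)) \<longlonglongrightarrow> 0 \<longleftrightarrow> l2_norm M (\<lambda>x. limit_fun f x - limit_fun g x) = 0"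
    using LIMSEQ_unique[OF tendsto_vdist_limit_fun[of f g]] tendsto_vdist_limit_fun[of f g] by metis
  with True show ?thesis
    by (simp add: cauchy_rel_def l2_norm_eq_0_iff limit_fun(1))
qed (auto simp: cauchy_rel_def)

lemma equiv_cauchy_rel: "equiv (cauchy_seqs E) (cauchy_rel E)"
proof (rule equivI)
  show "cauchy_rel E \<subseteq> cauchy_seqs E \<times> cauchy_seqs E" by (auto simp: cauchy_rel_iff)
  show "refl_on (cauchy_seqs E) (cauchy_rel E)" by (auto simp: refl_on_def cauchy_rel_iff)
  show "sym (cauchy_rel E)" by (auto simp: sym_def cauchy_rel_iff)
  show "trans (cauchy_rel E)" by (auto simp: trans_def cauchy_rel_iff)
qed

lemma cauchy_class_eq_iff:
  assumes "f \<in> cauchy_seqs E" "g \<in> cauchy_seqs E"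
  shows "cauchy_class f = cauchy_class g \<longleftrightarrow> (AE x in M. limit_fun f x = limit_fun g x)"
  by (simp only: eq_equiv_class_iff[OF equiv_cauchy_rel assms] cauchy_rel_iff assms simp_thms)

lemma cauchy_class_self: "f \<in> cauchy_seqs E \<Longrightarrow> f \<in> cauchy_class f"
  by (auto simp: cauchy_rel_iff)

lemma completion_cases:
  assumes "A \<in> vcarrier (completion E)"
  obtains f where "f \<in> cauchy_seqs E" "A = cauchy_class f"
  using assms unfolding completion_def quotient_def by auto

lemma cauchy_class_carrier: "f \<in> cauchy_seqs E \<Longrightarrow> cauchy_class f \<in> vcarrier (completion E)"
  by (auto simp: completion_def intro: quotientI)

text \<open>Convergence of the images proves the Cauchy property and identifies the limit at the same time. Sums,
  multiples and constant sequences are treated in this way.\<close>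

lemma cauchy_seqsI:
  assumes "\<And>n. f n \<in> vcarrier E" "F \<in> l2_funs M" "(\<lambda>n. l2_norm M (\<lambda>x. J (f n) x - F x)) \<longlonglongrightarrow> 0"
  shows "f \<in> cauchy_seqs E" "AE x in M. limit_fun f x = F x"
proof -
  have J: "J (f n) \<in> l2_funs M" for n using assms(1) by (rule J_l2)
  show f: "f \<in> cauchy_seqs E"
    unfolding cauchy_seqs_def
  proof (safe)
    fix e :: real assume "0 < e"
    then obtain N where N: "\<And>n. n \<ge> N \<Longrightarrow> l2_norm M (\<lambda>x. J (f n) x - F x) < e / 2"
      using LIMSEQ_D[OF assms(3), of "e / 2"] by auto
    have "vdist E (f m) (f n) < e" if "m \<ge> N" "n \<ge> N" for m n
      using N[OF that(1)] N[OF that(2)] l2_norm_diff_triangle[OF J[of m] assms(2) J[of n]]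
        l2_norm_diff_commute[of M "J (f n)" F] by (simp add: vdist_J assms(1))
    then show "\<exists>N. \<forall>m\<ge>N. \<forall>n\<ge>N. vdist E (f m) (f n) < e" by blast
  qed (use assms(1) in auto)
  note F = limit_fun[OF f]
  have "l2_norm M (\<lambda>x. limit_fun f x - F x) \<le> 0"
  proof (rule tendsto_lowerbound)
    show "(\<lambda>n. l2_norm M (\<lambda>x. J (f n) x - limit_fun f x) + l2_norm M (\<lambda>x. J (f n) x - F x)) \<longlonglongrightarrow> 0"
      using tendsto_add[OF F(2) assms(3)] by simp
    show "\<forall>\<^sub>F n in sequentially. l2_norm M (\<lambda>x. limit_fun f x - F x) \<le>
        l2_norm M (\<lambda>x. J (f n) x - limit_fun f x) + l2_norm M (\<lambda>x. J (f n) x - F x)"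
      using l2_norm_diff_triangle[OF F(1) J assms(2)] l2_norm_diff_commute[of M "limit_fun f"] by simp
  qed auto
  then show "AE x in M. limit_fun f x = F x"
    using l2_norm_eq_0_iff[OF F(1) assms(2)] l2_norm_nonneg by (simp add: order_antisym)
qed

lemma cauchy_seqs_add:
  assumes f: "f \<in> cauchy_seqs E" and g: "g \<in> cauchy_seqs E"
  shows "(\<lambda>n. vadd E (f n) (g n)) \<in> cauchy_seqs E"
    "AE x in M. limit_fun (\<lambda>n. vadd E (f n) (g n)) x = limit_fun f x + limit_fun g x"
proof -
  note F = limit_fun[OF f] and G = limit_fun[OF g]
  have c: "f n \<in> vcarrier E" "g n \<in> vcarrier E" for n by (auto intro: cauchy_seqsD f g)
  have "(\<lambda>n. l2_norm M (\<lambda>x. J (vadd E (f n) (g n)) x - (limit_fun f x + limit_fun g x))) \<longlonglongrightarrow> 0"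
  proof (rule Lim_null_comparison)
    show "(\<lambda>n. l2_norm M (\<lambda>x. J (f n) x - limit_fun f x) + l2_norm M (\<lambda>x. J (g n) x - limit_fun g x)) \<longlonglongrightarrow> 0"
      using tendsto_add[OF F(2) G(2)] by simp
    show "\<forall>\<^sub>F n in sequentially. norm (l2_norm M (\<lambda>x. J (vadd E (f n) (g n)) x - (limit_fun f x + limit_fun g x))) \<le>
        l2_norm M (\<lambda>x. J (f n) x - limit_fun f x) + l2_norm M (\<lambda>x. J (g n) x - limit_fun g x)"
    proof (intro always_eventually allI)
      fix n
      have "AE x in M. J (vadd E (f n) (g n)) x - (limit_fun f x + limit_fun g x) =
          (J (f n) x - limit_fun f x) + (J (g n) x - limit_fun g x)"
        using J_add[OF c(1)[of n] c(2)[of n]] by eventually_elim simp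
      from l2_norm_cong_AE[OF this]
      show "norm (l2_norm M (\<lambda>x. J (vadd E (f n) (g n)) x - (limit_fun f x + limit_fun g x))) \<le>
          l2_norm M (\<lambda>x. J (f n) x - limit_fun f x) + l2_norm M (\<lambda>x. J (g n) x - limit_fun g x)"
        using l2_norm_triangle[OF l2_funs_diff[OF J_l2[OF c(1)[of n]] F(1)] l2_funs_diff[OF J_l2[OF c(2)[of n]] G(1)]]
        by simp
    qed
  qed
  from cauchy_seqsI[OF vadd_closed[OF c] l2_funs_add[OF F(1) G(1)] this]
  show "(\<lambda>n. vadd E (f n) (g n)) \<in> cauchy_seqs E"
    "AE x in M. limit_fun (\<lambda>n. vadd E (f n) (g n)) x = limit_fun f x + limit_fun g x" .
qed

lemma cauchy_seqs_scale:
  assumes f: "f \<in> cauchy_seqs E"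
  shows "(\<lambda>n. vscale E c (f n)) \<in> cauchy_seqs E"
    "AE x in M. limit_fun (\<lambda>n. vscale E c (f n)) x = c * limit_fun f x"
proof -
  note F = limit_fun[OF f]
  have c: "f n \<in> vcarrier E" for n by (auto intro: cauchy_seqsD f)
  have "l2_norm M (\<lambda>x. J (vscale E c (f n)) x - c * limit_fun f x) =
      cmod c * l2_norm M (\<lambda>x. J (f n) x - limit_fun f x)" for n
  proof -
    have "AE x in M. J (vscale E c (f n)) x - c * limit_fun f x = c * (J (f n) x - limit_fun f x)"
      using J_scale[OF c[of n], of c] by eventually_elim (simp add: algebra_simps)
    from l2_norm_cong_AE[OF this] show ?thesis
      using l2_norm_sq_scale[OF l2_funsD(1)[OF l2_funs_diff[OF J_l2[OF c[of n]] F(1)]], of c]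
      by (simp add: l2_norm_def enn2real_mult real_sqrt_mult)
  qed
  then have "(\<lambda>n. l2_norm M (\<lambda>x. J (vscale E c (f n)) x - c * limit_fun f x)) \<longlonglongrightarrow> 0"
    using tendsto_mult_right_zero[OF F(2), of "cmod c"] by simp
  from cauchy_seqsI[OF vscale_closed[OF c] l2_funs_scale[OF F(1)] this]
  show "(\<lambda>n. vscale E c (f n)) \<in> cauchy_seqs E"
    "AE x in M. limit_fun (\<lambda>n. vscale E c (f n)) x = c * limit_fun f x" .
qed

lemma vadd_cauchy_class:
  assumes f: "f \<in> cauchy_seqs E" and g: "g \<in> cauchy_seqs E"
  shows "vadd (completion E) (cauchy_class f) (cauchy_class g) = cauchy_class (\<lambda>n. vadd E (f n) (g n))"
proof -
  have "cauchy_class (\<lambda>n. vadd E (f' n) (g' n)) = cauchy_class (\<lambda>n. vadd E (f n) (g n))"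
    if "f' \<in> cauchy_class f" "g' \<in> cauchy_class g" for f' g'
  proof -
    from that have f': "f' \<in> cauchy_seqs E" "AE x in M. limit_fun f x = limit_fun f' x"
      and g': "g' \<in> cauchy_seqs E" "AE x in M. limit_fun g x = limit_fun g' x"
      by (auto simp: cauchy_rel_iff)
    have "AE x in M. limit_fun (\<lambda>n. vadd E (f' n) (g' n)) x = limit_fun (\<lambda>n. vadd E (f n) (g n)) x"
      using cauchy_seqs_add(2)[OF f g] cauchy_seqs_add(2)[OF f'(1) g'(1)] f'(2) g'(2)
      by eventually_elim simp
    then show ?thesis
      by (simp add: cauchy_class_eq_iff cauchy_seqs_add f g f' g')
  qed
  then have "(\<Union>f'\<in>cauchy_class f. \<Union>g'\<in>cauchy_class g. cauchy_class (\<lambda>n. vadd E (f' n) (g' n))) =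
      cauchy_class (\<lambda>n. vadd E (f n) (g n))"
    using cauchy_class_self[OF f] cauchy_class_self[OF g] by (intro SUP_eq_const) blast+
  then show ?thesis by (simp add: completion_def)
qed

lemma vscale_cauchy_class:
  assumes f: "f \<in> cauchy_seqs E"
  shows "vscale (completion E) c (cauchy_class f) = cauchy_class (\<lambda>n. vscale E c (f n))"
proof -
  have "cauchy_class (\<lambda>n. vscale E c (f' n)) = cauchy_class (\<lambda>n. vscale E c (f n))"
    if "f' \<in> cauchy_class f" for f'
  proof -
    from that have f': "f' \<in> cauchy_seqs E" "AE x in M. limit_fun f x = limit_fun f' x"
      by (auto simp: cauchy_rel_iff)
    have "AE x in M. limit_fun (\<lambda>n. vscale E c (f' n)) x = limit_fun (\<lambda>n. vscale E c (f n)) x"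
      using cauchy_seqs_scale(2)[OF f, of c] cauchy_seqs_scale(2)[OF f'(1), of c] f'(2)
      by eventually_elim simp
    then show ?thesis
      by (simp add: cauchy_class_eq_iff cauchy_seqs_scale f f')
  qed
  then have "(\<Union>f'\<in>cauchy_class f. cauchy_class (\<lambda>n. vscale E c (f' n))) = cauchy_class (\<lambda>n. vscale E c (f n))"
    using cauchy_class_self[OF f] by (intro SUP_eq_const) blast+
  then show ?thesis by (simp add: completion_def)
qed

text \<open>The norm of a class is defined as a limit; it exists and is the same for all representatives because
  the norms of the images converge to the norm of the limit.\<close>

lemma vnorm_cauchy_class:
  assumes f: "f \<in> cauchy_seqs E"
  shows "vnorm (completion E) (cauchy_class f) = l2_norm M (limit_fun f)"
proof -
  have "lim (\<lambda>n. vnorm E (f' n)) = l2_norm M (limit_fun f)" if "f' \<in> cauchy_class f" for f'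
  proof -
    from that have f': "f' \<in> cauchy_seqs E" "AE x in M. limit_fun f x = limit_fun f' x"
      by (auto simp: cauchy_rel_iff)
    have c: "f' n \<in> vcarrier E" for n using f'(1) by (rule cauchy_seqsD)
    note F = limit_fun[OF f'(1)]
    have "(\<lambda>n. l2_norm M (J (f' n))) \<longlonglongrightarrow> l2_norm M (limit_fun f')"
    proof (rule LIM_zero_cancel, rule Lim_null_comparison)
      show "(\<lambda>n. l2_norm M (\<lambda>x. J (f' n) x - limit_fun f' x)) \<longlonglongrightarrow> 0" by (rule F(2))
      show "\<forall>\<^sub>F n in sequentially. norm (l2_norm M (J (f' n)) - l2_norm M (limit_fun f'))
          \<le> l2_norm M (\<lambda>x. J (f' n) x - limit_fun f' x)"
      proof (intro always_eventually allI)
        fix n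
        show "norm (l2_norm M (J (f' n)) - l2_norm M (limit_fun f'))
          \<le> l2_norm M (\<lambda>x. J (f' n) x - limit_fun f' x)"
          using l2_norm_triangle[OF l2_funs_diff[OF J_l2[OF c[of n]] F(1)] F(1)]
            l2_norm_triangle[OF l2_funs_diff[OF F(1) J_l2[OF c[of n]]] J_l2[OF c[of n]]]
            l2_norm_diff_commute[of M "J (f' n)" "limit_fun f'"]
          by (simp add: abs_le_iff)
      qed
    qed
    then have "(\<lambda>n. vnorm E (f' n)) \<longlonglongrightarrow> l2_norm M (limit_fun f)"
      using l2_norm_cong_AE[OF f'(2)] by (simp add: vnorm_J c)
    then show ?thesis by (rule limI)
  qed
  then have "(\<lambda>f. lim (\<lambda>n. vnorm E (f n))) ` cauchy_class f = {l2_norm M (limit_fun f)}"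
    using cauchy_class_self[OF f] by auto
  then show ?thesis by (simp add: completion_def)
qed

lemma vdist_cauchy_class:
  assumes f: "f \<in> cauchy_seqs E" and g: "g \<in> cauchy_seqs E"
  shows "vdist (completion E) (cauchy_class f) (cauchy_class g) =
    l2_norm M (\<lambda>x. limit_fun f x - limit_fun g x)"
proof -
  note g' = cauchy_seqs_scale[OF g, of "-1"]
  note fg = cauchy_seqs_add[OF f g'(1)]
  have "AE x in M. limit_fun (\<lambda>n. vadd E (f n) (vscale E (-1) (g n))) x = limit_fun f x - limit_fun g x"
    using g'(2) fg(2) by eventually_elim simp
  from l2_norm_cong_AE[OF this] show ?thesis
    unfolding vdist_def
    by (simp add: vscale_cauchy_class[OF g] vadd_cauchy_class[OF f g'(1)] vnorm_cauchy_class[OF fg(1)])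
qed

lemma cauchy_seqs_const:
  assumes "u \<in> vcarrier E"
  shows "(\<lambda>_. u) \<in> cauchy_seqs E" "AE x in M. limit_fun (\<lambda>_. u) x = J u x"
  using cauchy_seqsI[of "\<lambda>_. u" "J u"] assms J_l2[OF assms] by (auto simp: l2_norm_def l2_norm_sq_def)

definition extension :: "(nat \<Rightarrow> 'v) set \<Rightarrow> ('x \<Rightarrow> complex) set" where
  "extension = (\<lambda>A\<in>vcarrier (completion E). l2_class M (limit_fun (SOME f. f \<in> A)))"

lemma extension_cauchy_class:
  assumes f: "f \<in> cauchy_seqs E"
  shows "extension (cauchy_class f) = l2_class M (limit_fun f)"
proof -
  have "(SOME f'. f' \<in> cauchy_class f) \<in> cauchy_class f"
    using someI[of "\<lambda>f'. f' \<in> cauchy_class f", OF cauchy_class_self[OF f]] .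
  then have "l2_class M (limit_fun (SOME f'. f' \<in> cauchy_class f)) = l2_class M (limit_fun f)"
    by (subst l2_class_eq_iff) (auto simp: cauchy_rel_iff limit_fun(1))
  then show ?thesis
    using cauchy_class_carrier[OF f] by (simp add: extension_def)
qed

lemma extension_to_completion:
  assumes "u \<in> vcarrier E"
  shows "extension (to_completion E u) = l2_class M (J u)"
  using cauchy_seqs_const[OF assms]
  by (simp add: to_completion_def extension_cauchy_class l2_class_eq_iff limit_fun(1) J_l2 assms)

lemma linear_map_extension: "linear_map (completion E) (L2_space M) extension"
  unfolding linear_map_def
proof (intro conjI ballI allI funcsetI)
  fix A assume "A \<in> vcarrier (completion E)"
  then show "extension A \<in> vcarrier (L2_space M)"
    by (elim completion_cases) (simp add: extension_cauchy_class l2_class_carrier limit_fun)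
next
  fix A B assume "A \<in> vcarrier (completion E)" "B \<in> vcarrier (completion E)"
  then obtain f g where f: "f \<in> cauchy_seqs E" "A = cauchy_class f"
    and g: "g \<in> cauchy_seqs E" "B = cauchy_class g"
    by (metis completion_cases)
  note s = cauchy_seqs_add[OF f(1) g(1)]
  show "extension (vadd (completion E) A B) = vadd (L2_space M) (extension A) (extension B)"
    by (simp add: f g vadd_cauchy_class extension_cauchy_class s vadd_l2_class limit_fun
        l2_class_eq_iff l2_funs_add)
next
  fix c A assume "A \<in> vcarrier (completion E)"
  then obtain f where f: "f \<in> cauchy_seqs E" "A = cauchy_class f"
    by (metis completion_cases)
  note s = cauchy_seqs_scale[OF f(1), of c]
  show "extension (vscale (completion E) c A) = vscale (L2_space M) c (extension A)"
    by (simp add: f vscale_cauchy_class extension_cauchy_class s vscale_l2_class limit_fun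
        l2_class_eq_iff l2_funs_scale)
qed

lemma isometric_map_extension: "isometric_map (completion E) (L2_space M) extension"
  unfolding isometric_map_def
proof (intro conjI ballI PiE_I)
  fix A assume "A \<in> vcarrier (completion E)"
  then show "extension A \<in> vcarrier (L2_space M)"
    using linear_map_extension by (auto simp: linear_map_def)
next
  fix A assume "A \<notin> vcarrier (completion E)"
  then show "extension A = undefined" by (simp add: extension_def)
next
  fix A B assume "A \<in> vcarrier (completion E)" "B \<in> vcarrier (completion E)"
  then show "vdist (L2_space M) (extension A) (extension B) = vdist (completion E) A B"
    by (elim completion_cases)
      (simp add: extension_cauchy_class vdist_l2_class vdist_cauchy_class limit_fun)
qed

text \<open>The classes of constant sequences are dense in the completion, and two continuous maps that agree on
  a dense set are equal.\<close>

lemma extension_unique: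
  assumes T: "isometric_map (completion E) (L2_space M) T"
    and ext: "\<And>u. u \<in> vcarrier E \<Longrightarrow> T (to_completion E u) = l2_class M (J u)"
  shows "T = extension"
proof (rule extensionalityI[where A = "vcarrier (completion E)"])
  show "T \<in> extensional (vcarrier (completion E))" "extension \<in> extensional (vcarrier (completion E))"
    using T isometric_map_extension by (auto simp: isometric_map_def PiE_def)
  fix A assume A: "A \<in> vcarrier (completion E)"
  then obtain f where f: "f \<in> cauchy_seqs E" "A = cauchy_class f"
    by (metis completion_cases)
  have TA: "T A \<in> vcarrier (L2_space M)"
    using T A by (auto simp: isometric_map_def)
  then obtain F where F: "F \<in> l2_funs M" "T A = l2_class M F"
    by (metis L2_space_cases)
  note L = limit_fun[OF f(1)]
  have c: "f n \<in> vcarrier E" for n using f(1) by (rule cauchy_seqsD)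
  have eq: "l2_norm M (\<lambda>x. J (f n) x - F x) = l2_norm M (\<lambda>x. J (f n) x - limit_fun f x)" for n
  proof -
    note k = cauchy_seqs_const[OF c[of n]]
    have carr: "to_completion E (f n) \<in> vcarrier (completion E)"
      unfolding to_completion_def by (rule cauchy_class_carrier[OF k(1)])
    have "l2_norm M (\<lambda>x. J (f n) x - F x) = vdist (L2_space M) (T (to_completion E (f n))) (T A)"
      by (simp add: ext c F vdist_l2_class J_l2)
    also have "\<dots> = vdist (completion E) (to_completion E (f n)) A"
      using T A carr by (simp add: isometric_map_def)
    also have "\<dots> = l2_norm M (\<lambda>x. limit_fun (\<lambda>_. f n) x - limit_fun f x)"
      by (simp add: to_completion_def f vdist_cauchy_class k)
    also have "\<dots> = l2_norm M (\<lambda>x. J (f n) x - limit_fun f x)"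
      by (rule l2_norm_cong_AE) (use k(2) in auto)
    finally show ?thesis .
  qed
  have "(\<lambda>n. l2_norm M (\<lambda>x. J (f n) x - F x)) \<longlonglongrightarrow> 0"
    unfolding eq by (rule L(2))
  from cauchy_seqsI(2)[OF c F(1) this]
  have "l2_class M F = l2_class M (limit_fun f)"
    by (subst l2_class_eq_iff[OF F(1) L(1)]) (auto elim: eventually_mono)
  then show "T A = extension A"
    unfolding F(2) unfolding f(2) extension_cauchy_class[OF f(1)] .
qed

end

section \<open>Integrals depending on a parameter\<close>

text \<open>In a first-countable space it suffices to test a limit on sequences.\<close>

lemma integral_dominated_convergence_within:
  fixes f :: "'b::first_countable_topology \<Rightarrow> 'a \<Rightarrow> 'c::{banach, second_countable_topology}"
  assumes [measurable]: "\<And>t. t \<in> S \<Longrightarrow> f t \<in> borel_measurable M" "g \<in> borel_measurable M"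
    and w: "integrable M w"
    and lim: "AE x in M. ((\<lambda>t. f t x) \<longlongrightarrow> g x) (at a within S)"
    and bound: "\<And>t. t \<in> S \<Longrightarrow> t \<noteq> a \<Longrightarrow> AE x in M. norm (f t x) \<le> w x"
  shows "((\<lambda>t. \<integral>x. f t x \<partial>M) \<longlongrightarrow> (\<integral>x. g x \<partial>M)) (at a within S)"
  unfolding tendsto_at_iff_sequentially
proof (intro allI impI)
  fix X :: "nat \<Rightarrow> 'b" assume X: "\<forall>i. X i \<in> S - {a}" "X \<longlonglongrightarrow> a"
  have "(\<lambda>i. \<integral>x. f (X i) x \<partial>M) \<longlonglongrightarrow> (\<integral>x. g x \<partial>M)"
  proof (rule integral_dominated_convergence)
    show "AE x in M. (\<lambda>i. f (X i) x) \<longlonglongrightarrow> g x"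
      using lim by eventually_elim (use X in \<open>auto simp: tendsto_at_iff_sequentially o_def\<close>)
  qed (use X w bound in auto)
  then show "((\<lambda>t. \<integral>x. f t x \<partial>M) \<circ> X) \<longlonglongrightarrow> (\<integral>x. g x \<partial>M)" by (simp add: o_def)
qed

lemma has_vector_derivative_within_quotient:
  fixes f :: "real \<Rightarrow> 'a::real_normed_vector"
  shows "(f has_vector_derivative D) (at x within S) \<longleftrightarrow>
    ((\<lambda>y. (f y - f x) /\<^sub>R (y - x)) \<longlongrightarrow> D) (at x within S)"
proof -
  have "((\<lambda>y. norm (f y - f x - (y - x) *\<^sub>R D) / norm (y - x)) \<longlongrightarrow> 0) (at x within S) \<longleftrightarrow>
      ((\<lambda>y. norm ((f y - f x) /\<^sub>R (y - x) - D)) \<longlongrightarrow> 0) (at x within S)"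
  proof (rule Lim_cong_within)
    fix y assume "y \<noteq> x"
    then have "(f y - f x) /\<^sub>R (y - x) - D = (f y - f x - (y - x) *\<^sub>R D) /\<^sub>R (y - x)"
      by (simp add: scaleR_diff_right)
    then show "norm (f y - f x - (y - x) *\<^sub>R D) / norm (y - x) = norm ((f y - f x) /\<^sub>R (y - x) - D)"
      by (simp add: divide_inverse mult.commute)
  qed auto
  then show ?thesis
    unfolding has_vector_derivative_def has_derivative_iff_norm
    by (simp add: bounded_linear_scaleR_left tendsto_norm_zero_iff LIM_zero_iff)
qed

lemma norm_diff_le_of_vector_derivative:
  fixes f :: "real \<Rightarrow> 'a::real_normed_vector"
  assumes "convex S" "x \<in> S" "y \<in> S"
    and deriv: "\<And>t. t \<in> S \<Longrightarrow> (f has_vector_derivative f' t) (at t within S)"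
    and bound: "\<And>t. t \<in> S \<Longrightarrow> norm (f' t) \<le> B"
  shows "norm (f x - f y) \<le> B * \<bar>x - y\<bar>"
proof -
  have "norm (f x - f y) \<le> B * norm (x - y)"
  proof (rule differentiable_bound[OF assms(1)])
    fix t assume t: "t \<in> S"
    show "(f has_derivative (\<lambda>h. h *\<^sub>R f' t)) (at t within S)"
      using deriv[OF t] by (simp add: has_vector_derivative_def)
    show "onorm (\<lambda>h. h *\<^sub>R f' t) \<le> B"
      using bound[OF t] onorm_scaleR_left[OF bounded_linear_ident, of "f' t"] by (simp add: onorm_id)
  qed (use assms in auto)
  then show ?thesis by simp
qed

text \<open>By the mean value inequality \<open>B\<close> dominates the difference quotients, so that the limit may be taken under
  the integral sign.\<close>

lemma has_vector_derivative_integral: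
  fixes f f' :: "real \<Rightarrow> 'a \<Rightarrow> 'b::{banach, second_countable_topology}"
  assumes S: "convex S" "t0 \<in> S"
    and int: "\<And>t. t \<in> S \<Longrightarrow> integrable M (f t)"
    and [measurable]: "f' t0 \<in> borel_measurable M"
    and deriv: "\<And>t x. t \<in> S \<Longrightarrow> x \<in> space M \<Longrightarrow> ((\<lambda>t. f t x) has_vector_derivative f' t x) (at t within S)"
    and bound: "\<And>t x. t \<in> S \<Longrightarrow> x \<in> space M \<Longrightarrow> norm (f' t x) \<le> B x"
    and B: "integrable M B"
  shows "((\<lambda>t. \<integral>x. f t x \<partial>M) has_vector_derivative (\<integral>x. f' t0 x \<partial>M)) (at t0 within S)"
proof -
  have [measurable]: "t \<in> S \<Longrightarrow> f t \<in> borel_measurable M" for t using int by auto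
  have "((\<lambda>t. \<integral>x. (f t x - f t0 x) /\<^sub>R (t - t0) \<partial>M) \<longlongrightarrow> (\<integral>x. f' t0 x \<partial>M)) (at t0 within S)"
  proof (rule integral_dominated_convergence_within[OF _ _ B])
    show "AE x in M. ((\<lambda>t. (f t x - f t0 x) /\<^sub>R (t - t0)) \<longlongrightarrow> f' t0 x) (at t0 within S)"
      using deriv[OF S(2)] by (auto simp: has_vector_derivative_within_quotient)
    show "AE x in M. norm ((f t x - f t0 x) /\<^sub>R (t - t0)) \<le> B x" if "t \<in> S" "t \<noteq> t0" for t
    proof (rule AE_I2)
      fix x assume x: "x \<in> space M"
      have "norm (f t x - f t0 x) \<le> B x * \<bar>t - t0\<bar>"
        by (rule norm_diff_le_of_vector_derivative[OF S(1) that(1) S(2)]) (use deriv bound x in auto)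
      then show "norm ((f t x - f t0 x) /\<^sub>R (t - t0)) \<le> B x"
        using that(2) unfolding norm_scaleR by (simp add: field_simps)
    qed
  qed (use S(2) in measurable)
  moreover have "(\<integral>x. (f t x - f t0 x) /\<^sub>R (t - t0) \<partial>M) = ((\<integral>x. f t x \<partial>M) - (\<integral>x. f t0 x \<partial>M)) /\<^sub>R (t - t0)"
    if "t \<in> S" for t
    using int[OF that] int[OF S(2)] by simp
  ultimately have "((\<lambda>t. ((\<integral>x. f t x \<partial>M) - (\<integral>x. f t0 x \<partial>M)) /\<^sub>R (t - t0)) \<longlongrightarrow> (\<integral>x. f' t0 x \<partial>M)) (at t0 within S)"
    by (subst (asm) Lim_cong_within[where g = "\<lambda>t. ((\<integral>x. f t x \<partial>M) - (\<integral>x. f t0 x \<partial>M)) /\<^sub>R (t - t0)"]) auto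
  then show ?thesis by (simp add: has_vector_derivative_within_quotient)
qed

section \<open>Integrals of derivatives\<close>

lemma integral_translate:
  fixes f :: "'a::euclidean_space \<Rightarrow> 'b::{banach, second_countable_topology}"
  assumes [measurable]: "f \<in> borel_measurable borel"
  shows "(\<integral>x. f (c + x) \<partial>lborel) = (\<integral>x. f x \<partial>lborel)"
  using integral_distr[of "(+) c" lborel borel f] by (simp add: lborel_distr_plus)

lemma integrable_translate:
  fixes f :: "'a::euclidean_space \<Rightarrow> 'b::{banach, second_countable_topology}"
  assumes "integrable lborel f"
  shows "integrable lborel (\<lambda>x. f (c + x))"
proof -
  have [measurable]: "f \<in> borel_measurable borel"
    using borel_measurable_integrable[OF assms] by simp
  show ?thesis
    using integrable_distr_eq[of "(+) c" lborel borel f] assms by (simp add: lborel_distr_plus)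
qed

text \<open>The derivative along \<open>b\<close>, averaged over a unit segment in direction \<open>b\<close>, is a difference of two
  translates, whose integral vanishes.\<close>

lemma integral_directional_derivative_eq_0:
  fixes f f' :: "'a::euclidean_space \<Rightarrow> complex"
  assumes deriv: "\<And>x t. ((\<lambda>t. f (t *\<^sub>R b + x)) has_vector_derivative f' (t *\<^sub>R b + x)) (at t)"
    and cont: "continuous_on UNIV f'"
    and f: "integrable lborel f" and f': "integrable lborel f'"
  shows "(\<integral>x. f' x \<partial>lborel) = 0"
proof -
  have m[measurable]: "f' \<in> borel_measurable borel" "f \<in> borel_measurable borel"
    using borel_measurable_integrable[OF f] borel_measurable_integrable[OF f'] by auto
  have int: "integrable (lborel \<Otimes>\<^sub>M lborel) (\<lambda>(t::real, x). indicator {0..1} t *\<^sub>R f' (t *\<^sub>R b + x))"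
  proof (rule lborel_pair.Fubini_integrable)
    have "(\<integral>x. norm (f' (t *\<^sub>R b + x)) \<partial>lborel) = (\<integral>x. norm (f' x) \<partial>lborel)" for t :: real
      using integral_translate[of "\<lambda>x. norm (f' x)" "t *\<^sub>R b"] by simp
    then show "integrable lborel (\<lambda>t. \<integral>x. norm (case (t::real, x) of (t, x) \<Rightarrow> indicator {0..1} t *\<^sub>R f' (t *\<^sub>R b + x)) \<partial>lborel)"
      by simp
    show "AE t::real in lborel. integrable lborel (\<lambda>x. case (t, x) of (t, x) \<Rightarrow> indicator {0..1} t *\<^sub>R f' (t *\<^sub>R b + x))"
      using integrable_translate[OF f'] by auto
  qed measurable
  have "f (b + x) - f x = (\<integral>t. indicator {0..1} t *\<^sub>R f' (t *\<^sub>R b + x) \<partial>lborel)" for x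
  proof -
    have "(\<integral>t. indicator {0..1} t *\<^sub>R f' (t *\<^sub>R b + x) \<partial>lborel) = f (1 *\<^sub>R b + x) - f (0 *\<^sub>R b + x)"
    proof (rule integral_FTC_Icc)
      show "((\<lambda>t. f (t *\<^sub>R b + x)) has_vector_derivative f' (t *\<^sub>R b + x)) (at t within {0..1})" for t :: real
        by (rule has_vector_derivative_at_within[OF deriv])
      show "continuous_on {0..1} (\<lambda>t::real. f' (t *\<^sub>R b + x))"
        by (rule continuous_on_compose2[OF cont]) (auto intro!: continuous_intros)
    qed auto
    then show ?thesis by simp
  qed
  moreover have "(\<integral>x. f (b + x) - f x \<partial>lborel) = 0"
    using integral_translate[of f b] integrable_translate[OF f, of b] f by simp
  ultimately have "0 = (\<integral>x. (\<integral>t. indicator {0..1} t *\<^sub>R f' (t *\<^sub>R b + x) \<partial>lborel) \<partial>lborel)"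
    by simp
  also have "\<dots> = (\<integral>t. (\<integral>x. indicator {0..1} t *\<^sub>R f' (t *\<^sub>R b + x) \<partial>lborel) \<partial>lborel)"
    using lborel_pair.Fubini_integral[OF int] .
  also have "\<dots> = (\<integral>t. indicator {0..1::real} t *\<^sub>R (\<integral>x. f' x \<partial>lborel) \<partial>lborel)"
    using integral_translate[of f'] by simp
  also have "\<dots> = (\<integral>x. f' x \<partial>lborel)" by simp
  finally show ?thesis by simp
qed

lemma integral_derivative_atLeast:
  fixes F f :: "real \<Rightarrow> complex"
  assumes deriv: "\<And>x. x > a \<Longrightarrow> (F has_vector_derivative f x) (at x)"
    and cont: "continuous_on {a<..} f"
    and int: "set_integrable lborel {a<..} f"
    and A: "(F \<longlongrightarrow> A) (at_right a)" and B: "(F \<longlongrightarrow> B) at_top"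
  shows "(LINT x:{a<..}|lborel. f x) = B - A"
proof -
  have eq: "einterval (ereal a) \<infinity> = {a<..}" by (auto simp: einterval_def)
  have "(LBINT x=ereal a..\<infinity>. f x) = B - A"
  proof (rule interval_integral_FTC_integrable)
    show "isCont f x" if "ereal a < ereal x" for x
      using cont that by (simp add: continuous_on_eq_continuous_at)
  qed (use assms in \<open>auto simp: eq ereal_tendsto_simps\<close>)
  then show ?thesis by (simp add: interval_lebesgue_integral_def eq)
qed

lemma integrable_inverse_1_plus_sq: "integrable lborel (\<lambda>x::real. 1 / (1 + x\<^sup>2))"
  using integrable_inverse_1_plus_square by (simp add: set_integrable_def einterval_def inverse_eq_divide)

section \<open>Laplace transform of a power\<close>

lemma set_integrable_powr_exp:
  fixes q m :: real
  assumes "0 < q" "0 < m"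
  shows "set_integrable lborel {0<..} (\<lambda>t. t powr (q - 1) * exp (- (m * t)))"
proof -
  have "(\<lambda>t. complex_of_real t powr (complex_of_real q - 1) / of_real (exp (m * t))) absolutely_integrable_on {0<..}"
    using absolutely_integrable_Gamma_integral[of "complex_of_real q" m] assms by simp
  then have "set_integrable lebesgue {0<..} (\<lambda>t. norm (complex_of_real t powr (complex_of_real q - 1) / of_real (exp (m * t))))"
    by (rule absolutely_integrable_norm[unfolded o_def])
  moreover have "norm (complex_of_real t powr (complex_of_real q - 1) / of_real (exp (m * t))) = t powr (q - 1) * exp (- (m * t))"
    if "t \<in> {0<..}" for t
    using that by (simp add: norm_divide norm_powr_real_powr exp_minus field_simps)
  ultimately have "set_integrable lebesgue {0<..} (\<lambda>t. t powr (q - 1) * exp (- (m * t)))"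
    by (subst (asm) set_integrable_cong[OF refl refl]) auto
  then show ?thesis
    by (simp add: set_integrable_def integrable_completion)
qed

lemma set_integrable_powr_cexp:
  fixes q :: real and c :: complex
  assumes "0 < q" "0 < Re c"
  shows "set_integrable lborel {0<..} (\<lambda>t. of_real (t powr (q - 1)) * exp (- c * of_real t))"
  unfolding set_integrable_def
proof (rule Bochner_Integration.integrable_bound[OF set_integrable_powr_exp[OF assms, unfolded set_integrable_def]])
  show "AE t in lborel. norm (indicator {0<..} t *\<^sub>R (complex_of_real (t powr (q - 1)) * exp (- c * of_real t)))
      \<le> norm (indicator {0<..} t *\<^sub>R (t powr (q - 1) * exp (- (Re c * t))))"
    by (auto simp: indicator_def norm_mult)
qed measurable

text \<open>Integration by parts; the boundary terms vanish because \<open>p\<close> and the real part of \<open>c\<close> are positive.\<close>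

lemma powr_exp_recurrence:
  fixes p :: real and c :: complex
  assumes p: "0 < p" and c: "0 < Re c"
  shows "c * (LINT t:{0<..}|lborel. of_real (t powr p) * exp (- c * of_real t)) =
    of_real p * (LINT t:{0<..}|lborel. of_real (t powr (p - 1)) * exp (- c * of_real t))"
proof -
  let ?F = "\<lambda>t. complex_of_real (t powr p) * exp (- c * of_real t)"
  let ?G = "\<lambda>t. complex_of_real (t powr (p - 1)) * exp (- c * of_real t)"
  have iF: "set_integrable lborel {0<..} ?F"
    using set_integrable_powr_cexp[of "p + 1" c] p c by simp
  have iG: "set_integrable lborel {0<..} ?G"
    using set_integrable_powr_cexp[of p c] p c by simp
  have n: "norm (?F t) = t powr p * exp (- (Re c * t))" for t
    by (simp add: norm_mult)
  have "(LINT t:{0<..}|lborel. of_real p * ?G t - c * ?F t) = 0 - 0"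
  proof (rule integral_derivative_atLeast)
    fix t :: real assume t: "t > 0"
    have "((\<lambda>t. complex_of_real (t powr p)) has_vector_derivative of_real (p * t powr (p - 1))) (at t)"
      using has_real_derivative_powr[OF t, of p]
      by (intro has_vector_derivative_of_real) (simp add: has_real_derivative_iff_has_vector_derivative)
    moreover have "((\<lambda>t. exp (- c * of_real t)) has_vector_derivative - c * exp (- c * of_real t)) (at t)"
      by (rule has_vector_derivative_real_field) (auto intro!: derivative_eq_intros)
    ultimately have "(?F has_vector_derivative
        of_real (t powr p) * (- c * exp (- c * of_real t)) + of_real (p * t powr (p - 1)) * exp (- c * of_real t)) (at t)"
      by (rule has_vector_derivative_mult)
    then show "(?F has_vector_derivative of_real p * ?G t - c * ?F t) (at t)"
      by (simp add: algebra_simps)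
  next
    show "continuous_on {0<..} (\<lambda>t. of_real p * ?G t - c * ?F t)"
      by (intro continuous_intros) auto
    show "set_integrable lborel {0<..} (\<lambda>t. of_real p * ?G t - c * ?F t)"
      using iF iG by (intro set_integral_diff set_integrable_mult_right) auto
    show "(?F \<longlongrightarrow> 0) (at_right 0)"
    proof (rule tendsto_norm_zero_cancel)
      show "((\<lambda>t. norm (?F t)) \<longlongrightarrow> 0) (at_right 0)"
        unfolding n using p c by real_asymp
    qed
    show "(?F \<longlongrightarrow> 0) at_top"
    proof (rule tendsto_norm_zero_cancel)
      show "((\<lambda>t. norm (?F t)) \<longlongrightarrow> 0) at_top"
        unfolding n using p c by real_asymp
    qed
  qed
  then show ?thesis
    using iF iG by (simp add: set_integral_diff set_integrable_mult_right)
qed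

lemma Re_segment_from_1:
  fixes c :: complex
  assumes "0 < Re c" "0 \<le> t" "t \<le> 1"
  shows "min 1 (Re c) \<le> Re (1 + of_real t * (c - 1))"
proof -
  have "Re (1 + of_real t * (c - 1)) = (1 - t) * 1 + t * Re c"
    by (simp add: algebra_simps)
  also have "\<dots> \<ge> (1 - t) * min 1 (Re c) + t * min 1 (Re c)"
    using assms by (intro add_mono mult_left_mono) auto
  finally show ?thesis by (simp add: algebra_simps)
qed

lemma has_vector_derivative_powr_segment:
  fixes c a :: complex
  assumes "0 < Re c" "0 \<le> t" "t \<le> 1"
  shows "((\<lambda>t. (1 + of_real t * (c - 1)) powr a) has_vector_derivative
    (c - 1) * (a * (1 + of_real t * (c - 1)) powr (a - 1))) (at t within S)"
proof -
  have "1 + of_real t * (c - 1) \<notin> \<real>\<^sub>\<le>\<^sub>0"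
    using Re_segment_from_1[OF assms] assms(1) by (auto simp: complex_nonpos_Reals_iff min_def split: if_splits)
  then have "((\<lambda>z. z powr a) has_field_derivative a * (1 + of_real t * (c - 1)) powr (a - 1)) (at (1 + of_real t * (c - 1)))"
    by (rule has_field_derivative_powr)
  moreover have "((\<lambda>t. 1 + of_real t * (c - 1)) has_vector_derivative (c - 1)) (at t within S)"
    by (auto intro!: derivative_eq_intros)
  ultimately show ?thesis
    using field_vector_diff_chain_within[of "\<lambda>t. 1 + of_real t * (c - 1)" "c - 1" t S "\<lambda>z. z powr a"]
    by (auto simp: o_def intro: has_field_derivative_at_within)
qed

text \<open>Both sides, as functions of \<open>c\<close>, satisfy the equation \<open>c L' = - p L\<close>; for the integral this is the
  recurrence above. They agree at \<open>c = 1\<close> and are compared along the segment from \<open>1\<close> to \<open>c\<close>.\<close>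

lemma laplace_powr:
  fixes p :: real and c :: complex
  assumes p: "0 < p" and c: "0 < Re c"
  shows "(LINT t:{0<..}|lborel. of_real (t powr (p - 1)) * exp (- c * of_real t)) =
    of_real (Gamma p) * c powr (- of_real p)"
proof -
  define z where "z t = 1 + complex_of_real t * (c - 1)" for t
  define L where "L t = (LINT x:{0<..}|lborel. of_real (x powr (p - 1)) * exp (- z t * of_real x))" for t
  define L' where "L' t = (LINT x:{0<..}|lborel. of_real (x powr p) * exp (- z t * of_real x))" for t
  define m where "m = min 1 (Re c)"
  have m: "0 < m" using c by (simp add: m_def)
  have Rez: "m \<le> Re (z t)" if "t \<in> {0..1}" for t
    unfolding m_def z_def using Re_segment_from_1[OF c] that by auto
  have dL: "(L has_vector_derivative (- (c - 1) * L' t)) (at t within {0..1})" if t: "t \<in> {0..1}" for t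
  proof -
    let ?f = "\<lambda>t x. indicator {0<..} x *\<^sub>R (complex_of_real (x powr (p - 1)) * exp (- z t * of_real x))"
    let ?f' = "\<lambda>t x. indicator {0<..} x *\<^sub>R (- (c - 1) * (complex_of_real (x powr p) * exp (- z t * of_real x)))"
    have "((\<lambda>t. \<integral>x. ?f t x \<partial>lborel) has_vector_derivative (\<integral>x. ?f' t x \<partial>lborel)) (at t within {0..1})"
    proof (rule has_vector_derivative_integral)
      show "integrable lborel (?f t)" if "t \<in> {0..1}" for t
        using set_integrable_powr_cexp[of p "z t"] p m Rez[OF that] by (simp add: set_integrable_def)
      show "((\<lambda>t. ?f t x) has_vector_derivative ?f' t x) (at t within {0..1})" for t x
      proof (cases "x > 0")
        case True
        have "((\<lambda>t. exp (- (1 + complex_of_real t * (c - 1)) * of_real x)) has_vector_derivative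
            - (c - 1) * of_real x * exp (- (1 + complex_of_real t * (c - 1)) * of_real x)) (at t within {0..1})"
          by (rule has_vector_derivative_real_field) (auto intro!: derivative_eq_intros)
        from has_vector_derivative_mult_right[OF this, of "of_real (x powr (p - 1))"]
        have "((\<lambda>t. of_real (x powr (p - 1)) * exp (- z t * of_real x)) has_vector_derivative
            of_real (x powr (p - 1)) * (- (c - 1) * of_real x * exp (- z t * of_real x))) (at t within {0..1})"
          by (simp only: z_def)
        also have "of_real (x powr (p - 1)) * (- (c - 1) * of_real x * exp (- z t * of_real x)) =
            - (c - 1) * (of_real (x powr p) * exp (- z t * of_real x))"
        proof -
          have "x powr p = x powr (p - 1) * x" using True by (simp add: powr_diff)
          then show ?thesis by simp
        qed
        finally show ?thesis using True by simp
      qed simp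
      show "norm (?f' t x) \<le> cmod (c - 1) * (indicator {0<..} x *\<^sub>R (x powr (p + 1 - 1) * exp (- (m * x))))"
        if "t \<in> {0..1}" for t x
        using Rez[OF that] by (auto simp: indicator_def norm_mult norm_minus_commute[of 1 c] intro!: mult_left_mono)
      show "integrable lborel (\<lambda>x. cmod (c - 1) * (indicator {0<..} x *\<^sub>R (x powr (p + 1 - 1) * exp (- (m * x)))))"
        using set_integrable_powr_exp[of "p + 1" m] p m by (intro integrable_mult_right) (simp add: set_integrable_def)
    qed (use t in auto)
    moreover have "(\<integral>x. ?f' t x \<partial>lborel) = - (c - 1) * L' t"
      unfolding L'_def set_lebesgue_integral_def by (subst integral_mult_right_zero[symmetric]) (simp add: ac_simps)
    ultimately show ?thesis
      unfolding L_def set_lebesgue_integral_def by simp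
  qed
  have rec: "z t * L' t = of_real p * L t" if "t \<in> {0..1}" for t
    unfolding L_def L'_def using p m Rez[OF that] by (intro powr_exp_recurrence) auto
  have "((\<lambda>t. z t powr of_real p * L t) has_vector_derivative 0) (at t within {0..1})" if t: "t \<in> {0..1}" for t
  proof -
    have nz: "z t \<noteq> 0" using Rez[OF t] m by auto
    have "((\<lambda>t. z t powr of_real p * L t) has_vector_derivative
        z t powr of_real p * (- (c - 1) * L' t) + (c - 1) * (of_real p * z t powr (of_real p - 1)) * L t) (at t within {0..1})"
      using has_vector_derivative_powr_segment[OF c, of t "of_real p"] t
      by (intro has_vector_derivative_mult dL) (auto simp: z_def)
    also have "z t powr of_real p = z t powr (of_real p - 1) * z t"
      using nz by (simp add: powr_diff)
    also have "z t powr (of_real p - 1) * z t * (- (c - 1) * L' t) + (c - 1) * (of_real p * z t powr (of_real p - 1)) * L t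
        = (c - 1) * z t powr (of_real p - 1) * (of_real p * L t - z t * L' t)"
      by (simp add: algebra_simps)
    also have "\<dots> = 0" by (simp only: rec[OF t]) simp
    finally show ?thesis .
  qed
  then obtain k where k: "\<And>t. t \<in> {0..1} \<Longrightarrow> z t powr of_real p * L t = k"
    using has_vector_derivative_zero_constant[of "{0..1}" "\<lambda>t. z t powr of_real p * L t"] by auto
  have "L 0 = (LINT x:{0<..}|lborel. of_real (x powr (p - 1) / exp x))"
    unfolding L_def z_def by (intro set_lebesgue_integral_cong) (auto simp: exp_minus divide_inverse exp_of_real)
  also have "\<dots> = of_real (LINT x:{0<..}|lborel. x powr (p - 1) / exp x)"
    by (rule set_integral_complex_of_real)
  also have "(LINT x:{0<..}|lborel. x powr (p - 1) / exp x) = Gamma p"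
  proof -
    have eq: "indicator {0<..} x *\<^sub>R (x powr (p - 1) / exp x) = indicator {0..} x * x powr (p - 1) / exp x" for x :: real
      by (auto simp: indicator_def)
    have "(\<integral>x. indicator {0..} x * x powr (p - 1) / exp x \<partial>lborel) =
        enn2real (\<integral>\<^sup>+x. ennreal (indicator {0..} x * x powr (p - 1) / exp x) \<partial>lborel)"
      by (rule integral_eq_nn_integral) auto
    also have "\<dots> = Gamma p"
      using Gamma_real_pos[OF p] by (simp flip: Gamma_conv_nn_integral_real[OF p])
    finally show ?thesis by (simp only: set_lebesgue_integral_def eq)
  qed
  finally have "L 0 = of_real (Gamma p)" .
  then have "k = of_real (Gamma p)"
    using k[of 0] by (simp add: z_def)
  then have "c powr of_real p * L 1 = of_real (Gamma p)"
    using k[of 1] by (simp add: z_def)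
  moreover have "c \<noteq> 0" using c by auto
  ultimately have "L 1 = of_real (Gamma p) * c powr (- of_real p)"
    by (simp add: powr_minus field_simps)
  then show ?thesis by (simp add: L_def z_def)
qed

section \<open>Gaussian integrals\<close>

lemma integral_derivative_eq_0:
  fixes f f' :: "real \<Rightarrow> complex"
  assumes deriv: "\<And>x. (f has_vector_derivative f' x) (at x)"
    and "continuous_on UNIV f'" "integrable lborel f" "integrable lborel f'"
  shows "(\<integral>x. f' x \<partial>lborel) = 0"
proof (rule integral_directional_derivative_eq_0[where b = 1 and f = f])
  fix x t :: real
  have "((\<lambda>t. t + x) has_vector_derivative 1) (at t)"
    by (auto intro!: derivative_eq_intros)
  from vector_diff_chain_at[OF this deriv]
  show "((\<lambda>t. f (t *\<^sub>R 1 + x)) has_vector_derivative f' (t *\<^sub>R 1 + x)) (at t)"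
    by (simp add: o_def)
qed fact+

lemma integrable_gaussian_moment:
  assumes "0 < m"
  shows "integrable lborel (\<lambda>x::real. \<bar>x\<bar> ^ k * exp (- (m * x\<^sup>2)))"
proof -
  define s where "s = sqrt (1 / (2 * m))"
  have s: "0 < s" "s\<^sup>2 = 1 / (2 * m)" using assms by (auto simp: s_def)
  have "normal_density 0 s x = exp (- (m * x\<^sup>2)) / sqrt (2 * pi * s\<^sup>2)" for x
    by (simp add: normal_density_def s(2))
  then have "integrable lborel (\<lambda>x. sqrt (2 * pi * s\<^sup>2) * (normal_density 0 s x * \<bar>x\<bar> ^ k))"
    using integrable_normal_moment_abs[OF s(1), of 0 k] by (intro integrable_mult_right) simp
  moreover have "sqrt (2 * pi * s\<^sup>2) * (normal_density 0 s x * \<bar>x\<bar> ^ k) = \<bar>x\<bar> ^ k * exp (- (m * x\<^sup>2))" for x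
    using s(1) assms by (simp add: normal_density_def s(2))
  ultimately show ?thesis by simp
qed

text \<open>A plane wave with a Gaussian envelope. The width \<open>b\<close> is complex: the Schrodinger propagator is the limiting
  case of an imaginary one.\<close>

definition gauss_wave :: "complex \<Rightarrow> real \<Rightarrow> real \<Rightarrow> complex" where
  "gauss_wave b y x = exp (- of_real pi * b * of_real (x\<^sup>2) + 2 * of_real pi * \<i> * of_real (x * y))"

lemma norm_gauss_wave: "norm (gauss_wave b y x) = exp (- (pi * Re b * x\<^sup>2))"
  by (simp add: gauss_wave_def)

lemma continuous_gauss_wave [continuous_intros]: "continuous_on S (gauss_wave b y)"
  unfolding gauss_wave_def by (intro continuous_intros)

lemma borel_measurable_gauss_wave [measurable]: "gauss_wave b y \<in> borel_measurable borel"
  by (intro borel_measurable_continuous_onI continuous_intros)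

lemma integrable_gauss_wave_moment:
  assumes "0 < Re b"
  shows "integrable lborel (\<lambda>x. of_real (x ^ k) * gauss_wave b y x)"
proof (rule Bochner_Integration.integrable_bound)
  show "integrable lborel (\<lambda>x::real. \<bar>x\<bar> ^ k * exp (- (pi * Re b * x\<^sup>2)))"
    using assms by (intro integrable_gaussian_moment) simp
qed (auto simp: norm_mult norm_gauss_wave norm_power power_abs)

lemma has_vector_derivative_gauss_wave:
  "(gauss_wave b y has_vector_derivative
     (- 2 * of_real pi * b * of_real x + 2 * of_real pi * \<i> * of_real y) * gauss_wave b y x) (at x)"
proof -
  have "((\<lambda>z. exp (- of_real pi * b * z\<^sup>2 + 2 * of_real pi * \<i> * (z * of_real y))) has_field_derivative
     (- 2 * of_real pi * b * of_real x + 2 * of_real pi * \<i> * of_real y) * gauss_wave b y x) (at (of_real x))"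
    unfolding gauss_wave_def by (auto intro!: derivative_eq_intros simp: algebra_simps)
  from has_vector_derivative_real_field[OF this] show ?thesis
    by (simp add: gauss_wave_def[abs_def])
qed

text \<open>The derivatives of \<open>gauss_wave\<close> and of its product with \<open>x\<close> have vanishing integrals.\<close>

lemma gauss_wave_moments:
  fixes b :: complex and y :: real
  assumes b: "0 < Re b"
  defines "M \<equiv> \<lambda>k. \<integral>x. of_real (x ^ k) * gauss_wave b y x \<partial>lborel"
  shows "b * M 1 = \<i> * of_real y * M 0" "2 * of_real pi * b * M 2 = M 0 + 2 * of_real pi * \<i> * of_real y * M 1"
proof -
  note i = integrable_gauss_wave_moment[OF b, of _ y]
  let ?\<pi> = "complex_of_real pi"
  have int: "integrable lborel (\<lambda>x. of_real x * gauss_wave b y x)" "integrable lborel (gauss_wave b y)"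
    "integrable lborel (\<lambda>x. of_real (x^2) * gauss_wave b y x)"
    using i[of 1] i[of 0] i[of 2] by auto
  have d0: "(gauss_wave b y has_vector_derivative
      (- 2 * ?\<pi> * b) * (of_real x * gauss_wave b y x) + (2 * ?\<pi> * \<i> * of_real y) * gauss_wave b y x) (at x)" for x
    by (rule has_vector_derivative_eq_rhs[OF has_vector_derivative_gauss_wave]) (simp add: algebra_simps)
  have "0 = (\<integral>x. (- 2 * ?\<pi> * b) * (of_real x * gauss_wave b y x) + (2 * ?\<pi> * \<i> * of_real y) * gauss_wave b y x \<partial>lborel)"
    by (intro integral_derivative_eq_0[symmetric, OF d0] continuous_intros integrable_mult_right
        Bochner_Integration.integrable_add int)
  also have "\<dots> = - 2 * ?\<pi> * b * M 1 + 2 * ?\<pi> * \<i> * of_real y * M 0"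
    using int by (simp add: M_def)
  also have "\<dots> = 2 * ?\<pi> * (\<i> * of_real y * M 0 - b * M 1)"
    by (simp add: algebra_simps)
  finally show "b * M 1 = \<i> * of_real y * M 0" by simp
  have d: "((\<lambda>x. of_real x * gauss_wave b y x) has_vector_derivative
      gauss_wave b y x + ((- 2 * ?\<pi> * b) * (of_real (x\<^sup>2) * gauss_wave b y x) + (2 * ?\<pi> * \<i> * of_real y) * (of_real x * gauss_wave b y x))) (at x)" for x
  proof -
    have "((\<lambda>x. complex_of_real x) has_vector_derivative 1) (at x)"
      by (auto intro!: derivative_eq_intros)
    from has_vector_derivative_mult[OF this has_vector_derivative_gauss_wave[of b y x]]
    show ?thesis by (simp add: algebra_simps power2_eq_square)
  qed
  have "0 = (\<integral>x. gauss_wave b y x + ((- 2 * ?\<pi> * b) * (of_real (x\<^sup>2) * gauss_wave b y x) + (2 * ?\<pi> * \<i> * of_real y) * (of_real x * gauss_wave b y x)) \<partial>lborel)"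
    by (intro integral_derivative_eq_0[symmetric, OF d] continuous_intros integrable_mult_right
        Bochner_Integration.integrable_add int)
  also have "\<dots> = M 0 + (- 2 * ?\<pi> * b * M 2 + 2 * ?\<pi> * \<i> * of_real y * M 1)"
    using int by (simp add: M_def)
  finally show "2 * ?\<pi> * b * M 2 = M 0 + 2 * ?\<pi> * \<i> * of_real y * M 1" 
    by (simp add: algebra_simps)
qed

text \<open>This is the characteristic function of the standard normal distribution, rescaled.\<close>

lemma integral_gauss_wave_1:
  "(\<integral>x. gauss_wave 1 y x \<partial>lborel) = exp (- of_real (pi * y\<^sup>2))"
proof -
  define r where "r = sqrt (2 * pi)"
  have r: "0 < r" "r\<^sup>2 = 2 * pi" by (auto simp: r_def)
  have "complex_of_real (exp (- ((r * y)\<^sup>2) / 2)) = char std_normal_distribution (r * y)"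
    by (simp add: char_std_normal_distribution)
  also have "\<dots> = (\<integral>x. std_normal_density x *\<^sub>R iexp (r * y * x) \<partial>lborel)"
    unfolding char_def by (subst integral_density) (auto simp: normal_density_nonneg)
  also have "\<dots> = \<bar>r\<bar> *\<^sub>R (\<integral>x. std_normal_density (0 + r * x) *\<^sub>R iexp (r * y * (0 + r * x)) \<partial>lborel)"
    using r by (intro lborel_integral_real_affine) auto
  also have "\<dots> = (\<integral>x. gauss_wave 1 y x \<partial>lborel)"
  proof -
    have "\<bar>r\<bar> *\<^sub>R (std_normal_density (0 + r * x) *\<^sub>R iexp (r * y * (0 + r * x))) = gauss_wave 1 y x" for x
    proof -
      have "r * y * (0 + r * x) = 2 * pi * (x * y)"
        using r(2) by (simp add: power2_eq_square algebra_simps)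
      then have 1: "iexp (r * y * (0 + r * x)) = iexp (2 * pi * (x * y))" by (simp only:)
      have 2: "\<bar>r\<bar> * std_normal_density (0 + r * x) = exp (- pi * x\<^sup>2)"
        using r by (simp add: std_normal_density_def r_def power_mult_distrib real_sqrt_mult)
      have "\<bar>r\<bar> *\<^sub>R (std_normal_density (0 + r * x) *\<^sub>R iexp (r * y * (0 + r * x))) =
          of_real (\<bar>r\<bar> * std_normal_density (0 + r * x)) * iexp (r * y * (0 + r * x))"
        by (simp add: scaleR_conv_of_real)
      also have "\<dots> = of_real (exp (- pi * x\<^sup>2)) * iexp (2 * pi * (x * y))"
        by (simp only: 1 2)
      also have "\<dots> = gauss_wave 1 y x"
        by (simp add: gauss_wave_def exp_diff exp_of_real[symmetric] exp_minus divide_inverse ac_simps)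
      finally show ?thesis .
    qed
    then show ?thesis by (subst integral_scaleR_right[symmetric]) simp
  qed
  finally show ?thesis
    using r by (simp add: power_mult_distrib exp_of_real[symmetric])
qed

text \<open>As a function of \<open>b\<close> the left-hand side solves the same linear equation as the right-hand side, by
  the relations between its moments; both are compared along the segment from \<open>1\<close> to \<open>b\<close>.\<close>

lemma integral_gauss_wave:
  assumes b: "0 < Re b"
  shows "(\<integral>x. gauss_wave b y x \<partial>lborel) = b powr (- (1/2)) * exp (- of_real (pi * y\<^sup>2) / b)"
proof -
  let ?\<pi> = "complex_of_real pi"
  define z where "z t = 1 + complex_of_real t * (b - 1)" for t
  define M where "M k t = (\<integral>x. of_real (x ^ k) * gauss_wave (z t) y x \<partial>lborel)" for k t
  define m where "m = min 1 (Re b)"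
  have m: "0 < m" using b by (simp add: m_def)
  have Rez: "m \<le> Re (z t)" if "t \<in> {0..1}" for t
    unfolding m_def z_def using Re_segment_from_1[OF b] that by auto
  then have Rez0: "0 < Re (z t)" if "t \<in> {0..1}" for t
    using m that by force
  have dM: "(M 0 has_vector_derivative (- ?\<pi> * (b - 1) * M 2 t)) (at t within {0..1})" if t: "t \<in> {0..1}" for t
  proof -
    have "((\<lambda>t. \<integral>x. gauss_wave (z t) y x \<partial>lborel) has_vector_derivative
        (\<integral>x. - ?\<pi> * (b - 1) * (of_real (x^2) * gauss_wave (z t) y x) \<partial>lborel)) (at t within {0..1})"
    proof (rule has_vector_derivative_integral)
      show "integrable lborel (gauss_wave (z t) y)" if "t \<in> {0..1}" for t
        using integrable_gauss_wave_moment[OF Rez0[OF that], of 0] by simp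
      show "((\<lambda>t. gauss_wave (z t) y x) has_vector_derivative
          - ?\<pi> * (b - 1) * (of_real (x^2) * gauss_wave (z t) y x)) (at t within {0..1})" for t x
        unfolding gauss_wave_def z_def
        by (rule has_vector_derivative_real_field) (auto intro!: derivative_eq_intros simp: algebra_simps)
      show "norm (- ?\<pi> * (b - 1) * (of_real (x^2) * gauss_wave (z t) y x)) \<le>
          pi * cmod (b - 1) * (\<bar>x\<bar> ^ 2 * exp (- (pi * m * x\<^sup>2)))" if "t \<in> {0..1}" for t x
        using Rez[OF that]
        by (simp add: norm_mult norm_power norm_gauss_wave mult_left_mono mult_right_mono)
      show "integrable lborel (\<lambda>x. pi * cmod (b - 1) * (\<bar>x\<bar> ^ 2 * exp (- (pi * m * x\<^sup>2))))"
        using m by (intro integrable_mult_right integrable_gaussian_moment) auto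
    qed (use t in auto)
    then show ?thesis by (simp add: M_def[abs_def])
  qed
  \<comment> \<open>\<open>H\<close> is the reciprocal of the claimed value, so \<open>H t * M 0 t\<close> has to be constant.\<close>
  define H where "H t = z t powr (1/2) * exp (of_real (pi * y\<^sup>2) / z t)" for t
  have dH: "(H has_vector_derivative (b - 1) * (1 / (2 * z t) - ?\<pi> * of_real (y\<^sup>2) / (z t)\<^sup>2) * H t) (at t within {0..1})"
    if t: "t \<in> {0..1}" for t
  proof -
    have nz: "z t \<noteq> 0" using Rez0[OF t] by auto
    have 1: "((\<lambda>t. z t powr (1/2)) has_vector_derivative (b - 1) * (1/2 * z t powr (1/2 - 1))) (at t within {0..1})"
      unfolding z_def using t by (intro has_vector_derivative_powr_segment[OF b]) auto
    have 2: "((\<lambda>t. exp (of_real (pi * y\<^sup>2) / z t)) has_vector_derivative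
        - (b - 1) * (?\<pi> * of_real (y\<^sup>2) / (z t)\<^sup>2) * exp (of_real (pi * y\<^sup>2) / z t)) (at t within {0..1})"
    proof -
      obtain B where B: "b - 1 = B" by simp
      show ?thesis
        using nz unfolding z_def B
        by (intro has_vector_derivative_real_field) (auto intro!: derivative_eq_intros simp: power2_eq_square)
    qed
    have p: "z t powr (1/2 - 1) = z t powr (1/2) / z t"
      using nz powr_diff[of "z t" "1/2" 1] by simp
    have "(H has_vector_derivative z t powr (1/2) * (- (b - 1) * (?\<pi> * of_real (y\<^sup>2) / (z t)\<^sup>2) * exp (of_real (pi * y\<^sup>2) / z t))
        + (b - 1) * (1/2 * z t powr (1/2 - 1)) * exp (of_real (pi * y\<^sup>2) / z t)) (at t within {0..1})"
      unfolding H_def[abs_def] by (rule has_vector_derivative_mult[OF 1 2])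
    moreover have "Z * (- B * Q * E) + B * (1/2 * (Z / w)) * E = B * (1 / (2 * w) - Q) * (Z * E)" for Z B Q E w :: complex
      by (simp add: algebra_simps)
    ultimately show ?thesis
      unfolding p by (simp only: H_def)
  qed
  have "((\<lambda>t. H t * M 0 t) has_vector_derivative 0) (at t within {0..1})" if t: "t \<in> {0..1}" for t
  proof -
    have nz: "z t \<noteq> 0" using Rez0[OF t] by auto
    note mom = gauss_wave_moments[OF Rez0[OF t], of y, folded M_def]
    have M1: "M 1 t = \<i> * of_real y * M 0 t / z t"
      using mom(1) nz by (simp add: field_simps)
    have M2: "M 2 t = (M 0 t + 2 * ?\<pi> * \<i> * of_real y * M 1 t) / (2 * ?\<pi> * z t)"
      using mom(2) nz by (simp add: field_simps)
    have e: "?\<pi> * M 2 t = (1 / (2 * z t) - ?\<pi> * of_real (y\<^sup>2) / (z t)\<^sup>2) * M 0 t"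
      unfolding M2 M1 using nz by (simp add: field_simps power2_eq_square)
    have "((\<lambda>t. H t * M 0 t) has_vector_derivative
        H t * (- ?\<pi> * (b - 1) * M 2 t) + (b - 1) * (1 / (2 * z t) - ?\<pi> * of_real (y\<^sup>2) / (z t)\<^sup>2) * H t * M 0 t) (at t within {0..1})"
      by (rule has_vector_derivative_mult[OF dH[OF t] dM[OF t]])
    also have "H t * (- ?\<pi> * (b - 1) * M 2 t) + (b - 1) * (1 / (2 * z t) - ?\<pi> * of_real (y\<^sup>2) / (z t)\<^sup>2) * H t * M 0 t
      = H t * (b - 1) * ((1 / (2 * z t) - ?\<pi> * of_real (y\<^sup>2) / (z t)\<^sup>2) * M 0 t - ?\<pi> * M 2 t)"
      by (simp add: algebra_simps)
    also have "\<dots> = 0" by (simp only: e) simp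
    finally show ?thesis .
  qed
  then obtain k where k: "\<And>t. t \<in> {0..1} \<Longrightarrow> H t * M 0 t = k"
    using has_vector_derivative_zero_constant[of "{0..1}" "\<lambda>t. H t * M 0 t"] by auto
  have "k = 1"
    using k[of 0] by (simp add: H_def M_def z_def integral_gauss_wave_1 exp_minus)
  then have "H 1 * (\<integral>x. gauss_wave b y x \<partial>lborel) = 1"
    using k[of 1] by (simp add: M_def z_def)
  moreover have "b \<noteq> 0" using b by auto
  ultimately show ?thesis
    by (simp add: H_def z_def powr_minus exp_minus field_simps)
qed

lemma
  fixes f :: "'a::euclidean_space \<Rightarrow> real \<Rightarrow> 'c::{real_normed_field, banach, second_countable_topology}"
  assumes f: "\<And>b. b \<in> Basis \<Longrightarrow> integrable lborel (f b)"
  shows integral_prod_Basis: "(\<integral>x. (\<Prod>b\<in>Basis. f b (x \<bullet> b)) \<partial>lborel) = (\<Prod>b\<in>Basis. \<integral>x. f b x \<partial>lborel)"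
    and integrable_prod_Basis: "integrable lborel (\<lambda>x::'a. \<Prod>b\<in>Basis. f b (x \<bullet> b))"
proof -
  interpret product_sigma_finite "\<lambda>_::'a. lborel :: real measure" by standard
  let ?T = "\<lambda>g. \<Sum>b\<in>Basis. g b *\<^sub>R b :: 'a"
  have [measurable]: "b \<in> Basis \<Longrightarrow> f b \<in> borel_measurable borel" for b
    using borel_measurable_integrable[OF f] by simp
  have T: "?T \<in> measurable (\<Pi>\<^sub>M b\<in>Basis. lborel) borel"
    by measurable
  have m: "(\<lambda>x::'a. \<Prod>b\<in>Basis. f b (x \<bullet> b)) \<in> borel_measurable borel"
    by measurable
  have e: "(\<Prod>b\<in>Basis. f b (?T g \<bullet> b)) = (\<Prod>b\<in>Basis. f b (g b))" for g
    by (intro prod.cong) auto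
  show "integrable lborel (\<lambda>x::'a. \<Prod>b\<in>Basis. f b (x \<bullet> b))"
    unfolding lborel_eq[where 'a = 'a] integrable_distr_eq[OF T m] e
    by (rule product_integrable_prod) (auto intro: f)
  show "(\<integral>x. (\<Prod>b\<in>Basis. f b (x \<bullet> b)) \<partial>lborel) = (\<Prod>b\<in>Basis. \<integral>x. f b x \<partial>lborel)"
    unfolding lborel_eq[where 'a = 'a] integral_distr[OF T m] e
    by (rule product_integral_prod) (auto intro: f)
qed

definition gauss_wave_vec :: "complex \<Rightarrow> 'a::euclidean_space \<Rightarrow> 'a \<Rightarrow> complex" where
  "gauss_wave_vec b y x = exp (- of_real pi * b * of_real ((norm x)\<^sup>2)) * cis (2 * pi * (x \<bullet> y))"

lemma gauss_wave_vec_eq_prod: "gauss_wave_vec b y x = (\<Prod>i\<in>Basis. gauss_wave b (y \<bullet> i) (x \<bullet> i))"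
proof -
  have "(norm x)\<^sup>2 = (\<Sum>i\<in>Basis. (x \<bullet> i)\<^sup>2)"
    by (subst power2_norm_eq_inner, subst euclidean_inner) (simp add: power2_eq_square)
  then show ?thesis
    unfolding gauss_wave_vec_def gauss_wave_def cis_conv_exp exp_add[symmetric] exp_sum[OF finite_Basis, symmetric]
    by (intro arg_cong[where f = exp])
      (simp add: euclidean_inner[of x y] sum_subtractf sum_distrib_left sum_negf ac_simps)
qed

lemma integrable_gauss_wave_vec: "0 < Re b \<Longrightarrow> integrable lborel (gauss_wave_vec b y)"
  unfolding gauss_wave_vec_eq_prod[abs_def]
  using integrable_gauss_wave_moment[of b 0] by (intro integrable_prod_Basis) simp

lemma integral_gauss_wave_vec:
  fixes y :: "'a::euclidean_space"
  assumes b: "0 < Re b"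
  shows "(\<integral>x. gauss_wave_vec b y x \<partial>lborel) =
    b powr (- (of_nat DIM('a) / 2)) * exp (- of_real (pi * (norm y)\<^sup>2) / b)"
proof -
  have "(\<integral>x. gauss_wave_vec b y x \<partial>lborel) = (\<Prod>i\<in>Basis. \<integral>x. gauss_wave b (y \<bullet> i) x \<partial>lborel)"
    unfolding gauss_wave_vec_eq_prod using integrable_gauss_wave_moment[OF b, of 0]
    by (intro integral_prod_Basis) simp
  also have "\<dots> = (\<Prod>i\<in>(Basis::'a set). b powr (- (1/2)) * exp (- of_real (pi * (y \<bullet> i)\<^sup>2) / b))"
    by (simp add: integral_gauss_wave[OF b])
  also have "\<dots> = (b powr (- (1/2))) ^ DIM('a) * exp (\<Sum>i\<in>Basis. - of_real (pi * (y \<bullet> i)\<^sup>2) / b)"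
    by (simp add: prod.distrib exp_sum)
  also have "(\<Sum>i\<in>Basis. - of_real (pi * (y \<bullet> i)\<^sup>2) / b) = - of_real (pi * (norm y)\<^sup>2) / b"
  proof -
    have "(norm y)\<^sup>2 = (\<Sum>i\<in>Basis. (y \<bullet> i)\<^sup>2)"
      by (subst power2_norm_eq_inner, subst euclidean_inner) (simp add: power2_eq_square)
    then show ?thesis
      by (simp add: sum_negf sum_divide_distrib sum_distrib_left)
  qed
  also have "(b powr (- (1/2))) ^ DIM('a) = b powr (- (of_nat DIM('a) / 2))"
    using b by (auto simp: powr_def exp_of_nat_mult[symmetric] algebra_simps)
  finally show ?thesis .
qed

lemma borel_measurable_cnj [measurable (raw)]:
  "f \<in> borel_measurable M \<Longrightarrow> (\<lambda>x. cnj (f x)) \<in> borel_measurable M"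
  by (rule borel_measurable_continuous_on[where f = cnj]) (auto intro!: continuous_intros)

section \<open>Squared norms of oscillatory integrals\<close>

text \<open>Expanding the square and exchanging the integrals moves the outer integral onto the kernel. The two
  exchanges are justified separately, each on a product of two spaces.\<close>

lemma integral_norm_sq_oscillatory:
  fixes e :: "'a \<Rightarrow> 'b \<Rightarrow> complex" and h :: "'b \<Rightarrow> complex"
  assumes "finite_measure N" "sigma_finite_measure M"
    and [measurable]: "case_prod e \<in> borel_measurable (N \<Otimes>\<^sub>M M)"
    and e: "\<And>w x. norm (e w x) \<le> 1" and h: "integrable M h"
  shows "of_real (\<integral>w. (cmod (\<integral>x. e w x * h x \<partial>M))\<^sup>2 \<partial>N) =
      (\<integral>x'. cnj (h x') * (\<integral>x. h x * (\<integral>w. e w x * cnj (e w x') \<partial>N) \<partial>M) \<partial>M)"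
    and "integrable N (\<lambda>w. (cmod (\<integral>x. e w x * h x \<partial>M))\<^sup>2)"
proof -
  interpret N: finite_measure N by fact
  interpret M: sigma_finite_measure M by fact
  interpret pair_sigma_finite N M ..
  have [measurable]: "h \<in> borel_measurable M" using h by simp
  have cnj_meas: "(\<lambda>(w, x). cnj (e w x)) \<in> borel_measurable (N \<Otimes>\<^sub>M M)" "(\<lambda>x. cnj (h x)) \<in> borel_measurable M"
    by measurable
  have [measurable]: "e w \<in> borel_measurable M" if "w \<in> space N" for w using that by measurable
  define H where "H w = (\<integral>x. e w x * h x \<partial>M)" for w
  have [measurable]: "H \<in> borel_measurable N" unfolding H_def by measurable
  define K where "K = (\<integral>x. norm (h x) \<partial>M)"
  have K: "0 \<le> K" by (simp add: K_def)
  have ieh: "integrable M (\<lambda>x. e w x * h x)" if "w \<in> space N" for w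
    by (rule Bochner_Integration.integrable_bound[OF integrable_norm[OF h]])
      (use that e in \<open>auto simp: norm_mult intro!: mult_left_le_one_le\<close>)
  have H: "norm (H w) \<le> K" if "w \<in> space N" for w
    unfolding H_def K_def
    by (rule order_trans[OF integral_norm_bound integral_mono[OF integrable_norm[OF ieh[OF that]] integrable_norm[OF h]]])
      (use e in \<open>auto simp: norm_mult intro!: mult_left_le_one_le\<close>)
  have fub: "integrable (N \<Otimes>\<^sub>M M) (\<lambda>(w, x). G w * (E w x * k x))"
    if [measurable]: "G \<in> borel_measurable N" "case_prod E \<in> borel_measurable (N \<Otimes>\<^sub>M M)" "k \<in> borel_measurable M"
      and G: "\<And>w. w \<in> space N \<Longrightarrow> norm (G w) \<le> C" and E: "\<And>w x. norm (E w x) \<le> 1" and k: "integrable M k"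
    for G :: "'a \<Rightarrow> complex" and E k and C :: real
  proof (rule Fubini_integrable)
    have b: "norm (G w * (E w x * k x)) \<le> C * norm (k x)" if "w \<in> space N" for w x
    proof -
      have "norm (G w * (E w x * k x)) = norm (G w) * (norm (E w x) * norm (k x))" by (simp add: norm_mult)
      also have "\<dots> \<le> C * (1 * norm (k x))"
        using G[OF that] E[of w x] order_trans[OF norm_ge_zero G[OF that]] by (intro mult_mono) auto
      finally show ?thesis by simp
    qed
    have i: "integrable M (\<lambda>x. G w * (E w x * k x))" if "w \<in> space N" for w
      by (rule Bochner_Integration.integrable_bound[OF integrable_mult_right[OF integrable_norm[OF k], of C]])
        (use that b[OF that] in \<open>auto intro: order_trans[OF _ abs_ge_self]\<close>)
    then show "AE w in N. integrable M (\<lambda>x. case (w, x) of (w, x) \<Rightarrow> G w * (E w x * k x))"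
      by auto
    show "integrable N (\<lambda>w. \<integral>x. norm (case (w, x) of (w, x) \<Rightarrow> G w * (E w x * k x)) \<partial>M)"
    proof (rule N.integrable_const_bound[where B = "C * (\<integral>x. norm (k x) \<partial>M)"])
      show "AE w in N. norm (\<integral>x. norm (case (w, x) of (w, x) \<Rightarrow> G w * (E w x * k x)) \<partial>M) \<le> C * (\<integral>x. norm (k x) \<partial>M)"
      proof (rule AE_I2)
        fix w assume w: "w \<in> space N"
        have "(\<integral>x. norm (G w * (E w x * k x)) \<partial>M) \<le> (\<integral>x. C * norm (k x) \<partial>M)"
          by (intro integral_mono integrable_norm i[OF w] integrable_mult_right k b[OF w])
        then show "norm (\<integral>x. norm (case (w, x) of (w, x) \<Rightarrow> G w * (E w x * k x)) \<partial>M) \<le> C * (\<integral>x. norm (k x) \<partial>M)"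
          by simp
      qed
    qed measurable
  qed measurable
  show "integrable N (\<lambda>w. (cmod (\<integral>x. e w x * h x \<partial>M))\<^sup>2)"
    unfolding H_def[symmetric]
    by (rule N.integrable_const_bound[where B = "K\<^sup>2"]) (use H in \<open>auto intro!: power_mono\<close>)
  have "complex_of_real (\<integral>w. (cmod (H w))\<^sup>2 \<partial>N) = (\<integral>w. of_real ((cmod (H w))\<^sup>2) \<partial>N)"
    by (rule integral_complex_of_real[symmetric])
  also have "\<dots> = (\<integral>w. H w * cnj (H w) \<partial>N)"
    by (simp only: complex_norm_square)
  also have "\<dots> = (\<integral>w. (\<integral>x'. H w * (cnj (e w x') * cnj (h x')) \<partial>M) \<partial>N)"
  proof (intro Bochner_Integration.integral_cong refl)
    fix w assume "w \<in> space N"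
    have "cnj (H w) = (\<integral>x'. cnj (e w x') * cnj (h x') \<partial>M)"
      unfolding H_def Bochner_Integration.integral_cnj[symmetric] by simp
    then show "H w * cnj (H w) = (\<integral>x'. H w * (cnj (e w x') * cnj (h x')) \<partial>M)" by simp
  qed
  also have "\<dots> = (\<integral>x'. (\<integral>w. H w * (cnj (e w x') * cnj (h x')) \<partial>N) \<partial>M)"
    by (rule Fubini_integral[symmetric], rule fub[where C = K]) (use H e h cnj_meas in auto)
  also have "\<dots> = (\<integral>x'. cnj (h x') * (\<integral>w. (\<integral>x. cnj (e w x') * (e w x * h x) \<partial>M) \<partial>N) \<partial>M)"
    unfolding H_def by (subst integral_mult_right_zero[symmetric])
      (simp add: ac_simps flip: integral_mult_right_zero)
  also have "\<dots> = (\<integral>x'. cnj (h x') * (\<integral>x. (\<integral>w. cnj (e w x') * (e w x * h x) \<partial>N) \<partial>M) \<partial>M)"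
  proof (intro Bochner_Integration.integral_cong refl arg_cong2[where f = "(*)"])
    fix x' assume [measurable]: "x' \<in> space M"
    show "(\<integral>w. (\<integral>x. cnj (e w x') * (e w x * h x) \<partial>M) \<partial>N) = (\<integral>x. (\<integral>w. cnj (e w x') * (e w x * h x) \<partial>N) \<partial>M)"
      by (rule Fubini_integral[symmetric], rule fub[where C = 1]) (use e h in auto)
  qed
  also have "\<dots> = (\<integral>x'. cnj (h x') * (\<integral>x. h x * (\<integral>w. e w x * cnj (e w x') \<partial>N) \<partial>M) \<partial>M)"
    by (simp add: ac_simps flip: integral_mult_right_zero)
  finally show "of_real (\<integral>w. (cmod (\<integral>x. e w x * h x \<partial>M))\<^sup>2 \<partial>N) =
      (\<integral>x'. cnj (h x') * (\<integral>x. h x * (\<integral>w. e w x * cnj (e w x') \<partial>N) \<partial>M) \<partial>M)"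
    by (simp add: H_def)
qed

section \<open>Fourier analysis on Euclidean space\<close>

text \<open>An integral that is not known to be finite is computed from its regularizations, which are Bochner
  integrals and allow complex arguments; monotone convergence removes the regularization.\<close>

lemma nn_integral_eq_of_regularized:
  fixes F :: "'a \<Rightarrow> real" and \<rho> :: "nat \<Rightarrow> 'a \<Rightarrow> real"
  assumes [measurable]: "F \<in> borel_measurable M" "\<And>n. \<rho> n \<in> borel_measurable M"
    and F: "\<And>x. 0 \<le> F x"
    and \<rho>: "\<And>n x. 0 \<le> \<rho> n x" "\<And>x. incseq (\<lambda>n. \<rho> n x)" "\<And>x. (\<lambda>n. \<rho> n x) \<longlonglongrightarrow> 1"
    and int: "\<And>n. integrable M (\<lambda>x. \<rho> n x * F x)"
    and lim: "(\<lambda>n. \<integral>x. \<rho> n x * F x \<partial>M) \<longlonglongrightarrow> I"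
  shows "(\<integral>\<^sup>+x. ennreal (F x) \<partial>M) = ennreal I"
proof (rule LIMSEQ_unique)
  have "(\<lambda>n. \<integral>\<^sup>+x. ennreal (\<rho> n x * F x) \<partial>M) = (\<lambda>n. ennreal (\<integral>x. \<rho> n x * F x \<partial>M))"
    using int F \<rho>(1) by (intro ext nn_integral_eq_integral) auto
  then show "(\<lambda>n. \<integral>\<^sup>+x. ennreal (\<rho> n x * F x) \<partial>M) \<longlonglongrightarrow> ennreal I"
    using lim by (simp add: tendsto_ennrealI)
  show "(\<lambda>n. \<integral>\<^sup>+x. ennreal (\<rho> n x * F x) \<partial>M) \<longlonglongrightarrow> (\<integral>\<^sup>+x. ennreal (F x) \<partial>M)"
  proof (rule nn_integral_LIMSEQ)
    show "incseq (\<lambda>n x. ennreal (\<rho> n x * F x))"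
      using \<rho>(2) F by (auto simp: incseq_def le_fun_def intro!: ennreal_leI mult_right_mono)
    show "(\<lambda>n. ennreal (\<rho> n x * F x)) \<longlonglongrightarrow> ennreal (F x)" for x
      using tendsto_mult[OF \<rho>(3)[of x] tendsto_const[of "F x"]] by (intro tendsto_ennrealI) simp
  qed auto
qed

lemma integral_affine:
  fixes f :: "'a::euclidean_space \<Rightarrow> 'b::{banach, second_countable_topology}"
  assumes [measurable]: "f \<in> borel_measurable borel" and c: "c \<noteq> 0"
  shows "(\<integral>x. f x \<partial>lborel) = \<bar>c\<bar> ^ DIM('a) *\<^sub>R (\<integral>x. f (t + c *\<^sub>R x) \<partial>lborel)"
  by (subst lborel_affine[OF c, of t]) (simp add: integral_density integral_distr)

lemma borel_measurable_cis [measurable (raw)]: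
  "f \<in> borel_measurable M \<Longrightarrow> (\<lambda>x. cis (f x)) \<in> borel_measurable M"
  by (rule borel_measurable_continuous_on[where f = cis]) (auto intro!: continuous_intros)

lemma gauss_wave_vec_shift: "gauss_wave_vec b (y + y') x = gauss_wave_vec b y x * cis (2 * pi * (x \<bullet> y'))"
  by (simp add: gauss_wave_vec_def inner_add_right distrib_left cis_mult)

lemma gauss_wave_vec_of_real_0: "gauss_wave_vec (of_real m) 0 x = of_real (exp (- (pi * m * (norm x)\<^sup>2)))"
  by (simp add: gauss_wave_vec_def exp_of_real[symmetric])

lemma norm_gauss_wave_vec: "cmod (gauss_wave_vec b y x) = exp (- (pi * Re b * (norm x)\<^sup>2))"
  by (simp add: gauss_wave_vec_def norm_mult)

lemma integrable_gaussian_vec: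
  assumes "0 < m"
  shows "integrable lborel (\<lambda>x::'a::euclidean_space. exp (- (pi * m * (norm x)\<^sup>2)))"
  using integrable_norm[OF integrable_gauss_wave_vec[of "of_real m" "0::'a"]] assms
  by (simp add: norm_gauss_wave_vec)

lemma integral_gaussian_vec: "(\<integral>x. exp (- (pi * (norm x)\<^sup>2)) \<partial>(lborel :: 'a::euclidean_space measure)) = 1"
proof -
  have "complex_of_real (\<integral>x. exp (- (pi * (norm x)\<^sup>2)) \<partial>(lborel :: 'a measure)) = (\<integral>x. gauss_wave_vec 1 0 x \<partial>(lborel :: 'a measure))"
  proof -
    have "gauss_wave_vec 1 0 = (\<lambda>x::'a. complex_of_real (exp (- (pi * (norm x)\<^sup>2))))"
      using gauss_wave_vec_of_real_0[of 1] by (intro ext) simp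
    then show ?thesis by (simp only: integral_complex_of_real)
  qed
  also have "\<dots> = 1" by (subst integral_gauss_wave_vec) auto
  finally show ?thesis by simp
qed

text \<open>With a Gaussian weight of width \<open>\<delta>\<^sup>-\<^sup>1\<^sup>/\<^sup>2\<close>, the square of the transform integrates to a double
  integral of \<open>f (\<xi>) cnj (f (\<xi>'))\<close> against a Gaussian approximate identity in \<open>\<xi> - \<xi>'\<close>, which converges as
  \<open>\<delta> \<rightarrow> 0\<close> because \<open>f\<close> is continuous and bounded.\<close>

lemma plancherel:
  fixes f :: "'a::euclidean_space \<Rightarrow> complex"
  assumes cont: "continuous_on UNIV f" and bnd: "\<And>\<xi>. cmod (f \<xi>) \<le> C" and f: "integrable lborel f"
  shows "(\<integral>\<^sup>+x. ennreal ((cmod (\<integral>\<xi>. cis (2 * pi * (x \<bullet> \<xi>)) * f \<xi> \<partial>lborel))\<^sup>2) \<partial>lborel) =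
    (\<integral>\<^sup>+\<xi>. ennreal ((cmod (f \<xi>))\<^sup>2) \<partial>lborel)"
proof -
  have [measurable]: "f \<in> borel_measurable borel"
    using borel_measurable_integrable[OF f] by simp
  define \<delta> where "\<delta> n = 1 / real (Suc n)" for n
  have \<delta>: "0 < \<delta> n" for n by (simp add: \<delta>_def)
  have \<delta>0: "\<delta> \<longlonglongrightarrow> 0" unfolding \<delta>_def by (rule LIMSEQ_Suc[OF lim_const_over_n])
  define \<rho> where "\<rho> n x = exp (- (pi * \<delta> n * (norm (x::'a))\<^sup>2))" for n x
  define Ft where "Ft x = (\<integral>\<xi>. cis (2 * pi * (x \<bullet> \<xi>)) * f \<xi> \<partial>lborel)" for x
  have [measurable]: "Ft \<in> borel_measurable borel" unfolding Ft_def by measurable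
  have [measurable]: "\<rho> n \<in> borel_measurable borel" for n unfolding \<rho>_def by measurable
  define inner where "inner n \<xi>' = (\<integral>y. f (\<xi>' + sqrt (\<delta> n) *\<^sub>R y) * of_real (exp (- (pi * (norm y)\<^sup>2))) \<partial>lborel)" for n \<xi>'
  have reg: "integrable lborel (\<lambda>x. \<rho> n x * (cmod (Ft x))\<^sup>2)"
    "complex_of_real (\<integral>x. \<rho> n x * (cmod (Ft x))\<^sup>2 \<partial>lborel) = (\<integral>\<xi>'. cnj (f \<xi>') * inner n \<xi>' \<partial>lborel)" for n
  proof -
    define N where "N = density lborel (\<lambda>x. ennreal (\<rho> n x))"
    have i\<rho>: "integrable lborel (\<rho> n)"
      unfolding \<rho>_def using \<delta> by (intro integrable_gaussian_vec)
    have "emeasure N (space N) < \<infinity>"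
      using i\<rho> by (simp add: N_def emeasure_density \<rho>_def integrable_iff_bounded)
    then have fin: "finite_measure N" by (intro finite_measureI) simp
    have [measurable_cong]: "sets N = sets borel" by (simp add: N_def)
    have m: "(\<lambda>(x, \<xi>). cis (2 * pi * (x \<bullet> \<xi>))) \<in> borel_measurable (N \<Otimes>\<^sub>M lborel)" by measurable
    have "cmod (cis (2 * pi * (x \<bullet> \<xi>))) \<le> 1" for x \<xi> :: 'a by simp
    note osc = integral_norm_sq_oscillatory[OF fin lborel.sigma_finite_measure_axioms m this f]
    have \<rho>0: "AE x in lborel. 0 \<le> \<rho> n x" by (simp add: \<rho>_def)
    have dens: "(\<integral>x. g x \<partial>N) = (\<integral>x. \<rho> n x *\<^sub>R g x \<partial>lborel)" if "g \<in> borel_measurable borel"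
      for g :: "'a \<Rightarrow> complex"
      unfolding N_def by (rule integral_density) (use that \<rho>0 in auto)
    have densr: "(\<integral>x. g x \<partial>N) = (\<integral>x. \<rho> n x * g x \<partial>lborel)" if "g \<in> borel_measurable borel"
      for g :: "'a \<Rightarrow> real"
      unfolding N_def by (subst integral_density) (use that \<rho>0 in auto)
    show "integrable lborel (\<lambda>x. \<rho> n x * (cmod (Ft x))\<^sup>2)"
      using osc(2) \<rho>0 unfolding Ft_def[symmetric] N_def by (subst (asm) integrable_density) auto
    have kern: "(\<integral>x. cis (2 * pi * (x \<bullet> \<xi>)) * cnj (cis (2 * pi * (x \<bullet> \<xi>'))) \<partial>N) =
        of_real (\<delta> n powr (- (DIM('a) / 2)) * exp (- (pi * (norm (\<xi> - \<xi>'))\<^sup>2 / \<delta> n)))" for \<xi> \<xi>'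
    proof -
      have "(\<integral>x. cis (2 * pi * (x \<bullet> \<xi>)) * cnj (cis (2 * pi * (x \<bullet> \<xi>'))) \<partial>N) =
          (\<integral>x. gauss_wave_vec (of_real (\<delta> n)) (\<xi> - \<xi>') x \<partial>lborel)"
      proof (subst dens)
        have "\<rho> n x *\<^sub>R (cis (2 * pi * (x \<bullet> \<xi>)) * cnj (cis (2 * pi * (x \<bullet> \<xi>')))) =
            gauss_wave_vec (of_real (\<delta> n)) (\<xi> - \<xi>') x" for x
          by (simp add: \<rho>_def gauss_wave_vec_def scaleR_conv_of_real cis_cnj cis_mult
              inner_diff_right right_diff_distrib exp_of_real[symmetric] mult.assoc)
        then show "(\<integral>x. \<rho> n x *\<^sub>R (cis (2 * pi * (x \<bullet> \<xi>)) * cnj (cis (2 * pi * (x \<bullet> \<xi>')))) \<partial>lborel) =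
            (\<integral>x. gauss_wave_vec (of_real (\<delta> n)) (\<xi> - \<xi>') x \<partial>lborel)" by simp
      qed measurable
      also have "\<dots> = of_real (\<delta> n) powr (- (of_nat DIM('a) / 2)) * exp (- of_real (pi * (norm (\<xi> - \<xi>'))\<^sup>2) / of_real (\<delta> n))"
        using \<delta>[of n] by (subst integral_gauss_wave_vec) auto
      also have "of_real (\<delta> n) powr (- (of_nat DIM('a) / 2)) = complex_of_real (\<delta> n powr (- (DIM('a) / 2)))"
        using \<delta>[of n] powr_of_real[of "\<delta> n" "- (DIM('a) / 2)"] by simp
      also have "exp (- of_real (pi * (norm (\<xi> - \<xi>'))\<^sup>2) / of_real (\<delta> n)) = complex_of_real (exp (- (pi * (norm (\<xi> - \<xi>'))\<^sup>2 / \<delta> n)))"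
        by (simp add: exp_of_real[symmetric])
      finally show ?thesis by simp
    qed
    have inner: "(\<integral>\<xi>. f \<xi> * (\<integral>x. cis (2 * pi * (x \<bullet> \<xi>)) * cnj (cis (2 * pi * (x \<bullet> \<xi>'))) \<partial>N) \<partial>lborel) = inner n \<xi>'" for \<xi>'
    proof -
      have sq: "sqrt (\<delta> n) \<noteq> 0" using \<delta>[of n] by simp
      have "(\<integral>\<xi>. f \<xi> * (\<integral>x. cis (2 * pi * (x \<bullet> \<xi>)) * cnj (cis (2 * pi * (x \<bullet> \<xi>'))) \<partial>N) \<partial>lborel) =
          (\<integral>\<xi>. f \<xi> * of_real (\<delta> n powr (- (DIM('a) / 2)) * exp (- (pi * (norm (\<xi> - \<xi>'))\<^sup>2 / \<delta> n))) \<partial>lborel)"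
        unfolding kern ..
      also have "\<dots> = \<bar>sqrt (\<delta> n)\<bar> ^ DIM('a) *\<^sub>R (\<integral>y. f (\<xi>' + sqrt (\<delta> n) *\<^sub>R y) *
          of_real (\<delta> n powr (- (DIM('a) / 2)) * exp (- (pi * (norm (\<xi>' + sqrt (\<delta> n) *\<^sub>R y - \<xi>'))\<^sup>2 / \<delta> n))) \<partial>lborel)"
        by (rule integral_affine[OF _ sq]) measurable
      also have "\<dots> = (\<integral>y. \<bar>sqrt (\<delta> n)\<bar> ^ DIM('a) *\<^sub>R (f (\<xi>' + sqrt (\<delta> n) *\<^sub>R y) *
          of_real (\<delta> n powr (- (DIM('a) / 2)) * exp (- (pi * (norm (\<xi>' + sqrt (\<delta> n) *\<^sub>R y - \<xi>'))\<^sup>2 / \<delta> n)))) \<partial>lborel)"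
        by (rule integral_scaleR_right[symmetric])
      also have "\<dots> = inner n \<xi>'"
        unfolding inner_def
      proof (intro Bochner_Integration.integral_cong refl)
        fix y :: 'a
        have "\<bar>sqrt (\<delta> n)\<bar> ^ DIM('a) = \<delta> n powr (DIM('a) / 2)"
          using \<delta>[of n] by (simp add: powr_half_sqrt[symmetric] powr_realpow[symmetric] powr_powr)
        then have "\<bar>sqrt (\<delta> n)\<bar> ^ DIM('a) * \<delta> n powr (- (DIM('a) / 2)) = 1"
          using \<delta>[of n] by (simp add: powr_add[symmetric])
        moreover have "(norm (\<xi>' + sqrt (\<delta> n) *\<^sub>R y - \<xi>'))\<^sup>2 / \<delta> n = (norm y)\<^sup>2"
          using \<delta>[of n] by (simp add: power_mult_distrib)
        then have "pi * (norm (\<xi>' + sqrt (\<delta> n) *\<^sub>R y - \<xi>'))\<^sup>2 / \<delta> n = pi * (norm y)\<^sup>2"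
          by (metis times_divide_eq_right)
        ultimately show "\<bar>sqrt (\<delta> n)\<bar> ^ DIM('a) *\<^sub>R (f (\<xi>' + sqrt (\<delta> n) *\<^sub>R y) *
          of_real (\<delta> n powr (- (DIM('a) / 2)) * exp (- (pi * (norm (\<xi>' + sqrt (\<delta> n) *\<^sub>R y - \<xi>'))\<^sup>2 / \<delta> n)))) =
          f (\<xi>' + sqrt (\<delta> n) *\<^sub>R y) * of_real (exp (- (pi * (norm y)\<^sup>2)))"
          by (simp add: scaleR_conv_of_real mult.assoc[symmetric] mult.commute[of "f _"] flip: of_real_mult of_real_power)
      qed
      finally show ?thesis .
    qed
    have "complex_of_real (\<integral>x. \<rho> n x * (cmod (Ft x))\<^sup>2 \<partial>lborel) = of_real (\<integral>x. (cmod (Ft x))\<^sup>2 \<partial>N)"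
      by (subst densr) auto
    also have "\<dots> = (\<integral>\<xi>'. cnj (f \<xi>') * inner n \<xi>' \<partial>lborel)"
      unfolding Ft_def using osc(1) by (simp add: inner)
    finally show "complex_of_real (\<integral>x. \<rho> n x * (cmod (Ft x))\<^sup>2 \<partial>lborel) = (\<integral>\<xi>'. cnj (f \<xi>') * inner n \<xi>' \<partial>lborel)" .
  qed
  have C: "0 \<le> C" using order_trans[OF norm_ge_zero bnd] .
  have gi: "integrable lborel (\<lambda>y::'a. C * exp (- (pi * (norm y)\<^sup>2)))"
    using integrable_gaussian_vec[of 1, where 'a = 'a] by simp
  have inner_bound: "cmod (inner n \<xi>') \<le> C" for n \<xi>'
  proof -
    have "cmod (inner n \<xi>') \<le> (\<integral>y. C * exp (- (pi * (norm y)\<^sup>2)) \<partial>(lborel :: 'a measure))"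
      unfolding inner_def
    proof (rule order_trans[OF integral_norm_bound integral_mono'[OF gi]])
      show "norm (f (\<xi>' + sqrt (\<delta> n) *\<^sub>R y) * complex_of_real (exp (- (pi * (norm y)\<^sup>2)))) \<le> C * exp (- (pi * (norm y)\<^sup>2))" for y
        using bnd by (simp add: norm_mult mult_right_mono)
    qed (use C in auto)
    then show ?thesis using integral_gaussian_vec[where 'a = 'a] by simp
  qed
  have inner_lim: "(\<lambda>n. inner n \<xi>') \<longlonglongrightarrow> f \<xi>'" for \<xi>'
  proof -
    have "(\<lambda>n. inner n \<xi>') \<longlonglongrightarrow> (\<integral>y. f \<xi>' * of_real (exp (- (pi * (norm (y::'a))\<^sup>2))) \<partial>lborel)"
      unfolding inner_def
    proof (rule integral_dominated_convergence[OF _ _ gi])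
      show "AE y in lborel. (\<lambda>n. f (\<xi>' + sqrt (\<delta> n) *\<^sub>R y) * of_real (exp (- (pi * (norm y)\<^sup>2)))) \<longlonglongrightarrow>
          f \<xi>' * of_real (exp (- (pi * (norm y)\<^sup>2)))"
      proof (intro AE_I2 tendsto_mult tendsto_const)
        fix y :: 'a
        have "(\<lambda>n. \<xi>' + sqrt (\<delta> n) *\<^sub>R y) \<longlonglongrightarrow> \<xi>' + sqrt 0 *\<^sub>R y"
          by (intro tendsto_intros \<delta>0)
        then show "(\<lambda>n. f (\<xi>' + sqrt (\<delta> n) *\<^sub>R y)) \<longlonglongrightarrow> f \<xi>'"
          using cont by (intro isCont_tendsto_compose[where g = f]) (auto simp: continuous_on_eq_continuous_at)
      qed
      show "AE y in lborel. norm (f (\<xi>' + sqrt (\<delta> n) *\<^sub>R y) * complex_of_real (exp (- (pi * (norm y)\<^sup>2)))) \<le> C * exp (- (pi * (norm y)\<^sup>2))" for n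
        using bnd by (simp add: norm_mult mult_right_mono)
    qed measurable
    moreover have "(\<integral>y. f \<xi>' * of_real (exp (- (pi * (norm (y::'a))\<^sup>2))) \<partial>lborel) = f \<xi>'"
      by (simp only: integral_mult_right_zero integral_complex_of_real integral_gaussian_vec) simp
    ultimately show ?thesis by (simp only:)
  qed
  have i2: "integrable lborel (\<lambda>\<xi>. (cmod (f \<xi>))\<^sup>2)"
    by (rule Bochner_Integration.integrable_bound[OF integrable_mult_right[OF integrable_norm[OF f], of C]])
      (use bnd C in \<open>auto simp: power2_eq_square intro!: mult_right_mono\<close>)
  have "(\<lambda>n. \<integral>\<xi>'. cnj (f \<xi>') * inner n \<xi>' \<partial>lborel) \<longlonglongrightarrow> (\<integral>\<xi>'. cnj (f \<xi>') * f \<xi>' \<partial>lborel)"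
  proof (rule integral_dominated_convergence)
    show "(\<lambda>\<xi>'. cnj (f \<xi>') * inner n \<xi>') \<in> borel_measurable lborel" for n
      unfolding inner_def by measurable
    show "integrable lborel (\<lambda>\<xi>. C * cmod (f \<xi>))"
      by (intro integrable_mult_right integrable_norm f)
    show "AE \<xi>' in lborel. norm (cnj (f \<xi>') * inner n \<xi>') \<le> C * cmod (f \<xi>')" for n
      using inner_bound by (auto simp: norm_mult mult.commute[of _ "cmod (inner _ _)"] intro!: mult_right_mono)
    show "AE \<xi>' in lborel. (\<lambda>n. cnj (f \<xi>') * inner n \<xi>') \<longlonglongrightarrow> cnj (f \<xi>') * f \<xi>'"
      using inner_lim by (auto intro!: tendsto_intros)
  qed measurable
  also have "(\<integral>\<xi>'. cnj (f \<xi>') * f \<xi>' \<partial>lborel) = of_real (\<integral>\<xi>. (cmod (f \<xi>))\<^sup>2 \<partial>lborel)"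
    by (subst integral_complex_of_real[symmetric]) (simp only: complex_norm_square mult.commute)
  finally have "(\<lambda>n. \<integral>x. \<rho> n x * (cmod (Ft x))\<^sup>2 \<partial>lborel) \<longlonglongrightarrow> (\<integral>\<xi>. (cmod (f \<xi>))\<^sup>2 \<partial>lborel)"
    unfolding reg(2)[symmetric] by (simp only: tendsto_of_real_iff)
  then have "(\<integral>\<^sup>+x. ennreal ((cmod (Ft x))\<^sup>2) \<partial>lborel) = ennreal (\<integral>\<xi>. (cmod (f \<xi>))\<^sup>2 \<partial>lborel)"
  proof (rule nn_integral_eq_of_regularized[rotated -1])
    show "incseq (\<lambda>n. \<rho> n x)" for x
      unfolding \<rho>_def \<delta>_def incseq_def by (auto intro!: mult_left_mono mult_right_mono divide_left_mono)
    have "(\<lambda>n. \<rho> n x) \<longlonglongrightarrow> exp (- (pi * 0 * (norm x)\<^sup>2))" for x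
      unfolding \<rho>_def by (intro tendsto_intros \<delta>0)
    then show "(\<lambda>n. \<rho> n x) \<longlonglongrightarrow> 1" for x by simp
  qed (use reg(1) in \<open>auto simp: \<rho>_def\<close>)
  also have "\<dots> = (\<integral>\<^sup>+\<xi>. ennreal ((cmod (f \<xi>))\<^sup>2) \<partial>lborel)"
    using i2 by (intro nn_integral_eq_integral[symmetric]) auto
  finally show ?thesis by (simp only: Ft_def)
qed

text \<open>The multiplier is regularized by a Gaussian factor, which gives the exponent \<open>b = 4 \<pi> \<i> \<sigma> + \<delta>\<close> a
  positive real part; the kernel is then an absolutely convergent Gaussian integral, and \<open>\<delta> \<rightarrow> 0\<close>.\<close>

lemma schrodinger_kernel_fourier:
  fixes f :: "'a::euclidean_space \<Rightarrow> complex"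
  defines "fh \<equiv> \<lambda>\<xi>. \<integral>y. cis (- 2 * pi * (\<xi> \<bullet> y)) * f y \<partial>lborel"
  assumes f: "integrable lborel f" and fh: "integrable lborel fh" and \<sigma>: "0 < \<sigma>"
  shows "(\<integral>y. (4 * of_real pi * \<i> * of_real \<sigma>) powr (- of_nat DIM('a) / 2) *
      cis ((norm (x - y))\<^sup>2 / (4 * \<sigma>)) * f y \<partial>lborel) =
    (\<integral>\<xi>. cis (2 * pi * (x \<bullet> \<xi>)) * (cis (- 4 * pi\<^sup>2 * \<sigma> * (norm \<xi>)\<^sup>2) * fh \<xi>) \<partial>lborel)"
proof -
  have [measurable]: "f \<in> borel_measurable borel" "fh \<in> borel_measurable borel"
    using borel_measurable_integrable[OF f] borel_measurable_integrable[OF fh] by auto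
  define b0 where "b0 = 4 * complex_of_real pi * \<i> * of_real \<sigma>"
  define \<delta> where "\<delta> n = 1 / real (Suc n)" for n
  have \<delta>: "0 < \<delta> n" for n by (simp add: \<delta>_def)
  have \<delta>0: "\<delta> \<longlonglongrightarrow> 0" unfolding \<delta>_def by (rule LIMSEQ_Suc[OF lim_const_over_n])
  define b where "b n = b0 + of_real (\<delta> n)" for n
  have Reb: "Re (b n) = \<delta> n" for n by (simp add: b_def b0_def)
  have Imb: "Im (b n) = 4 * pi * \<sigma>" "Im b0 = 4 * pi * \<sigma>" for n by (simp_all add: b_def b0_def)
  have b_lim: "b \<longlonglongrightarrow> b0"
    unfolding b_def using tendsto_add[OF tendsto_const tendsto_of_real[OF \<delta>0], of b0] by simp
  have bnz: "b n \<noteq> 0" "b0 \<noteq> 0" for n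
  proof -
    show "b n \<noteq> 0" using Imb(1)[of n] \<sigma> by (intro notI) simp
    show "b0 \<noteq> 0" using Imb(2) \<sigma> by (intro notI) simp
  qed
  have fub: "integrable (lborel \<Otimes>\<^sub>M lborel) (\<lambda>(\<xi>, y). gauss_wave_vec (b n) (x - y) \<xi> * f y)" for n
  proof (rule lborel_pair.Fubini_integrable)
    have n: "(\<integral>y. norm (gauss_wave_vec (b n) (x - y) \<xi> * f y) \<partial>lborel) = exp (- (pi * \<delta> n * (norm \<xi>)\<^sup>2)) * (\<integral>y. norm (f y) \<partial>lborel)" for \<xi>
      by (simp add: norm_mult norm_gauss_wave_vec Reb)
    show "integrable lborel (\<lambda>\<xi>. \<integral>y. norm (case (\<xi>, y) of (\<xi>, y) \<Rightarrow> gauss_wave_vec (b n) (x - y) \<xi> * f y) \<partial>lborel)"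
      using integrable_gaussian_vec[OF \<delta>[of n], where 'a = 'a] by (simp add: n)
    show "AE \<xi> in lborel. integrable lborel (\<lambda>y. case (\<xi>, y) of (\<xi>, y) \<Rightarrow> gauss_wave_vec (b n) (x - y) \<xi> * f y)"
    proof (rule AE_I2)
      fix \<xi> :: 'a
      have "integrable lborel (\<lambda>y. gauss_wave_vec (b n) (x - y) \<xi> * f y)"
        unfolding gauss_wave_vec_def
        by (rule Bochner_Integration.integrable_bound[OF integrable_mult_right[OF integrable_norm[OF f], of "exp (- (pi * \<delta> n * (norm \<xi>)\<^sup>2))"]])
          (auto simp: norm_mult Reb)
      then show "integrable lborel (\<lambda>y. case (\<xi>, y) of (\<xi>, y) \<Rightarrow> gauss_wave_vec (b n) (x - y) \<xi> * f y)" by simp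
    qed
  qed (unfold gauss_wave_vec_def, measurable)
  have reg: "(\<integral>\<xi>. gauss_wave_vec (b n) x \<xi> * fh \<xi> \<partial>lborel) =
      (\<integral>y. b n powr (- (of_nat DIM('a) / 2)) * exp (- of_real (pi * (norm (x - y))\<^sup>2) / b n) * f y \<partial>lborel)" for n
  proof -
    have "(\<integral>\<xi>. gauss_wave_vec (b n) x \<xi> * fh \<xi> \<partial>lborel) =
        (\<integral>\<xi>. (\<integral>y. gauss_wave_vec (b n) (x - y) \<xi> * f y \<partial>lborel) \<partial>lborel)"
    proof (intro Bochner_Integration.integral_cong refl)
      fix \<xi> :: 'a
      have "gauss_wave_vec (b n) x \<xi> * fh \<xi> = (\<integral>y. gauss_wave_vec (b n) x \<xi> * (cis (- 2 * pi * (\<xi> \<bullet> y)) * f y) \<partial>lborel)"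
        unfolding fh_def by (rule integral_mult_right_zero[symmetric])
      also have "\<dots> = (\<integral>y. gauss_wave_vec (b n) (x - y) \<xi> * f y \<partial>lborel)"
      proof (intro Bochner_Integration.integral_cong refl)
        fix y :: 'a
        show "gauss_wave_vec (b n) x \<xi> * (cis (- 2 * pi * (\<xi> \<bullet> y)) * f y) = gauss_wave_vec (b n) (x - y) \<xi> * f y"
          using gauss_wave_vec_shift[of "b n" x "- y" \<xi>] by simp
      qed
      finally show "gauss_wave_vec (b n) x \<xi> * fh \<xi> = (\<integral>y. gauss_wave_vec (b n) (x - y) \<xi> * f y \<partial>lborel)" .
    qed
    also have "\<dots> = (\<integral>y. (\<integral>\<xi>. gauss_wave_vec (b n) (x - y) \<xi> * f y \<partial>lborel) \<partial>lborel)"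
      by (rule lborel_pair.Fubini_integral[OF fub, symmetric])
    also have "\<dots> = (\<integral>y. b n powr (- (of_nat DIM('a) / 2)) * exp (- of_real (pi * (norm (x - y))\<^sup>2) / b n) * f y \<partial>lborel)"
      using \<delta>[of n] by (simp add: integral_gauss_wave_vec Reb)
    finally show ?thesis .
  qed
  have "(\<lambda>n. \<integral>\<xi>. gauss_wave_vec (b n) x \<xi> * fh \<xi> \<partial>lborel) \<longlonglongrightarrow> (\<integral>\<xi>. gauss_wave_vec b0 x \<xi> * fh \<xi> \<partial>lborel)"
  proof (rule integral_dominated_convergence[OF _ _ integrable_norm[OF fh]])
    show "AE \<xi> in lborel. (\<lambda>n. gauss_wave_vec (b n) x \<xi> * fh \<xi>) \<longlonglongrightarrow> gauss_wave_vec b0 x \<xi> * fh \<xi>"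
      unfolding gauss_wave_vec_def by (auto intro!: tendsto_intros b_lim)
    show "AE \<xi> in lborel. norm (gauss_wave_vec (b n) x \<xi> * fh \<xi>) \<le> norm (fh \<xi>)" for n
      using \<delta>[of n] by (auto simp: norm_mult norm_gauss_wave_vec Reb less_imp_le intro!: mult_left_le_one_le)
  qed (unfold gauss_wave_vec_def, measurable)
  moreover have "(\<lambda>n. \<integral>y. b n powr (- (of_nat DIM('a) / 2)) * exp (- of_real (pi * (norm (x - y))\<^sup>2) / b n) * f y \<partial>lborel)
      \<longlonglongrightarrow> (\<integral>y. b0 powr (- (of_nat DIM('a) / 2)) * exp (- of_real (pi * (norm (x - y))\<^sup>2) / b0) * f y \<partial>lborel)"
  proof (rule integral_dominated_convergence)
    show "integrable lborel (\<lambda>y. (4 * pi * \<sigma>) powr (- (DIM('a) / 2)) * norm (f y))"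
      by (intro integrable_mult_right integrable_norm f)
    show "AE y in lborel. (\<lambda>n. b n powr (- (of_nat DIM('a) / 2)) * exp (- of_real (pi * (norm (x - y))\<^sup>2) / b n) * f y)
      \<longlonglongrightarrow> b0 powr (- (of_nat DIM('a) / 2)) * exp (- of_real (pi * (norm (x - y))\<^sup>2) / b0) * f y"
      using \<sigma> bnz Imb by (intro AE_I2 tendsto_intros b_lim) (auto simp: complex_nonpos_Reals_iff)
    show "AE y in lborel. norm (b n powr (- (of_nat DIM('a) / 2)) * exp (- of_real (pi * (norm (x - y))\<^sup>2) / b n) * f y)
        \<le> (4 * pi * \<sigma>) powr (- (DIM('a) / 2)) * norm (f y)" for n
    proof (rule AE_I2)
      fix y :: 'a
      have "norm (b n powr (- (of_nat DIM('a) / 2))) = norm (b n) powr (- (DIM('a) / 2))"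
        using norm_powr_real_powr'[of "- (of_nat DIM('a) / 2)" "b n"] by simp
      also have "\<dots> \<le> (4 * pi * \<sigma>) powr (- (DIM('a) / 2))"
        using abs_Im_le_cmod[of "b n"] \<sigma> by (intro powr_mono2') (auto simp: Imb)
      finally have 1: "norm (b n powr (- (of_nat DIM('a) / 2))) \<le> (4 * pi * \<sigma>) powr (- (DIM('a) / 2))" .
      have "Re (- of_real (pi * (norm (x - y))\<^sup>2) / b n) \<le> 0"
        using \<delta>[of n] by (simp add: Re_divide Reb divide_nonneg_nonneg)
      then have 2: "norm (exp (- of_real (pi * (norm (x - y))\<^sup>2) / b n)) \<le> 1" by simp
      have "norm (b n powr (- (of_nat DIM('a) / 2))) * norm (exp (- of_real (pi * (norm (x - y))\<^sup>2) / b n)) * norm (f y)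
          \<le> (4 * pi * \<sigma>) powr (- (DIM('a) / 2)) * 1 * norm (f y)"
        by (intro mult_mono 1 2) auto
      then show "norm (b n powr (- (of_nat DIM('a) / 2)) * exp (- of_real (pi * (norm (x - y))\<^sup>2) / b n) * f y)
        \<le> (4 * pi * \<sigma>) powr (- (DIM('a) / 2)) * norm (f y)"
        by (simp only: norm_mult mult_1_right)
    qed
  qed measurable
  ultimately have eq: "(\<integral>\<xi>. gauss_wave_vec b0 x \<xi> * fh \<xi> \<partial>lborel) =
      (\<integral>y. b0 powr (- (of_nat DIM('a) / 2)) * exp (- of_real (pi * (norm (x - y))\<^sup>2) / b0) * f y \<partial>lborel)"
    unfolding reg using LIMSEQ_unique by blast
  have e1: "gauss_wave_vec b0 x \<xi> * fh \<xi> =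
      cis (2 * pi * (x \<bullet> \<xi>)) * (cis (- 4 * pi\<^sup>2 * \<sigma> * (norm \<xi>)\<^sup>2) * fh \<xi>)" for \<xi>
    unfolding gauss_wave_vec_def b0_def
    by (simp add: cis_conv_exp inner_commute[of x] power2_eq_square ac_simps)
  have e2: "exp (- of_real (pi * (norm (x - y))\<^sup>2) / b0) = cis ((norm (x - y))\<^sup>2 / (4 * \<sigma>))" for y
    unfolding cis_conv_exp b0_def using \<sigma> by (intro arg_cong[where f = exp]) (simp add: field_simps)
  show ?thesis
    using eq unfolding e1 e2 by (simp add: b0_def)
qed

text \<open>The weight measures decay in space and in frequency. It is a product over the coordinates, so that its
  integral factorizes, and its reciprocal is a polynomial, so that multiplication by the reciprocal of
  the weight corresponds to a differential operator under the Fourier transform.\<close>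

definition weight :: "'a::euclidean_space \<Rightarrow> real" where
  "weight x = (\<Prod>b\<in>Basis. 1 / (1 + (x \<bullet> b)\<^sup>2))"

lemma weight_pos: "0 < weight x"
  unfolding weight_def by (intro prod_pos) (auto intro: add_pos_nonneg)

lemma weight_le_1: "weight x \<le> 1"
  unfolding weight_def
proof (intro prod_le_1 conjI)
  show "1 / (1 + (x \<bullet> b)\<^sup>2) \<le> 1" for b
    using frac_le[of 1 1 1 "1 + (x \<bullet> b)\<^sup>2"] by simp
qed auto

lemma integrable_weight: "integrable lborel weight"
  unfolding weight_def[abs_def] by (intro integrable_prod_Basis integrable_inverse_1_plus_sq)

lemma borel_measurable_weight [measurable]: "weight \<in> borel_measurable borel"
  using borel_measurable_integrable[OF integrable_weight] by simp

section \<open>Schwartz functions and their Fourier transforms in space\<close>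

abbreviation partial_deriv :: "'a::euclidean_space \<Rightarrow> ('a \<Rightarrow> complex) \<Rightarrow> 'a \<Rightarrow> complex" where
  "partial_deriv b f \<equiv> iterated_deriv [b] f"

lemma schwartzD:
  assumes "f \<in> schwartz" "bs \<in> lists Basis"
  shows "iterated_deriv bs f differentiable (at x)"
    "bounded (range (\<lambda>x. norm x ^ k *\<^sub>R iterated_deriv bs f x))"
  using assms by (auto simp: schwartz_def)

lemma iterated_deriv_append: "iterated_deriv bs (iterated_deriv cs f) = iterated_deriv (bs @ cs) f"
  by (induction bs) auto

lemma schwartz_partial_deriv:
  assumes "f \<in> schwartz" "b \<in> Basis"
  shows "partial_deriv b f \<in> schwartz"
  unfolding schwartz_def
proof (intro CollectI ballI)
  fix bs :: "'a list" assume "bs \<in> lists Basis"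
  then have bs: "bs @ [b] \<in> lists Basis" using assms(2) by auto
  show "(\<forall>x. iterated_deriv bs (partial_deriv b f) differentiable at x) \<and>
      (\<forall>k. bounded (range (\<lambda>x. norm x ^ k *\<^sub>R iterated_deriv bs (partial_deriv b f) x)))"
    unfolding iterated_deriv_append using schwartzD[OF assms(1) bs] by auto
qed

lemma schwartz_has_derivative:
  assumes "f \<in> schwartz"
  shows "(f has_derivative frechet_derivative f (at x)) (at x)"
  using schwartzD(1)[OF assms, of "[]" x] by (simp add: frechet_derivative_works)

lemma iterated_deriv_add:
  assumes f: "f \<in> schwartz" and g: "g \<in> schwartz" and bs: "bs \<in> lists Basis"
  shows "iterated_deriv bs (\<lambda>x. f x + g x) = (\<lambda>x. iterated_deriv bs f x + iterated_deriv bs g x)"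
  using bs
proof (induction bs)
  case (Cons b bs)
  then have bs: "bs \<in> lists Basis" and IH: "iterated_deriv bs (\<lambda>x. f x + g x) = (\<lambda>x. iterated_deriv bs f x + iterated_deriv bs g x)"
    by auto
  show ?case
  proof
    fix x
    have "((\<lambda>x. iterated_deriv bs f x + iterated_deriv bs g x) has_derivative
        (\<lambda>h. frechet_derivative (iterated_deriv bs f) (at x) h + frechet_derivative (iterated_deriv bs g) (at x) h)) (at x)"
      using schwartzD(1)[OF f bs] schwartzD(1)[OF g bs]
      by (intro has_derivative_add) (simp_all add: frechet_derivative_works)
    from frechet_derivative_at[OF this]
    show "iterated_deriv (b # bs) (\<lambda>x. f x + g x) x = iterated_deriv (b # bs) f x + iterated_deriv (b # bs) g x"
      by (simp add: IH) metis
  qed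
qed simp

lemma iterated_deriv_scale:
  assumes f: "f \<in> schwartz" and bs: "bs \<in> lists Basis"
  shows "iterated_deriv bs (\<lambda>x. c * f x) = (\<lambda>x. c * iterated_deriv bs f x)"
  using bs
proof (induction bs)
  case (Cons b bs)
  then have bs: "bs \<in> lists Basis" and IH: "iterated_deriv bs (\<lambda>x. c * f x) = (\<lambda>x. c * iterated_deriv bs f x)"
    by auto
  show ?case
  proof
    fix x
    have "((\<lambda>x. c * iterated_deriv bs f x) has_derivative
        (\<lambda>h. c * frechet_derivative (iterated_deriv bs f) (at x) h)) (at x)"
      using schwartzD(1)[OF f bs] by (intro has_derivative_mult_right) (simp add: frechet_derivative_works)
    from frechet_derivative_at[OF this]
    show "iterated_deriv (b # bs) (\<lambda>x. c * f x) x = c * iterated_deriv (b # bs) f x"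
      by (simp add: IH) metis
  qed
qed simp

lemma schwartz_add:
  assumes f: "f \<in> schwartz" and g: "g \<in> schwartz"
  shows "(\<lambda>x. f x + g x) \<in> schwartz"
  unfolding schwartz_def
proof (intro CollectI ballI conjI allI)
  fix bs :: "'a list" assume bs: "bs \<in> lists Basis"
  show "iterated_deriv bs (\<lambda>x. f x + g x) differentiable at x" for x
    using schwartzD(1)[OF f bs] schwartzD(1)[OF g bs] by (simp add: iterated_deriv_add[OF f g bs])
  show "bounded (range (\<lambda>x. norm x ^ k *\<^sub>R iterated_deriv bs (\<lambda>x. f x + g x) x))" for k
    using bounded_plus_comp[OF schwartzD(2)[OF f bs, of k] schwartzD(2)[OF g bs, of k]]
    by (simp add: iterated_deriv_add[OF f g bs] scaleR_add_right)
qed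

lemma schwartz_scale:
  assumes f: "f \<in> schwartz"
  shows "(\<lambda>x. c * f x) \<in> schwartz"
  unfolding schwartz_def
proof (intro CollectI ballI conjI allI)
  fix bs :: "'a list" assume bs: "bs \<in> lists Basis"
  show "iterated_deriv bs (\<lambda>x. c * f x) differentiable at x" for x
    using schwartzD(1)[OF f bs] by (simp add: iterated_deriv_scale[OF f bs])
  show "bounded (range (\<lambda>x. norm x ^ k *\<^sub>R iterated_deriv bs (\<lambda>x. c * f x) x))" for k
  proof -
    have "bounded ((\<lambda>y. c * y) ` range (\<lambda>x. norm x ^ k *\<^sub>R iterated_deriv bs f x))"
      by (rule bounded_linear_image[OF schwartzD(2)[OF f bs] bounded_linear_mult_right])
    then show ?thesis by (simp add: iterated_deriv_scale[OF f bs] image_image)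
  qed
qed

lemma continuous_on_schwartz: "f \<in> schwartz \<Longrightarrow> continuous_on UNIV f"
  by (auto simp: continuous_on_eq_continuous_at intro: has_derivative_continuous[OF schwartz_has_derivative])

lemma borel_measurable_schwartz: "f \<in> schwartz \<Longrightarrow> f \<in> borel_measurable borel"
  by (intro borel_measurable_continuous_onI continuous_on_schwartz)

lemma schwartz_directional_derivative:
  assumes "f \<in> schwartz"
  shows "((\<lambda>t. f (t *\<^sub>R b + x)) has_vector_derivative partial_deriv b f (t *\<^sub>R b + x)) (at t)"
proof -
  have "((\<lambda>t. t *\<^sub>R b + x) has_derivative (\<lambda>h. h *\<^sub>R b)) (at t)"
    by (auto intro!: derivative_eq_intros)
  from has_derivative_compose[OF this schwartz_has_derivative[OF assms]]
  have "((\<lambda>t. f (t *\<^sub>R b + x)) has_derivative (\<lambda>h. frechet_derivative f (at (t *\<^sub>R b + x)) (h *\<^sub>R b))) (at t)" .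
  moreover have "linear (frechet_derivative f (at (t *\<^sub>R b + x)))"
    using schwartzD(1)[OF assms, of "[]"] by (intro linear_frechet_derivative) simp
  ultimately show ?thesis
    by (simp add: has_vector_derivative_def linear_scale)
qed

lemma schwartz_bound_power:
  assumes "f \<in> schwartz"
  obtains C where "0 \<le> C" "\<And>x. (1 + (norm x)\<^sup>2) ^ m * cmod (f x) \<le> C"
proof -
  obtain A where A: "\<And>x. cmod (f x) \<le> A"
    using schwartzD(2)[OF assms, of "[]" 0] by (auto simp: bounded_iff)
  obtain B where B: "\<And>x. norm x ^ (2 * m) * cmod (f x) \<le> B"
    using schwartzD(2)[OF assms, of "[]" "2 * m"] by (auto simp: bounded_iff)
  have le: "(1 + u) ^ m \<le> 2 ^ m * (1 + u ^ m)" if "0 \<le> u" for u :: real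
  proof (cases "u \<le> 1")
    case True
    then have "(1 + u) ^ m \<le> 2 ^ m" using that by (intro power_mono) auto
    also have "\<dots> \<le> 2 ^ m * (1 + u ^ m)" using that by simp
    finally show ?thesis .
  next
    case False
    then have "(1 + u) ^ m \<le> (2 * u) ^ m" using that by (intro power_mono) auto
    also have "\<dots> \<le> 2 ^ m * (1 + u ^ m)" by (simp add: power_mult_distrib)
    finally show ?thesis .
  qed
  have "(1 + (norm x)\<^sup>2) ^ m * cmod (f x) \<le> 2 ^ m * (A + B)" for x
  proof -
    have "(1 + (norm x)\<^sup>2) ^ m * cmod (f x) \<le> 2 ^ m * (1 + ((norm x)\<^sup>2) ^ m) * cmod (f x)"
      by (intro mult_right_mono le) auto
    also have "\<dots> = 2 ^ m * (cmod (f x) + norm x ^ (2 * m) * cmod (f x))"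
      by (simp add: power_mult[symmetric] distrib_left distrib_right)
    also have "\<dots> \<le> 2 ^ m * (A + B)"
      by (intro mult_left_mono add_mono A B) auto
    finally show ?thesis .
  qed
  moreover have "0 \<le> 2 ^ m * (A + B)"
    using order_trans[OF norm_ge_zero A] order_trans[OF _ B] by (auto intro!: mult_nonneg_nonneg add_nonneg_nonneg)
  ultimately show ?thesis using that by blast
qed

text \<open>The reciprocal of the right-hand side is bounded by a multiple of \<open>(1 + |X|\<^sup>2)\<^sup>d\<^sup>+\<^sup>1\<close>.\<close>

lemma schwartz_decay:
  fixes \<phi> :: "'a::euclidean_space \<times> real \<Rightarrow> complex"
  assumes "\<phi> \<in> schwartz"
  obtains C where "0 \<le> C" "\<And>x t. cmod (\<phi> (x, t)) \<le> C * weight x / (1 + t\<^sup>2)"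
proof -
  obtain C where C: "0 \<le> C" "\<And>X. (1 + (norm X)\<^sup>2) ^ Suc (DIM('a)) * cmod (\<phi> X) \<le> C"
    using schwartz_bound_power[OF assms] by blast
  have "cmod (\<phi> (x, t)) \<le> C * weight x / (1 + t\<^sup>2)" for x t
  proof -
    have n: "(norm (x, t))\<^sup>2 = (norm x)\<^sup>2 + t\<^sup>2"
      by (simp add: norm_Pair)
    have "(\<Prod>b\<in>Basis. 1 + (x \<bullet> b)\<^sup>2) \<le> (\<Prod>b\<in>(Basis::'a set). 1 + (norm (x, t))\<^sup>2)"
    proof (intro prod_mono conjI)
      fix b :: 'a assume "b \<in> Basis"
      then have "\<bar>x \<bullet> b\<bar>\<^sup>2 \<le> (norm x)\<^sup>2" by (intro power_mono Basis_le_norm) auto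
      then show "1 + (x \<bullet> b)\<^sup>2 \<le> 1 + (norm (x, t))\<^sup>2"
        using zero_le_power2[of t] unfolding n power2_abs by linarith
    qed auto
    then have "(\<Prod>b\<in>Basis. 1 + (x \<bullet> b)\<^sup>2) * (1 + t\<^sup>2) \<le> (1 + (norm (x, t))\<^sup>2) ^ DIM('a) * (1 + (norm (x, t))\<^sup>2)"
      unfolding n by (intro mult_mono) (auto intro!: prod_nonneg)
    then have "(\<Prod>b\<in>Basis. 1 + (x \<bullet> b)\<^sup>2) * (1 + t\<^sup>2) * cmod (\<phi> (x, t)) \<le>
        (1 + (norm (x, t))\<^sup>2) ^ Suc (DIM('a)) * cmod (\<phi> (x, t))"
      by (intro mult_right_mono) (auto simp: mult.commute)
    also have "\<dots> \<le> C" by (rule C)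
    finally have "(\<Prod>b\<in>Basis. 1 + (x \<bullet> b)\<^sup>2) * (1 + t\<^sup>2) * cmod (\<phi> (x, t)) \<le> C" .
    moreover have "(\<Prod>b\<in>Basis. 1 + (x \<bullet> b)\<^sup>2) = 1 / weight x"
      by (simp add: weight_def prod_dividef)
    ultimately have "(1 / weight x) * (1 + t\<^sup>2) * cmod (\<phi> (x, t)) \<le> C" by simp
    moreover have "0 < 1 + t\<^sup>2" by (simp add: add_pos_nonneg)
    ultimately show ?thesis
      using weight_pos[of x] by (simp add: field_simps)
  qed
  then show ?thesis using that C(1) by blast
qed

lemma schwartz_decay_space:
  fixes \<phi> :: "'a::euclidean_space \<times> real \<Rightarrow> complex"
  assumes "\<phi> \<in> schwartz"
  obtains C where "0 \<le> C" "\<And>x t. cmod (\<phi> (x, t)) \<le> C * weight x"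
proof -
  obtain C where C: "0 \<le> C" "\<And>x t. cmod (\<phi> (x, t)) \<le> C * weight x / (1 + t\<^sup>2)"
    using schwartz_decay[OF assms] by blast
  have "cmod (\<phi> (x, t)) \<le> C * weight x" for x t
  proof -
    have "C * weight x / (1 + t\<^sup>2) \<le> C * weight x"
      using C(1) weight_pos[of x] frac_le[of "C * weight x" "C * weight x" 1 "1 + t\<^sup>2"] by simp
    with C(2)[of x t] show ?thesis by (rule order_trans)
  qed
  with C(1) show ?thesis by (rule that)
qed

lemma integrable_schwartz_slice:
  fixes \<phi> :: "'a::euclidean_space \<times> real \<Rightarrow> complex"
  assumes "\<phi> \<in> schwartz"
  shows "integrable lborel (\<lambda>x. \<phi> (x, t))"
proof -
  have [measurable]: "\<phi> \<in> borel_measurable borel" by (rule borel_measurable_schwartz[OF assms])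
  obtain C where C: "0 \<le> C" "\<And>x t. cmod (\<phi> (x, t)) \<le> C * weight x"
    using schwartz_decay_space[OF assms] by blast
  show ?thesis
  proof (rule Bochner_Integration.integrable_bound[OF integrable_mult_right[OF integrable_weight, of C]])
    show "(\<lambda>x. \<phi> (x, t)) \<in> borel_measurable lborel" by measurable
  qed (use C weight_pos in \<open>auto intro: order_trans[OF _ abs_ge_self]\<close>)
qed

lemma has_vector_derivative_cis:
  assumes "(f has_real_derivative D) (at x within S)"
  shows "((\<lambda>x. cis (f x)) has_vector_derivative D *\<^sub>R (\<i> * cis (f x))) (at x within S)"
  unfolding has_vector_derivative_complex_iff using assms by (auto intro!: derivative_eq_intros)

context
  fixes \<phi> :: "(real ^ 'd) \<times> real \<Rightarrow> complex"
  assumes \<phi>: "\<phi> \<in> schwartz"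
begin

lemma integrable_fourier_integrand: "integrable lborel (\<lambda>x. cis (- 2 * pi * (\<xi> \<bullet> x)) * \<phi> (x, t))"
  by (rule Bochner_Integration.integrable_bound[OF integrable_norm[OF integrable_schwartz_slice[OF \<phi>, of t]]])
    (use borel_measurable_schwartz[OF \<phi>] in \<open>auto simp: norm_mult\<close>)

text \<open>The derivative of \<open>cis (- 2 \<pi> \<langle>\<xi>, x\<rangle>) \<phi>(x, t)\<close> in the direction \<open>i\<close> has vanishing integral.\<close>

lemma fourier_space_partial_deriv:
  assumes i: "i \<in> Basis"
  shows "fourier_space (partial_deriv (i, 0) \<phi>) \<xi> t = 2 * of_real pi * \<i> * of_real (\<xi> \<bullet> i) * fourier_space \<phi> \<xi> t"
proof -
  have b: "(i, 0) \<in> (Basis :: ((real ^ 'd) \<times> real) set)"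
    using i by (auto simp: Basis_prod_def)
  have \<psi>: "partial_deriv (i, 0) \<phi> \<in> schwartz"
    by (rule schwartz_partial_deriv[OF \<phi> b])
  note int = integrable_fourier_integrand
  have int': "integrable lborel (\<lambda>x. cis (- 2 * pi * (\<xi> \<bullet> x)) * partial_deriv (i, 0) \<phi> (x, t))"
    by (rule Bochner_Integration.integrable_bound[OF integrable_norm[OF integrable_schwartz_slice[OF \<psi>, of t]]])
      (use borel_measurable_schwartz[OF \<psi>] in \<open>auto simp: norm_mult\<close>)
  let ?c = "- 2 * of_real pi * \<i> * complex_of_real (\<xi> \<bullet> i)"
  have "(\<integral>x. ?c * (cis (- 2 * pi * (\<xi> \<bullet> x)) * \<phi> (x, t)) + cis (- 2 * pi * (\<xi> \<bullet> x)) * partial_deriv (i, 0) \<phi> (x, t) \<partial>lborel) = 0"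
  proof (rule integral_directional_derivative_eq_0[where b = i])
    fix x :: "real ^ 'd" and \<tau> :: real
    have "((\<lambda>\<tau>. \<phi> (\<tau> *\<^sub>R (i, 0) + (x, t))) has_vector_derivative partial_deriv (i, 0) \<phi> (\<tau> *\<^sub>R (i, 0) + (x, t))) (at \<tau>)"
      by (rule schwartz_directional_derivative[OF \<phi>])
    then have 1: "((\<lambda>\<tau>. \<phi> (\<tau> *\<^sub>R i + x, t)) has_vector_derivative partial_deriv (i, 0) \<phi> (\<tau> *\<^sub>R i + x, t)) (at \<tau>)"
      by (simp del: iterated_deriv.simps)
    have 2: "((\<lambda>\<tau>. cis (- 2 * pi * (\<xi> \<bullet> (\<tau> *\<^sub>R i + x)))) has_vector_derivative
        ?c * cis (- 2 * pi * (\<xi> \<bullet> (\<tau> *\<^sub>R i + x)))) (at \<tau>)"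
    proof (rule has_vector_derivative_eq_rhs[OF has_vector_derivative_cis])
      show "((\<lambda>\<tau>. - 2 * pi * (\<xi> \<bullet> (\<tau> *\<^sub>R i + x))) has_real_derivative - 2 * pi * (\<xi> \<bullet> i)) (at \<tau>)"
        unfolding inner_add_right inner_scaleR_right by (auto intro!: derivative_eq_intros)
    qed (simp add: scaleR_conv_of_real)
    show "((\<lambda>\<tau>. cis (- 2 * pi * (\<xi> \<bullet> (\<tau> *\<^sub>R i + x))) * \<phi> (\<tau> *\<^sub>R i + x, t)) has_vector_derivative
        ?c * (cis (- 2 * pi * (\<xi> \<bullet> (\<tau> *\<^sub>R i + x))) * \<phi> (\<tau> *\<^sub>R i + x, t)) +
        cis (- 2 * pi * (\<xi> \<bullet> (\<tau> *\<^sub>R i + x))) * partial_deriv (i, 0) \<phi> (\<tau> *\<^sub>R i + x, t)) (at \<tau>)"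
      by (rule has_vector_derivative_eq_rhs[OF has_vector_derivative_mult[OF 2 1]]) (simp only: ac_simps)
  next
    have c: "continuous_on UNIV (\<lambda>x. \<phi> (x, t))" "continuous_on UNIV (\<lambda>x. partial_deriv (i, 0) \<phi> (x, t))"
      by (rule continuous_on_compose2[OF continuous_on_schwartz[OF \<phi>]], auto intro!: continuous_intros)
        (rule continuous_on_compose2[OF continuous_on_schwartz[OF \<psi>, simplified]], auto intro!: continuous_intros)
    show "continuous_on UNIV (\<lambda>x. ?c * (cis (- 2 * pi * (\<xi> \<bullet> x)) * \<phi> (x, t)) + cis (- 2 * pi * (\<xi> \<bullet> x)) * partial_deriv (i, 0) \<phi> (x, t))"
      by (intro continuous_intros c)
    show "integrable lborel (\<lambda>x. ?c * (cis (- 2 * pi * (\<xi> \<bullet> x)) * \<phi> (x, t)) + cis (- 2 * pi * (\<xi> \<bullet> x)) * partial_deriv (i, 0) \<phi> (x, t))"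
      by (intro Bochner_Integration.integrable_add integrable_mult_right int int')
  qed (rule int)
  also have "(\<integral>x. ?c * (cis (- 2 * pi * (\<xi> \<bullet> x)) * \<phi> (x, t)) + cis (- 2 * pi * (\<xi> \<bullet> x)) * partial_deriv (i, 0) \<phi> (x, t) \<partial>lborel) =
      ?c * fourier_space \<phi> \<xi> t + fourier_space (partial_deriv (i, 0) \<phi>) \<xi> t"
    unfolding fourier_space_def
    by (subst Bochner_Integration.integral_add[OF integrable_mult_right[OF int] int'])
      (simp only: integral_mult_right_zero)
  finally show ?thesis by (simp add: add_eq_0_iff2 algebra_simps)
qed

lemma fourier_space_bound_time:
  obtains C where "0 \<le> C" "\<And>\<xi> t. cmod (fourier_space \<phi> \<xi> t) \<le> C / (1 + t\<^sup>2)"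
proof -
  obtain C where C: "0 \<le> C" "\<And>x t. cmod (\<phi> (x, t)) \<le> C * weight x / (1 + t\<^sup>2)"
    using schwartz_decay[OF \<phi>] by blast
  let ?W = "\<integral>x. weight x \<partial>(lborel :: (real ^ 'd) measure)"
  have "cmod (fourier_space \<phi> \<xi> t) \<le> (C * ?W) / (1 + t\<^sup>2)" for \<xi> t
  proof -
    have "cmod (fourier_space \<phi> \<xi> t) \<le> (\<integral>x. C / (1 + t\<^sup>2) * weight (x :: real ^ 'd) \<partial>lborel)"
      unfolding fourier_space_def
    proof (rule order_trans[OF integral_norm_bound integral_mono])
      show "integrable lborel (\<lambda>x. norm (cis (- 2 * pi * (\<xi> \<bullet> x)) * \<phi> (x, t)))"
        by (intro integrable_norm integrable_fourier_integrand)
      show "integrable lborel (\<lambda>x. C / (1 + t\<^sup>2) * weight (x :: real ^ 'd))"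
        by (intro integrable_mult_right integrable_weight)
      show "norm (cis (- 2 * pi * (\<xi> \<bullet> x)) * \<phi> (x, t)) \<le> C / (1 + t\<^sup>2) * weight x" for x
        using C(2)[of x t] by (simp add: norm_mult)
    qed
    then show ?thesis by simp
  qed
  moreover have "0 \<le> C * ?W"
    using C(1) weight_pos by (intro mult_nonneg_nonneg Bochner_Integration.integral_nonneg) (auto intro: less_imp_le)
  ultimately show ?thesis using that by blast
qed

lemma fourier_space_time_derivative:
  "((\<lambda>t. fourier_space \<phi> \<xi> t) has_vector_derivative fourier_space (partial_deriv (0, 1) \<phi>) \<xi> t) (at t)"
proof -
  have b: "(0, 1) \<in> (Basis :: ((real ^ 'd) \<times> real) set)"
    by (auto simp: Basis_prod_def)
  have \<psi>: "partial_deriv (0, 1) \<phi> \<in> schwartz"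
    by (rule schwartz_partial_deriv[OF \<phi> b])
  obtain C where C: "0 \<le> C" "\<And>x t. cmod (partial_deriv (0, 1) \<phi> (x, t)) \<le> C * weight x"
    using schwartz_decay_space[OF \<psi>] by blast
  show ?thesis
    unfolding fourier_space_def
  proof (rule has_vector_derivative_integral[where B = "\<lambda>x. C * weight x"])
    show "integrable lborel (\<lambda>x. cis (- 2 * pi * (\<xi> \<bullet> x)) * \<phi> (x, t))" for t
      by (rule integrable_fourier_integrand)
    show "(\<lambda>x. cis (- 2 * pi * (\<xi> \<bullet> x)) * partial_deriv (0, 1) \<phi> (x, t)) \<in> borel_measurable lborel"
      using borel_measurable_schwartz[OF \<psi>] by measurable
    show "((\<lambda>t. cis (- 2 * pi * (\<xi> \<bullet> x)) * \<phi> (x, t)) has_vector_derivative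
        cis (- 2 * pi * (\<xi> \<bullet> x)) * partial_deriv (0, 1) \<phi> (x, t)) (at t)" for t x
    proof (rule has_vector_derivative_mult_right)
      have "((\<lambda>\<tau>. \<phi> (\<tau> *\<^sub>R (0, 1) + (x, 0))) has_vector_derivative partial_deriv (0, 1) \<phi> (t *\<^sub>R (0, 1) + (x, 0))) (at t)"
        by (rule schwartz_directional_derivative[OF \<phi>])
      then show "((\<lambda>t. \<phi> (x, t)) has_vector_derivative partial_deriv (0, 1) \<phi> (x, t)) (at t)"
        by (simp del: iterated_deriv.simps)
    qed
    show "norm (cis (- 2 * pi * (\<xi> \<bullet> x)) * partial_deriv (0, 1) \<phi> (x, t)) \<le> C * weight x" for t x
      using C(2)[of x t] by (simp add: norm_mult del: iterated_deriv.simps)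
  qed (auto intro: integrable_mult_right integrable_weight)
qed

lemma continuous_fourier_space: "continuous_on UNIV (\<lambda>\<xi>. fourier_space \<phi> \<xi> t)"
proof -
  have [measurable]: "\<phi> \<in> borel_measurable borel" by (rule borel_measurable_schwartz[OF \<phi>])
  have "((\<lambda>\<xi>. fourier_space \<phi> \<xi> t) \<longlongrightarrow> fourier_space \<phi> \<xi>0 t) (at \<xi>0)" for \<xi>0
    unfolding fourier_space_def
  proof (rule integral_dominated_convergence_within[OF _ _ integrable_norm[OF integrable_schwartz_slice[OF \<phi>, of t]]])
    show "AE x in lborel. ((\<lambda>\<xi>. cis (- 2 * pi * (\<xi> \<bullet> x)) * \<phi> (x, t)) \<longlongrightarrow> cis (- 2 * pi * (\<xi>0 \<bullet> x)) * \<phi> (x, t)) (at \<xi>0)"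
      by (intro AE_I2 tendsto_intros)
  qed (auto simp: norm_mult)
  then show ?thesis by (auto simp: continuous_on_def)
qed

lemma borel_measurable_fourier_space:
  "(\<lambda>(\<xi>, t). fourier_space \<phi> \<xi> t) \<in> borel_measurable (borel \<Otimes>\<^sub>M borel)"
proof -
  have [measurable]: "\<phi> \<in> borel_measurable (borel \<Otimes>\<^sub>M borel)"
    using borel_measurable_schwartz[OF \<phi>] by (simp add: borel_prod)
  show ?thesis unfolding fourier_space_def by measurable
qed

end

lemma fourier_space_add:
  assumes "\<phi> \<in> schwartz" "\<psi> \<in> schwartz"
  shows "fourier_space (\<lambda>X. \<phi> X + \<psi> X) \<xi> t = fourier_space \<phi> \<xi> t + fourier_space \<psi> \<xi> t"
  unfolding fourier_space_def distrib_left
  by (rule Bochner_Integration.integral_add[OF integrable_fourier_integrand[OF assms(1)] integrable_fourier_integrand[OF assms(2)]])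

lemma fourier_space_scale: "fourier_space (\<lambda>X. c * \<phi> X) \<xi> t = c * fourier_space \<phi> \<xi> t"
  unfolding fourier_space_def by (simp add: mult.left_commute[of _ c])

text \<open>The functions \<open>m\<close> such that \<open>m(D\<^sub>x)\<close> acts on Schwartz functions. They form an algebra containing the
  coordinates, so that the decay of a transform in \<open>\<xi>\<close> and its time derivative reduce to bounds for the
  transforms of other Schwartz functions.\<close>

definition fourier_multiplier :: "(real ^ 'd \<Rightarrow> complex) \<Rightarrow> bool" where
  "fourier_multiplier m \<longleftrightarrow>
     (\<forall>\<phi>\<in>schwartz. \<exists>\<psi>\<in>schwartz. \<forall>\<xi> t. fourier_space \<psi> \<xi> t = m \<xi> * fourier_space \<phi> \<xi> t)"

lemma fourier_multiplier_const: "fourier_multiplier (\<lambda>_. c)"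
  unfolding fourier_multiplier_def using schwartz_scale fourier_space_scale by blast

lemma fourier_multiplier_add:
  assumes "fourier_multiplier m" "fourier_multiplier n"
  shows "fourier_multiplier (\<lambda>\<xi>. m \<xi> + n \<xi>)"
  unfolding fourier_multiplier_def
proof
  fix \<phi> :: "(real ^ 'a) \<times> real \<Rightarrow> complex" assume \<phi>: "\<phi> \<in> schwartz"
  obtain \<psi> \<theta> where "\<psi> \<in> schwartz" "\<And>\<xi> t. fourier_space \<psi> \<xi> t = m \<xi> * fourier_space \<phi> \<xi> t"
    and "\<theta> \<in> schwartz" "\<And>\<xi> t. fourier_space \<theta> \<xi> t = n \<xi> * fourier_space \<phi> \<xi> t"
    using assms \<phi> unfolding fourier_multiplier_def by blast
  then show "\<exists>\<psi>\<in>schwartz. \<forall>\<xi> t. fourier_space \<psi> \<xi> t = (m \<xi> + n \<xi>) * fourier_space \<phi> \<xi> t"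
    by (intro bexI[of _ "\<lambda>X. \<psi> X + \<theta> X"] schwartz_add) (auto simp: fourier_space_add distrib_right)
qed

lemma fourier_multiplier_mult:
  assumes "fourier_multiplier m" "fourier_multiplier n"
  shows "fourier_multiplier (\<lambda>\<xi>. m \<xi> * n \<xi>)"
  unfolding fourier_multiplier_def
proof
  fix \<phi> :: "(real ^ 'a) \<times> real \<Rightarrow> complex" assume \<phi>: "\<phi> \<in> schwartz"
  obtain \<psi> where \<psi>: "\<psi> \<in> schwartz" "\<And>\<xi> t. fourier_space \<psi> \<xi> t = n \<xi> * fourier_space \<phi> \<xi> t"
    using assms(2) \<phi> unfolding fourier_multiplier_def by blast
  obtain \<theta> where "\<theta> \<in> schwartz" "\<And>\<xi> t. fourier_space \<theta> \<xi> t = m \<xi> * fourier_space \<psi> \<xi> t"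
    using assms(1) \<psi>(1) unfolding fourier_multiplier_def by blast
  then show "\<exists>\<psi>\<in>schwartz. \<forall>\<xi> t. fourier_space \<psi> \<xi> t = m \<xi> * n \<xi> * fourier_space \<phi> \<xi> t"
    by (intro bexI[of _ \<theta>]) (auto simp: \<psi>(2))
qed

lemma fourier_multiplier_coordinate:
  assumes "i \<in> Basis"
  shows "fourier_multiplier (\<lambda>\<xi>. of_real (\<xi> \<bullet> i))"
  unfolding fourier_multiplier_def
proof
  fix \<phi> :: "(real ^ 'a) \<times> real \<Rightarrow> complex" assume \<phi>: "\<phi> \<in> schwartz"
  have b: "(i, 0) \<in> (Basis :: ((real ^ 'a) \<times> real) set)"
    using assms by (auto simp: Basis_prod_def)
  let ?c = "1 / (2 * complex_of_real pi * \<i>)"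
  show "\<exists>\<psi>\<in>schwartz. \<forall>\<xi> t. fourier_space \<psi> \<xi> t = complex_of_real (\<xi> \<bullet> i) * fourier_space \<phi> \<xi> t"
  proof (intro bexI allI)
    show "(\<lambda>X. ?c * partial_deriv (i, 0) \<phi> X) \<in> schwartz"
      by (rule schwartz_scale[OF schwartz_partial_deriv[OF \<phi> b]])
    show "fourier_space (\<lambda>X. ?c * partial_deriv (i, 0) \<phi> X) \<xi> t = complex_of_real (\<xi> \<bullet> i) * fourier_space \<phi> \<xi> t" for \<xi> t
      unfolding fourier_space_scale fourier_space_partial_deriv[OF \<phi> assms] by simp
  qed
qed

lemma fourier_multiplier_sum:
  assumes "finite S" "\<And>i. i \<in> S \<Longrightarrow> fourier_multiplier (m i)"
  shows "fourier_multiplier (\<lambda>\<xi>. \<Sum>i\<in>S. m i \<xi>)"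
  using assms by (induction S) (auto intro: fourier_multiplier_const fourier_multiplier_add)

lemma fourier_multiplier_prod:
  assumes "finite S" "\<And>i. i \<in> S \<Longrightarrow> fourier_multiplier (m i)"
  shows "fourier_multiplier (\<lambda>\<xi>. \<Prod>i\<in>S. m i \<xi>)"
  using assms by (induction S) (auto intro: fourier_multiplier_const fourier_multiplier_mult)

lemma fourier_multiplier_coordinate_sq:
  "i \<in> Basis \<Longrightarrow> fourier_multiplier (\<lambda>\<xi>. of_real ((\<xi> \<bullet> i)\<^sup>2))"
  using fourier_multiplier_mult[OF fourier_multiplier_coordinate[of i] fourier_multiplier_coordinate[of i]]
  by (simp add: power2_eq_square)

lemma fourier_multiplier_norm_sq: "fourier_multiplier (\<lambda>\<xi>. of_real ((norm \<xi>)\<^sup>2))"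
proof -
  have "(norm \<xi>)\<^sup>2 = (\<Sum>i\<in>Basis. (\<xi> \<bullet> i)\<^sup>2)" for \<xi> :: "real ^ 'a"
    by (subst power2_norm_eq_inner, subst euclidean_inner) (simp add: power2_eq_square)
  moreover have "fourier_multiplier (\<lambda>\<xi>. \<Sum>i\<in>(Basis :: (real ^ 'a) set). of_real ((\<xi> \<bullet> i)\<^sup>2))"
    by (intro fourier_multiplier_sum fourier_multiplier_coordinate_sq) auto
  ultimately show ?thesis by simp
qed

text \<open>The reciprocal of the weight is a Fourier multiplier, so that the bound without the weight, applied to
  another Schwartz function, gives the bound with it.\<close>

lemma fourier_space_decay:
  fixes \<phi> :: "(real ^ 'd) \<times> real \<Rightarrow> complex"
  assumes "\<phi> \<in> schwartz"
  obtains C where "0 \<le> C" "\<And>\<xi> t. cmod (fourier_space \<phi> \<xi> t) \<le> C * weight \<xi> / (1 + t\<^sup>2)"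
proof -
  have "fourier_multiplier (\<lambda>\<xi>. \<Prod>i\<in>(Basis :: (real ^ 'd) set). 1 + of_real ((\<xi> \<bullet> i)\<^sup>2))"
    by (intro fourier_multiplier_prod fourier_multiplier_add fourier_multiplier_const fourier_multiplier_coordinate_sq) auto
  then obtain \<psi> where \<psi>: "\<psi> \<in> schwartz"
    "\<And>\<xi> t. fourier_space \<psi> \<xi> t = (\<Prod>i\<in>Basis. 1 + of_real ((\<xi> \<bullet> i)\<^sup>2)) * fourier_space \<phi> \<xi> t"
    using assms unfolding fourier_multiplier_def by blast
  obtain C where C: "0 \<le> C" "\<And>\<xi> t. cmod (fourier_space \<psi> \<xi> t) \<le> C / (1 + t\<^sup>2)"
    using fourier_space_bound_time[OF \<psi>(1)] by blast
  have "cmod (fourier_space \<phi> \<xi> t) \<le> C * weight \<xi> / (1 + t\<^sup>2)" for \<xi> t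
  proof -
    have "(\<Prod>i\<in>Basis. 1 + complex_of_real ((\<xi> \<bullet> i)\<^sup>2)) = of_real (1 / weight \<xi>)"
      by (simp add: weight_def prod_dividef)
    then have "fourier_space \<psi> \<xi> t = of_real (1 / weight \<xi>) * fourier_space \<phi> \<xi> t"
      using \<psi>(2) by simp
    then have "cmod (fourier_space \<psi> \<xi> t) = 1 / weight \<xi> * cmod (fourier_space \<phi> \<xi> t)"
      using weight_pos[of \<xi>] by (simp add: norm_mult norm_divide)
    then have "cmod (fourier_space \<phi> \<xi> t) = weight \<xi> * cmod (fourier_space \<psi> \<xi> t)"
      using weight_pos[of \<xi>] by simp
    also have "\<dots> \<le> weight \<xi> * (C / (1 + t\<^sup>2))"
      using weight_pos[of \<xi>] by (intro mult_left_mono C) auto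
    finally show ?thesis by (simp add: mult.commute)
  qed
  then show ?thesis using that C(1) by blast
qed

text \<open>The history of one Fourier mode, composed with the free flow. It is defined for all real \<open>\<sigma>\<close> from a
  Schwartz function on the whole space-time, and is therefore smooth across \<open>\<sigma> = 0\<close>.\<close>

definition mode :: "((real ^ 'd) \<times> real \<Rightarrow> complex) \<Rightarrow> real ^ 'd \<Rightarrow> real \<Rightarrow> complex" where
  "mode \<phi> \<xi> \<sigma> = cis (- 4 * pi\<^sup>2 * \<sigma> * (norm \<xi>)\<^sup>2) * fourier_space \<phi> \<xi> (- \<sigma>)"

lemma mode_decay:
  fixes \<phi> :: "(real ^ 'd) \<times> real \<Rightarrow> complex"
  assumes "\<phi> \<in> schwartz"
  obtains C where "0 \<le> C" "\<And>\<xi> \<sigma>. cmod (mode \<phi> \<xi> \<sigma>) \<le> C * weight \<xi> / (1 + \<sigma>\<^sup>2)"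
proof -
  obtain C where "0 \<le> C" "\<And>\<xi> t. cmod (fourier_space \<phi> \<xi> t) \<le> C * weight \<xi> / (1 + t\<^sup>2)"
    using fourier_space_decay[OF assms] by blast
  from this(1) this(2)[of _ "- _"] show ?thesis
    using that by (auto simp: mode_def norm_mult)
qed

text \<open>The flow contributes the multiplier \<open>- 4 \<pi>\<^sup>2 \<i> |\<xi>|\<^sup>2\<close>, so the derivative of a mode is again a mode, with the
  same decay.\<close>

lemma mode_derivative:
  fixes \<phi> :: "(real ^ 'd) \<times> real \<Rightarrow> complex"
  assumes \<phi>: "\<phi> \<in> schwartz"
  obtains \<psi> where "\<psi> \<in> schwartz" "\<And>\<xi> \<sigma>. (mode \<phi> \<xi> has_vector_derivative mode \<psi> \<xi> \<sigma>) (at \<sigma>)"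
proof -
  have b: "(0, 1) \<in> (Basis :: ((real ^ 'd) \<times> real) set)"
    by (auto simp: Basis_prod_def)
  have dt: "partial_deriv (0, 1) \<phi> \<in> schwartz"
    by (rule schwartz_partial_deriv[OF \<phi> b])
  let ?c = "- 4 * (complex_of_real pi)\<^sup>2 * \<i>"
  have "fourier_multiplier (\<lambda>\<xi> :: real ^ 'd. ?c * of_real ((norm \<xi>)\<^sup>2))"
    by (intro fourier_multiplier_mult fourier_multiplier_const fourier_multiplier_norm_sq)
  then obtain \<theta> where \<theta>: "\<theta> \<in> schwartz"
    "\<And>\<xi> t. fourier_space \<theta> \<xi> t = ?c * of_real ((norm \<xi>)\<^sup>2) * fourier_space \<phi> \<xi> t"
    using \<phi> unfolding fourier_multiplier_def by blast
  define \<psi> where "\<psi> = (\<lambda>X. \<theta> X + (- 1) * partial_deriv (0, 1) \<phi> X)"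
  have \<psi>: "\<psi> \<in> schwartz"
    unfolding \<psi>_def by (intro schwartz_add \<theta> schwartz_scale dt)
  have F\<psi>: "fourier_space \<psi> \<xi> t = ?c * of_real ((norm \<xi>)\<^sup>2) * fourier_space \<phi> \<xi> t - fourier_space (partial_deriv (0, 1) \<phi>) \<xi> t" for \<xi> t
    unfolding \<psi>_def fourier_space_add[OF \<theta>(1) schwartz_scale[OF dt]] fourier_space_scale \<theta>(2) by simp
  have "(mode \<phi> \<xi> has_vector_derivative mode \<psi> \<xi> \<sigma>) (at \<sigma>)" for \<xi> \<sigma>
  proof -
    have 1: "((\<lambda>\<sigma>. cis (- 4 * pi\<^sup>2 * \<sigma> * (norm \<xi>)\<^sup>2)) has_vector_derivative
        ?c * of_real ((norm \<xi>)\<^sup>2) * cis (- 4 * pi\<^sup>2 * \<sigma> * (norm \<xi>)\<^sup>2)) (at \<sigma>)"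
    proof (rule has_vector_derivative_eq_rhs[OF has_vector_derivative_cis])
      show "((\<lambda>\<sigma>. - 4 * pi\<^sup>2 * \<sigma> * (norm \<xi>)\<^sup>2) has_real_derivative - 4 * pi\<^sup>2 * (norm \<xi>)\<^sup>2) (at \<sigma>)"
        by (auto intro!: derivative_eq_intros)
    qed (simp add: scaleR_conv_of_real)
    have "((\<lambda>\<sigma>. - \<sigma>) has_vector_derivative - 1) (at \<sigma>)"
      by (auto intro!: derivative_eq_intros)
    from vector_diff_chain_at[OF this fourier_space_time_derivative[OF \<phi>, of \<xi> "- \<sigma>"]]
    have 2: "((\<lambda>\<sigma>. fourier_space \<phi> \<xi> (- \<sigma>)) has_vector_derivative - fourier_space (partial_deriv (0, 1) \<phi>) \<xi> (- \<sigma>)) (at \<sigma>)"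
      by (simp add: o_def del: iterated_deriv.simps)
    show ?thesis
      unfolding mode_def[abs_def]
      by (rule has_vector_derivative_eq_rhs[OF has_vector_derivative_mult[OF 1 2]])
        (simp add: F\<psi> algebra_simps del: iterated_deriv.simps)
  qed
  then show ?thesis using that \<psi> by blast
qed

lemma continuous_mode_frequency: "\<phi> \<in> schwartz \<Longrightarrow> continuous_on UNIV (\<lambda>\<xi>. mode \<phi> \<xi> \<sigma>)"
  unfolding mode_def by (intro continuous_intros continuous_fourier_space)

lemma continuous_mode_time: "\<phi> \<in> schwartz \<Longrightarrow> continuous_on UNIV (mode \<phi> \<xi>)"
  by (rule mode_derivative) (auto intro!: continuous_at_imp_continuous_on has_vector_derivative_continuous)

lemma borel_measurable_mode:
  assumes "\<phi> \<in> schwartz"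
  shows "(\<lambda>(\<xi>, \<sigma>). mode \<phi> \<xi> \<sigma>) \<in> borel_measurable (borel \<Otimes>\<^sub>M borel)"
proof -
  note [measurable] = borel_measurable_fourier_space[OF assms]
  show ?thesis unfolding mode_def by measurable
qed

section \<open>Two oscillatory transforms on the half-line\<close>

subsection \<open>Powers and domination\<close>

text \<open>Off the cut the logarithm is continuous; on the cut it is given by a formula in the modulus.\<close>

lemma borel_measurable_Ln: "(Ln :: complex \<Rightarrow> complex) \<in> borel_measurable borel"
proof -
  have cl: "\<real>\<^sub>\<le>\<^sub>0 \<in> sets (borel :: complex measure)"
    by (rule borel_closed[OF closed_nonpos_Reals_complex])
  then have 1: "(\<lambda>z. if z \<in> - \<real>\<^sub>\<le>\<^sub>0 then Ln z else (0 :: complex)) \<in> borel_measurable borel" (is "?f \<in> _")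
    by (intro borel_measurable_continuous_on_if continuous_intros) auto
  have 2: "(\<lambda>z. if z \<in> \<real>\<^sub>\<le>\<^sub>0 then if z = 0 then Ln 0 else of_real (ln (cmod z)) + of_real pi * \<i> else (0 :: complex)) \<in> borel_measurable borel" (is "?g \<in> _")
    using cl by measurable
  have "Ln z = ?f z + ?g z" for z :: complex
    by (auto elim!: nonpos_Reals_cases simp: Ln_of_real')
  then have eq: "(Ln :: complex \<Rightarrow> complex) = (\<lambda>z. ?f z + ?g z)" by (rule ext)
  show ?thesis
    using borel_measurable_add[OF 1 2] unfolding eq[symmetric] .
qed

lemma borel_measurable_cpowr [measurable (raw)]:
  fixes f :: "'a \<Rightarrow> complex"
  assumes [measurable]: "f \<in> borel_measurable M"
  shows "(\<lambda>x. f x powr c) \<in> borel_measurable M"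
proof -
  note [measurable] = measurable_compose[OF _ borel_measurable_Ln]
  show ?thesis unfolding powr_def by measurable
qed

lemma set_integral_dominated:
  fixes f :: "real \<Rightarrow> complex" and w :: "real \<Rightarrow> real"
  assumes "(\<lambda>x. indicator S x *\<^sub>R f x) \<in> borel_measurable borel"
    and w: "set_integrable lborel S w"
    and bound: "AE x in lborel. x \<in> S \<longrightarrow> norm (f x) \<le> w x"
  shows "set_integrable lborel S f" "norm (LINT x:S|lborel. f x) \<le> (LINT x:S|lborel. w x)"
proof -
  have b: "AE x in lborel. norm (indicator S x *\<^sub>R f x) \<le> indicator S x *\<^sub>R w x"
    using bound by eventually_elim (auto simp: indicator_def)
  have i: "integrable lborel (\<lambda>x. indicator S x *\<^sub>R f x)"
    by (rule Bochner_Integration.integrable_bound[OF w[unfolded set_integrable_def]])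
      (use assms(1) b in \<open>auto elim!: eventually_mono\<close>)
  then show "set_integrable lborel S f" by (simp add: set_integrable_def)
  show "norm (LINT x:S|lborel. f x) \<le> (LINT x:S|lborel. w x)"
    unfolding set_lebesgue_integral_def
    by (rule order_trans[OF integral_norm_bound integral_mono_AE])
      (use integrable_norm[OF i] w b in \<open>auto simp: set_integrable_def\<close>)
qed

lemma power_integral_near_0:
  fixes p a :: real
  assumes "p < 1" "0 < a"
  shows "set_integrable lborel {0<..<a} (\<lambda>x. x powr (- p))"
    "(LINT x:{0<..<a}|lborel. x powr (- p)) = a powr (1 - p) / (1 - p)"
proof -
  have eq: "einterval 0 (ereal a) = {0<..<a}" by (auto simp: einterval_def zero_ereal_def)
  have d: "DERIV (\<lambda>x. x powr (1 - p) / (1 - p)) x :> x powr (- p)" if "0 < x" for x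
    using that assms by (auto intro!: derivative_eq_intros)
  have c: "isCont (\<lambda>x. x powr (- p)) x" if "0 < x" for x
    using that by (auto intro!: continuous_intros)
  have lim0: "((\<lambda>x. x powr (1 - p) / (1 - p)) \<longlongrightarrow> 0) (at_right 0)"
    using assms by real_asymp
  have lima: "((\<lambda>x. x powr (1 - p) / (1 - p)) \<longlongrightarrow> a powr (1 - p) / (1 - p)) (at_left a)"
    using assms by (intro tendsto_intros) auto
  show "set_integrable lborel {0<..<a} (\<lambda>x. x powr (- p))"
    using assms d c lim0 lima
    by (intro interval_integral_FTC_nonneg(1)[where F = "\<lambda>x. x powr (1 - p) / (1 - p)" and a = 0 and b = "ereal a", unfolded eq])
      (auto simp: zero_ereal_def ereal_tendsto_simps1)
  have "(LBINT x=0..ereal a. x powr (- p)) = a powr (1 - p) / (1 - p) - 0"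
    using assms d c lim0 lima
    by (intro interval_integral_FTC_nonneg(2)[where F = "\<lambda>x. x powr (1 - p) / (1 - p)"])
      (auto simp: zero_ereal_def ereal_tendsto_simps1)
  then show "(LINT x:{0<..<a}|lborel. x powr (- p)) = a powr (1 - p) / (1 - p)"
    using assms by (simp add: interval_lebesgue_integral_def eq)
qed

lemma power_integral_at_top:
  fixes q a :: real
  assumes "0 < q" "0 < a"
  shows "set_integrable lborel {a<..} (\<lambda>x. x powr (- 1 - q))"
    "(LINT x:{a<..}|lborel. x powr (- 1 - q)) = a powr (- q) / q"
proof -
  have eq: "einterval (ereal a) \<infinity> = {a<..}" by (auto simp: einterval_def)
  have d: "DERIV (\<lambda>x. - (x powr (- q) / q)) x :> x powr (- 1 - q)" if "a < x" for x
  proof -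
    have "DERIV (\<lambda>x. - (x powr (- q) / q)) x :> x powr (- q - 1)"
      using that assms by (auto intro!: derivative_eq_intros)
    then show ?thesis by (simp add: minus_diff_commute)
  qed
  have c: "isCont (\<lambda>x. x powr (- 1 - q)) x" if "a < x" for x
    using that assms by (auto intro!: continuous_intros)
  have limt: "((\<lambda>x. - (x powr (- q) / q)) \<longlongrightarrow> 0) at_top"
    using assms by real_asymp
  have lima: "((\<lambda>x. - (x powr (- q) / q)) \<longlongrightarrow> - (a powr (- q) / q)) (at_right a)"
    using assms by (intro tendsto_intros) auto
  show "set_integrable lborel {a<..} (\<lambda>x. x powr (- 1 - q))"
    using assms d c limt lima
    by (intro interval_integral_FTC_nonneg(1)[where F = "\<lambda>x. - (x powr (- q) / q)" and a = "ereal a" and b = \<infinity>, unfolded eq])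
      (auto simp: ereal_tendsto_simps1)
  have "(LBINT x=ereal a..\<infinity>. x powr (- 1 - q)) = 0 - - (a powr (- q) / q)"
    using assms d c limt lima
    by (intro interval_integral_FTC_nonneg(2)[where F = "\<lambda>x. - (x powr (- q) / q)"])
      (auto simp: ereal_tendsto_simps1)
  then show "(LINT x:{a<..}|lborel. x powr (- 1 - q)) = a powr (- q) / q"
    by (simp add: interval_lebesgue_integral_def eq)
qed

text \<open>The model of a majorant with different powers at \<open>0\<close> and at \<open>\<infinity>\<close>. Its value \<open>0\<close> at the point \<open>1\<close> is the reason
  why domination by it is stated almost everywhere.\<close>

definition power_hat :: "real \<Rightarrow> real \<Rightarrow> real \<Rightarrow> real" where
  "power_hat p q x = indicator {0<..<1} x *\<^sub>R x powr (- p) + indicator {1<..} x *\<^sub>R x powr (- 1 - q)"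

lemma borel_measurable_power_hat [measurable]: "power_hat p q \<in> borel_measurable borel"
  unfolding power_hat_def[abs_def] by measurable

lemma power_hat_nonneg: "0 \<le> power_hat p q x"
  by (simp add: power_hat_def)

lemma
  assumes "p < 1" "0 < q"
  shows integrable_power_hat: "integrable lborel (power_hat p q)"
    and integral_power_hat: "(\<integral>x. power_hat p q x \<partial>lborel) = 1 / (1 - p) + 1 / q"
proof -
  note 1 = power_integral_near_0[OF assms(1), of 1] and 2 = power_integral_at_top[OF assms(2), of 1]
  show "integrable lborel (power_hat p q)"
    unfolding power_hat_def[abs_def] using 1 2 by (simp add: set_integrable_def)
  show "(\<integral>x. power_hat p q x \<partial>lborel) = 1 / (1 - p) + 1 / q"
    unfolding power_hat_def[abs_def] using 1 2 by (simp add: set_integrable_def set_lebesgue_integral_def)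
qed

lemma le_power_hat_AE:
  assumes "\<And>x. 0 < x \<Longrightarrow> x < 1 \<Longrightarrow> f x \<le> C * x powr (- p)" "\<And>x. 1 < x \<Longrightarrow> f x \<le> C * x powr (- 1 - q)"
  shows "AE x in lborel. x \<in> {0<..} \<longrightarrow> f x \<le> C * power_hat p q x"
  using AE_lborel_singleton[of 1]
  by eventually_elim (use assms in \<open>auto simp: power_hat_def indicator_def not_less\<close>)

text \<open>An integrable majorant of \<open>|y|\<^sup>-\<^sup>s - 1\<close>.\<close>

definition riesz_majorant :: "real \<Rightarrow> real \<Rightarrow> real" where
  "riesz_majorant s y = power_hat s 1 y + power_hat s 1 (- y)"

lemma riesz_majorant_nonneg: "0 \<le> riesz_majorant s y"
  by (simp add: riesz_majorant_def power_hat_nonneg)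

lemma integrable_riesz_majorant:
  assumes "s < 1"
  shows "integrable lborel (riesz_majorant s)"
proof -
  have "integrable lborel (\<lambda>y. power_hat s 1 (0 + (- 1) * y))"
    using integrable_power_hat[of s 1] assms by (intro lborel_integrable_real_affine) auto
  then show ?thesis
    unfolding riesz_majorant_def[abs_def] using integrable_power_hat[of s 1] assms by simp
qed

lemma abs_powr_le_riesz_majorant:
  assumes "0 < s"
  shows "\<bar>y\<bar> powr (- s) \<le> 1 + riesz_majorant s y"
proof (cases "\<bar>y\<bar> < 1 \<and> y \<noteq> 0")
  case True
  then show ?thesis
    using power_hat_nonneg[of s 1 y] power_hat_nonneg[of s 1 "- y"]
    by (cases "0 < y") (auto simp: riesz_majorant_def power_hat_def indicator_def)
next
  case False
  then have "\<bar>y\<bar> powr (- s) \<le> 1"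
  proof (cases "y = 0")
    case False
    with \<open>\<not> (\<bar>y\<bar> < 1 \<and> y \<noteq> 0)\<close> have "1 \<le> \<bar>y\<bar>" by auto
    then show ?thesis
      using assms powr_mono2'[of "- s" 1 "\<bar>y\<bar>"] by simp
  qed simp
  then show ?thesis using riesz_majorant_nonneg[of s y] by linarith
qed

lemma integrable_riesz_majorant_shift:
  assumes "s < 1"
  shows "integrable lborel (\<lambda>y. riesz_majorant s (y - c))" "integrable lborel (\<lambda>y. riesz_majorant s (c - y))"
    "(\<integral>y. riesz_majorant s (y - c) \<partial>lborel) = (\<integral>y. riesz_majorant s y \<partial>lborel)"
proof -
  show "integrable lborel (\<lambda>y. riesz_majorant s (y - c))"
    using integrable_translate[OF integrable_riesz_majorant[OF assms], of "- c"] by simp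
  show "integrable lborel (\<lambda>y. riesz_majorant s (c - y))"
    using lborel_integrable_real_affine[OF integrable_riesz_majorant[OF assms], of "- 1" c] by simp
  show "(\<integral>y. riesz_majorant s (y - c) \<partial>lborel) = (\<integral>y. riesz_majorant s y \<partial>lborel)"
    using integral_translate[of "riesz_majorant s" "- c"] borel_measurable_integrable[OF integrable_riesz_majorant[OF assms]]
    by simp
qed

lemma power_times_cauchy_le:
  fixes x :: real
  assumes "0 < x" "0 < s" "s < 1"
  shows "x powr (1 - s) / (1 + x\<^sup>2) \<le> 1"
proof -
  have "x powr (1 - s) \<le> 1 + x\<^sup>2"
  proof (cases "x \<le> 1")
    case True
    then have "x powr (1 - s) \<le> 1 powr (1 - s)" using assms by (intro powr_mono2) auto
    then show ?thesis using zero_le_power2[of x] unfolding powr_one_eq_one by linarith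
  next
    case False
    then have "x powr (1 - s) \<le> x powr 2" using assms by (intro powr_mono) auto
    then show ?thesis using assms by simp
  qed
  then show ?thesis by (simp add: divide_le_eq_1 add_pos_nonneg)
qed

subsection \<open>The common quadratic form\<close>

text \<open>The profile \<open>g\<close> is the history of one Fourier mode, as a function on the whole line. The transforms
  below see its restriction to \<open>\<sigma> > 0\<close>, which in general jumps at \<open>0\<close>; the jump is the source of the
  boundary terms.\<close>

locale mode_profile =
  fixes s :: real and g g' :: "real \<Rightarrow> complex" and A :: real
  assumes s: "0 < s" "s < 1"
    and deriv: "\<And>\<sigma>. (g has_vector_derivative g' \<sigma>) (at \<sigma>)"
    and cont': "continuous_on UNIV g'"
    and bound: "\<And>\<sigma>. cmod (g \<sigma>) \<le> A / (1 + \<sigma>\<^sup>2)" "\<And>\<sigma>. cmod (g' \<sigma>) \<le> A / (1 + \<sigma>\<^sup>2)"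
begin

lemma A_nonneg: "0 \<le> A"
  using order_trans[OF norm_ge_zero bound(1)[of 0]] by simp

lemma bound_A: "cmod (g \<sigma>) \<le> A"
proof -
  have "A / (1 + \<sigma>\<^sup>2) \<le> A / 1"
    using A_nonneg by (intro divide_left_mono) (auto simp: add_pos_nonneg)
  with bound(1)[of \<sigma>] show ?thesis by simp
qed

lemma continuous_g: "continuous_on UNIV g"
  by (auto intro!: continuous_at_imp_continuous_on has_vector_derivative_continuous deriv)

lemma g_measurable [measurable]: "g \<in> borel_measurable borel" "g' \<in> borel_measurable borel"
  by (auto intro!: borel_measurable_continuous_onI continuous_g cont')

definition K :: real where "K = (\<integral>x. 1 / (1 + x\<^sup>2) \<partial>(lborel :: real measure))"

lemma K_nonneg: "0 \<le> K"
  unfolding K_def by (intro Bochner_Integration.integral_nonneg) auto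

lemma integrable_A_cauchy: "integrable lborel (\<lambda>\<sigma>. A / (1 + \<sigma>\<^sup>2))"
  using integrable_mult_right[OF integrable_inverse_1_plus_sq, of A] by simp

lemma g_integrable: "integrable lborel g" "integrable lborel g'"
proof -
  have b: "AE \<sigma> in lborel. norm (g \<sigma>) \<le> norm (A / (1 + \<sigma>\<^sup>2))" "AE \<sigma> in lborel. norm (g' \<sigma>) \<le> norm (A / (1 + \<sigma>\<^sup>2))"
    using bound A_nonneg by simp_all
  show "integrable lborel g" "integrable lborel g'"
    by (rule Bochner_Integration.integrable_bound[OF integrable_A_cauchy _ b(1)], measurable)
      (rule Bochner_Integration.integrable_bound[OF integrable_A_cauchy _ b(2)], measurable)
qed

lemma set_integrable_bounded_factor:
  fixes f h :: "real \<Rightarrow> complex"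
  assumes h: "integrable lborel h" and [measurable]: "f \<in> borel_measurable borel" "S \<in> sets borel"
    and b: "\<And>\<sigma>. \<sigma> \<in> S \<Longrightarrow> cmod (f \<sigma>) \<le> C"
  shows "set_integrable lborel S (\<lambda>\<sigma>. h \<sigma> * f \<sigma>)"
proof (rule set_integral_dominated(1))
  have [measurable]: "h \<in> borel_measurable borel" using borel_measurable_integrable[OF h] by simp
  show "(\<lambda>\<sigma>. indicator S \<sigma> *\<^sub>R (h \<sigma> * f \<sigma>)) \<in> borel_measurable borel" by measurable
  show "set_integrable lborel S (\<lambda>\<sigma>. C * norm (h \<sigma>))"
    unfolding set_integrable_def using integrable_mult_indicator[of S lborel "\<lambda>\<sigma>. C * norm (h \<sigma>)"] h by simp
  show "AE \<sigma> in lborel. \<sigma> \<in> S \<longrightarrow> norm (h \<sigma> * f \<sigma>) \<le> C * norm (h \<sigma>)"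
    using b by (auto simp: norm_mult mult.commute[of "cmod (h _)"] intro!: mult_right_mono)
qed

text \<open>Along the affine path \<open>c \<sigma> = \<alpha> + \<beta> \<sigma>\<close> the kernel \<open>c\<^sup>-\<^sup>1\<^sup>-\<^sup>s\<close> is a derivative; integrating by parts trades
  it for the kernel \<open>c\<^sup>-\<^sup>s\<close>, which stays integrable when \<open>c\<close> approaches the imaginary axis.\<close>

lemma kernel_by_parts:
  fixes \<alpha> \<beta> :: complex and e k :: real
  assumes k: "0 < k" "\<And>\<sigma>. e \<le> \<sigma> \<Longrightarrow> k \<le> Re (\<alpha> + \<beta> * of_real \<sigma>)" and \<beta>: "\<beta> \<noteq> 0"
  shows "(LINT \<sigma>:{e<..}|lborel. g \<sigma> * (\<alpha> + \<beta> * of_real \<sigma>) powr (- 1 - of_real s)) =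
    (g e * (\<alpha> + \<beta> * of_real e) powr (- of_real s) +
      (LINT \<sigma>:{e<..}|lborel. g' \<sigma> * (\<alpha> + \<beta> * of_real \<sigma>) powr (- of_real s))) / (of_real s * \<beta>)"
proof -
  let ?c = "\<lambda>\<sigma>. \<alpha> + \<beta> * complex_of_real \<sigma>"
  have nn: "?c \<sigma> \<notin> \<real>\<^sub>\<le>\<^sub>0" if "e \<le> \<sigma>" for \<sigma>
    using k(1) k(2)[OF that] by (auto simp: complex_nonpos_Reals_iff)
  have ic: "isCont (\<lambda>\<sigma>. ?c \<sigma> powr q) \<sigma>" if "e \<le> \<sigma>" for \<sigma> q
    by (intro isCont_powr_complex nn that) (auto intro!: continuous_intros)
  then have cp: "continuous_on {e<..} (\<lambda>\<sigma>. ?c \<sigma> powr q)" for q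
    by (auto intro!: continuous_at_imp_continuous_on)
  have b: "cmod (?c \<sigma> powr (- of_real q)) \<le> k powr (- q)" if "e \<le> \<sigma>" "0 < q" for \<sigma> q
  proof -
    have "cmod (?c \<sigma> powr (- of_real q)) = cmod (?c \<sigma>) powr (- q)"
      using norm_powr_real_powr'[of "- of_real q" "?c \<sigma>"] by simp
    also have "\<dots> \<le> k powr (- q)"
      using k(1) k(2)[OF that(1)] abs_Re_le_cmod[of "?c \<sigma>"] that(2) by (intro powr_mono2') auto
    finally show ?thesis .
  qed
  have i1: "set_integrable lborel {e<..} (\<lambda>\<sigma>. g \<sigma> * ?c \<sigma> powr (- 1 - of_real s))"
  proof (rule set_integrable_bounded_factor[OF g_integrable(1)])
    show "cmod (?c \<sigma> powr (- 1 - of_real s)) \<le> k powr (- (1 + s))" if "\<sigma> \<in> {e<..}" for \<sigma>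
      using b[of \<sigma> "1 + s"] that s by simp
  qed measurable
  have i2: "set_integrable lborel {e<..} (\<lambda>\<sigma>. g' \<sigma> * ?c \<sigma> powr (- of_real s))"
  proof (rule set_integrable_bounded_factor[OF g_integrable(2)])
    show "cmod (?c \<sigma> powr (- of_real s)) \<le> k powr (- s)" if "\<sigma> \<in> {e<..}" for \<sigma>
      using b[of \<sigma> s] that s by simp
  qed measurable
  have "(LINT \<sigma>:{e<..}|lborel. g' \<sigma> * ?c \<sigma> powr (- of_real s) - of_real s * \<beta> * (g \<sigma> * ?c \<sigma> powr (- 1 - of_real s))) =
      0 - g e * ?c e powr (- of_real s)"
  proof (rule integral_derivative_atLeast[where F = "\<lambda>\<sigma>. g \<sigma> * ?c \<sigma> powr (- of_real s)"])
    fix \<sigma> assume \<sigma>: "e < \<sigma>"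
    have "((\<lambda>z. (\<alpha> + \<beta> * z) powr (- of_real s)) has_field_derivative
        (- of_real s) * ?c \<sigma> powr (- of_real s - 1) * \<beta>) (at (of_real \<sigma>))"
      using nn[of \<sigma>] \<sigma> by (auto intro!: derivative_eq_intros)
    then have 1: "((\<lambda>\<sigma>. ?c \<sigma> powr (- of_real s)) has_vector_derivative
        (- of_real s) * ?c \<sigma> powr (- of_real s - 1) * \<beta>) (at \<sigma>)"
      by (rule has_vector_derivative_real_field)
    have e: "- complex_of_real s - 1 = - 1 - of_real s" by simp
    show "((\<lambda>\<sigma>. g \<sigma> * ?c \<sigma> powr (- of_real s)) has_vector_derivative
       g' \<sigma> * ?c \<sigma> powr (- of_real s) - of_real s * \<beta> * (g \<sigma> * ?c \<sigma> powr (- 1 - of_real s))) (at \<sigma>)"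
      by (intro has_vector_derivative_eq_rhs[OF has_vector_derivative_mult[OF deriv 1[unfolded e]]]) (simp add: algebra_simps)
  next
    show "continuous_on {e<..} (\<lambda>\<sigma>. g' \<sigma> * ?c \<sigma> powr (- of_real s) - of_real s * \<beta> * (g \<sigma> * ?c \<sigma> powr (- 1 - of_real s)))"
      by (intro continuous_on_diff continuous_on_mult continuous_on_const cp less_imp_le
          continuous_on_subset[OF continuous_g] continuous_on_subset[OF cont']) auto
    show "set_integrable lborel {e<..} (\<lambda>\<sigma>. g' \<sigma> * ?c \<sigma> powr (- of_real s) - of_real s * \<beta> * (g \<sigma> * ?c \<sigma> powr (- 1 - of_real s)))"
      by (intro set_integral_diff set_integrable_mult_right i1 i2)
    have "isCont (\<lambda>\<sigma>. g \<sigma> * ?c \<sigma> powr (- of_real s)) e"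
      using continuous_g by (intro continuous_mult ic) (auto simp: continuous_on_eq_continuous_at)
    then show "((\<lambda>\<sigma>. g \<sigma> * ?c \<sigma> powr (- of_real s)) \<longlongrightarrow> g e * ?c e powr (- of_real s)) (at_right e)"
      by (simp add: continuous_within filterlim_at_split)
    show "((\<lambda>\<sigma>. g \<sigma> * ?c \<sigma> powr (- of_real s)) \<longlongrightarrow> 0) at_top"
    proof (rule Lim_null_comparison)
      show "\<forall>\<^sub>F \<sigma> in at_top. norm (g \<sigma> * ?c \<sigma> powr (- of_real s)) \<le> A / (1 + \<sigma>\<^sup>2) * k powr (- s)"
        using eventually_ge_at_top[of e]
      proof eventually_elim
        case (elim \<sigma>)
        then show ?case
          unfolding norm_mult using bound(1)[of \<sigma>] A_nonneg b[of \<sigma> s] s by (intro mult_mono) auto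
      qed
      show "((\<lambda>\<sigma>. A / (1 + \<sigma>\<^sup>2) * k powr (- s)) \<longlongrightarrow> 0) at_top"
        by real_asymp
    qed
  qed
  then have "of_real s * \<beta> * (LINT \<sigma>:{e<..}|lborel. g \<sigma> * ?c \<sigma> powr (- 1 - of_real s)) =
      g e * ?c e powr (- of_real s) + (LINT \<sigma>:{e<..}|lborel. g' \<sigma> * ?c \<sigma> powr (- of_real s))"
    unfolding set_integral_diff(2)[OF i2 set_integrable_mult_right[OF i1]] set_integral_mult_right
    by (simp add: diff_eq_eq)
  then show ?thesis
    using \<beta> s by (simp add: field_simps)
qed

text \<open>The distribution \<open>(\<i> (\<sigma> - \<sigma>'))\<^sup>-\<^sup>1\<^sup>-\<^sup>s\<close> applied to \<open>g\<close> on \<open>\<sigma> > e\<close>, written in the form in which it converges,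
  after integration by parts.\<close>

definition limit_kernel :: "real \<Rightarrow> real \<Rightarrow> complex" where
  "limit_kernel e \<sigma>' = (g e * (\<i> * of_real (e - \<sigma>')) powr (- of_real s) +
      (LINT \<sigma>:{e<..}|lborel. g' \<sigma> * (\<i> * of_real (\<sigma> - \<sigma>')) powr (- of_real s))) / (of_real s * \<i>)"

lemma norm_kernel_le:
  fixes c :: complex
  assumes "\<bar>Im c\<bar> = \<bar>y\<bar>" "y \<noteq> 0"
  shows "cmod (c powr (- of_real s)) \<le> 1 + riesz_majorant s y"
proof -
  have "cmod (c powr (- of_real s)) = cmod c powr (- s)"
    using norm_powr_real_powr'[of "- of_real s" c] by simp
  also have "\<dots> \<le> \<bar>y\<bar> powr (- s)"
    using assms abs_Im_le_cmod[of c] s by (intro powr_mono2') auto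
  also have "\<dots> \<le> 1 + riesz_majorant s y"
    by (rule abs_powr_le_riesz_majorant[OF s(1)])
  finally show ?thesis .
qed

lemma integrable_derivative_majorant:
  "integrable lborel (\<lambda>\<sigma>. A / (1 + \<sigma>\<^sup>2) + A * riesz_majorant s (\<sigma> - \<sigma>'))"
  by (intro Bochner_Integration.integrable_add integrable_A_cauchy integrable_mult_right integrable_riesz_majorant_shift s)

lemma derivative_term_le:
  assumes "\<bar>Im c\<bar> = \<bar>\<sigma> - \<sigma>'\<bar>" "\<sigma> \<noteq> \<sigma>'"
  shows "cmod (g' \<sigma> * c powr (- of_real s)) \<le> A / (1 + \<sigma>\<^sup>2) + A * riesz_majorant s (\<sigma> - \<sigma>')"
proof -
  have "cmod (g' \<sigma> * c powr (- of_real s)) \<le> A / (1 + \<sigma>\<^sup>2) * (1 + riesz_majorant s (\<sigma> - \<sigma>'))"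
    unfolding norm_mult using bound(2)[of \<sigma>] norm_kernel_le[OF assms(1)] assms(2) A_nonneg by (intro mult_mono) auto
  also have "\<dots> \<le> A / (1 + \<sigma>\<^sup>2) + A * riesz_majorant s (\<sigma> - \<sigma>')"
  proof -
    have "A / (1 + \<sigma>\<^sup>2) \<le> A / 1"
      using A_nonneg by (intro divide_left_mono) (auto simp: add_pos_nonneg)
    then show ?thesis
      using riesz_majorant_nonneg[of s "\<sigma> - \<sigma>'"] mult_right_mono[of "A / (1 + \<sigma>\<^sup>2)" A "riesz_majorant s (\<sigma> - \<sigma>')"]
      by (simp add: distrib_left)
  qed
  finally show ?thesis .
qed

text \<open>On the path the imaginary part is \<open>\<sigma> - \<sigma>'\<close> for every \<open>n\<close>, so that \<open>|\<sigma> - \<sigma>'|\<^sup>-\<^sup>s\<close> dominates all kernels at once.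
  The boundary term restricts the statement to \<open>\<sigma>' \<noteq> e\<close>.\<close>

lemma kernel_limit:
  fixes \<alpha> \<beta> :: "nat \<Rightarrow> complex" and k :: "nat \<Rightarrow> real"
  assumes k: "\<And>n. 0 < k n" "\<And>n \<sigma>. e \<le> \<sigma> \<Longrightarrow> k n \<le> Re (\<alpha> n + \<beta> n * of_real \<sigma>)"
    and im: "\<And>n \<sigma>. Im (\<alpha> n + \<beta> n * of_real \<sigma>) = \<sigma> - \<sigma>'" and \<beta>1: "\<And>n. Im (\<beta> n) = 1"
    and lim: "\<alpha> \<longlonglongrightarrow> - \<i> * of_real \<sigma>'" "\<beta> \<longlonglongrightarrow> \<i>" and \<sigma>': "\<sigma>' \<noteq> e"
  defines "I \<equiv> \<lambda>n. LINT \<sigma>:{e<..}|lborel. g \<sigma> * (\<alpha> n + \<beta> n * of_real \<sigma>) powr (- 1 - of_real s)"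
  shows "I \<longlonglongrightarrow> limit_kernel e \<sigma>'"
    and "cmod (I n) \<le> (A * (1 + riesz_majorant s (e - \<sigma>')) + A * K + A * (\<integral>y. riesz_majorant s y \<partial>lborel)) / s"
proof -
  let ?c = "\<lambda>n \<sigma>. \<alpha> n + \<beta> n * complex_of_real \<sigma>"
  have \<beta>0: "\<beta> n \<noteq> 0" for n using \<beta>1[of n] by auto
  have \<beta>n: "1 \<le> cmod (\<beta> n)" for n using abs_Im_le_cmod[of "\<beta> n"] \<beta>1[of n] by simp
  define D where "D n = (LINT \<sigma>:{e<..}|lborel. g' \<sigma> * ?c n \<sigma> powr (- of_real s))" for n
  have I: "I n = (g e * ?c n e powr (- of_real s) + D n) / (of_real s * \<beta> n)" for n
    unfolding I_def D_def by (rule kernel_by_parts[OF k(1) k(2) \<beta>0])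
  have clim: "(\<lambda>n. ?c n \<sigma> powr (- of_real s)) \<longlonglongrightarrow> (\<i> * of_real (\<sigma> - \<sigma>')) powr (- of_real s)" if "\<sigma> \<noteq> \<sigma>'" for \<sigma>
  proof (rule tendsto_powr_complex)
    have "(\<lambda>n. ?c n \<sigma>) \<longlonglongrightarrow> - \<i> * of_real \<sigma>' + \<i> * of_real \<sigma>"
      by (intro tendsto_intros lim)
    then show "(\<lambda>n. ?c n \<sigma>) \<longlonglongrightarrow> \<i> * of_real (\<sigma> - \<sigma>')" by (simp add: algebra_simps)
  qed (use that in \<open>auto simp: complex_nonpos_Reals_iff\<close>)
  have im': "\<bar>Im (?c n \<sigma>)\<bar> = \<bar>\<sigma> - \<sigma>'\<bar>" for n \<sigma> using im by simp
  have "D \<longlonglongrightarrow> (LINT \<sigma>:{e<..}|lborel. g' \<sigma> * (\<i> * of_real (\<sigma> - \<sigma>')) powr (- of_real s))"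
    unfolding D_def set_lebesgue_integral_def
  proof (rule integral_dominated_convergence[OF _ _ integrable_derivative_majorant[of \<sigma>']])
    show "AE \<sigma> in lborel. (\<lambda>n. indicator {e<..} \<sigma> *\<^sub>R (g' \<sigma> * ?c n \<sigma> powr (- of_real s))) \<longlonglongrightarrow>
        indicator {e<..} \<sigma> *\<^sub>R (g' \<sigma> * (\<i> * of_real (\<sigma> - \<sigma>')) powr (- of_real s))"
      using AE_lborel_singleton[of \<sigma>'] by eventually_elim (intro tendsto_intros clim)
    show "AE \<sigma> in lborel. norm (indicator {e<..} \<sigma> *\<^sub>R (g' \<sigma> * ?c n \<sigma> powr (- of_real s))) \<le>
        A / (1 + \<sigma>\<^sup>2) + A * riesz_majorant s (\<sigma> - \<sigma>')" for n
      using AE_lborel_singleton[of \<sigma>']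
    proof eventually_elim
      case (elim \<sigma>)
      then show ?case
        using derivative_term_le[OF im'[of n \<sigma>]] A_nonneg riesz_majorant_nonneg[of s "\<sigma> - \<sigma>'"]
        by (auto simp: indicator_def)
    qed
  qed measurable
  then show "I \<longlonglongrightarrow> limit_kernel e \<sigma>'"
    unfolding I[abs_def] limit_kernel_def using s \<sigma>' by (intro tendsto_intros clim lim) auto
  have "cmod (D n) \<le> (LINT \<sigma>:{e<..}|lborel. A / (1 + \<sigma>\<^sup>2) + A * riesz_majorant s (\<sigma> - \<sigma>'))"
    unfolding D_def
  proof (rule set_integral_dominated(2))
    show "set_integrable lborel {e<..} (\<lambda>\<sigma>. A / (1 + \<sigma>\<^sup>2) + A * riesz_majorant s (\<sigma> - \<sigma>'))"
      unfolding set_integrable_def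
      using integrable_mult_indicator[OF _ integrable_derivative_majorant[of \<sigma>'], of "{e<..}"] by simp
    show "AE \<sigma> in lborel. \<sigma> \<in> {e<..} \<longrightarrow> cmod (g' \<sigma> * ?c n \<sigma> powr (- of_real s)) \<le> A / (1 + \<sigma>\<^sup>2) + A * riesz_majorant s (\<sigma> - \<sigma>')"
      using AE_lborel_singleton[of \<sigma>'] by eventually_elim (use derivative_term_le[OF im'] in auto)
  qed measurable
  also have "\<dots> \<le> (\<integral>\<sigma>. A / (1 + \<sigma>\<^sup>2) + A * riesz_majorant s (\<sigma> - \<sigma>') \<partial>lborel)"
    unfolding set_lebesgue_integral_def
    by (rule integral_mono'[OF integrable_derivative_majorant])
      (use A_nonneg riesz_majorant_nonneg[of s] in \<open>auto simp: indicator_def\<close>)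
  also have "\<dots> = A * K + A * (\<integral>y. riesz_majorant s y \<partial>lborel)"
    using integrable_A_cauchy integrable_riesz_majorant_shift[OF s(2), of \<sigma>']
      integral_mult_right_zero[of lborel A "\<lambda>x. 1 / (1 + x\<^sup>2)"]
    by (simp add: K_def)
  finally have Dn: "cmod (D n) \<le> A * K + A * (\<integral>y. riesz_majorant s y \<partial>lborel)" .
  have "cmod (g e * ?c n e powr (- of_real s)) \<le> A * (1 + riesz_majorant s (e - \<sigma>'))"
    unfolding norm_mult using bound_A[of e] norm_kernel_le[OF im'[of n e]] \<sigma>' A_nonneg by (intro mult_mono) auto
  with Dn have num: "cmod (g e * ?c n e powr (- of_real s) + D n) \<le> A * (1 + riesz_majorant s (e - \<sigma>')) + A * K + A * (\<integral>y. riesz_majorant s y \<partial>lborel)"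
    using norm_triangle_ineq[of "g e * ?c n e powr (- of_real s)" "D n"] by linarith
  have "cmod (I n) = cmod (g e * ?c n e powr (- of_real s) + D n) / (s * cmod (\<beta> n))"
    unfolding I norm_divide norm_mult using s by simp
  also have "\<dots> \<le> (A * (1 + riesz_majorant s (e - \<sigma>')) + A * K + A * (\<integral>y. riesz_majorant s y \<partial>lborel)) / (s * 1)"
    using s \<beta>n[of n] order_trans[OF norm_ge_zero num] by (intro frac_le num mult_left_mono) auto
  finally show "cmod (I n) \<le> (A * (1 + riesz_majorant s (e - \<sigma>')) + A * K + A * (\<integral>y. riesz_majorant s y \<partial>lborel)) / s"
    by simp
qed

text \<open>The limit does not depend on how the imaginary axis is approached. Two different approximations of the
  kernel therefore lead to the same quadratic form.\<close>

lemma quadratic_form_limit: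
  fixes \<alpha> \<beta> :: "nat \<Rightarrow> real \<Rightarrow> complex" and k :: "nat \<Rightarrow> real \<Rightarrow> real"
  assumes k: "\<And>n \<sigma>'. e < \<sigma>' \<Longrightarrow> 0 < k n \<sigma>'" "\<And>n \<sigma> \<sigma>'. e \<le> \<sigma> \<Longrightarrow> e < \<sigma>' \<Longrightarrow> k n \<sigma>' \<le> Re (\<alpha> n \<sigma>' + \<beta> n \<sigma>' * of_real \<sigma>)"
    and im: "\<And>n \<sigma> \<sigma>'. Im (\<alpha> n \<sigma>' + \<beta> n \<sigma>' * of_real \<sigma>) = \<sigma> - \<sigma>'" and \<beta>1: "\<And>n \<sigma>'. Im (\<beta> n \<sigma>') = 1"
    and lim: "\<And>\<sigma>'. (\<lambda>n. \<alpha> n \<sigma>') \<longlonglongrightarrow> - \<i> * of_real \<sigma>'" "\<And>\<sigma>'. (\<lambda>n. \<beta> n \<sigma>') \<longlonglongrightarrow> \<i>"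
    and [measurable]: "\<And>n. \<alpha> n \<in> borel_measurable borel" "\<And>n. \<beta> n \<in> borel_measurable borel"
  shows "(\<lambda>n. LINT \<sigma>':{e<..}|lborel. cnj (g \<sigma>') *
      (LINT \<sigma>:{e<..}|lborel. g \<sigma> * (\<alpha> n \<sigma>' + \<beta> n \<sigma>' * of_real \<sigma>) powr (- 1 - of_real s))) \<longlonglongrightarrow>
    (LINT \<sigma>':{e<..}|lborel. cnj (g \<sigma>') * limit_kernel e \<sigma>')"
proof -
  define R where "R = (\<integral>y. riesz_majorant s y \<partial>lborel)"
  have R: "0 \<le> R" unfolding R_def by (intro Bochner_Integration.integral_nonneg riesz_majorant_nonneg)
  define B where "B \<sigma>' = (A * (1 + riesz_majorant s (e - \<sigma>')) + A * K + A * R) / s" for \<sigma>'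
  have B: "0 \<le> B \<sigma>'" for \<sigma>'
    using A_nonneg K_nonneg R s riesz_majorant_nonneg[of s] by (simp add: B_def)
  define W where "W \<sigma>' = ((1 + K + R) * A / s) * (A / (1 + \<sigma>'\<^sup>2)) + (A * A / s) * riesz_majorant s (e - \<sigma>')" for \<sigma>'
  have W: "A / (1 + \<sigma>'\<^sup>2) * B \<sigma>' \<le> W \<sigma>'" for \<sigma>'
  proof -
    have "A / (1 + \<sigma>'\<^sup>2) \<le> A / 1"
      using A_nonneg by (intro divide_left_mono) (auto simp: add_pos_nonneg)
    then have "A / (1 + \<sigma>'\<^sup>2) * (A / s * riesz_majorant s (e - \<sigma>')) \<le> A * (A / s * riesz_majorant s (e - \<sigma>'))"
      using A_nonneg s riesz_majorant_nonneg[of s] by (intro mult_right_mono) auto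
    moreover have "A / (1 + \<sigma>'\<^sup>2) * B \<sigma>' = ((1 + K + R) * A / s) * (A / (1 + \<sigma>'\<^sup>2)) + A / (1 + \<sigma>'\<^sup>2) * (A / s * riesz_majorant s (e - \<sigma>'))"
      using s unfolding B_def add_divide_distrib by (simp only: distrib_left distrib_right add_divide_distrib) (simp add: ac_simps)
    ultimately show ?thesis by (simp add: W_def)
  qed
  have iW: "integrable lborel W"
    unfolding W_def by (intro Bochner_Integration.integrable_add integrable_mult_right integrable_A_cauchy integrable_riesz_majorant_shift s)
  have m1: "(\<lambda>\<sigma>'. LINT \<sigma>:{e<..}|lborel. g \<sigma> * (\<alpha> n \<sigma>' + \<beta> n \<sigma>' * of_real \<sigma>) powr (- 1 - of_real s)) \<in> borel_measurable borel" for n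
    unfolding set_lebesgue_integral_def by (rule lborel.borel_measurable_lebesgue_integral) measurable
  have m2: "limit_kernel e \<in> borel_measurable borel"
  proof -
    have "(\<lambda>\<sigma>'. LINT \<sigma>:{e<..}|lborel. g' \<sigma> * (\<i> * of_real (\<sigma> - \<sigma>')) powr (- of_real s)) \<in> borel_measurable borel"
      unfolding set_lebesgue_integral_def by (rule lborel.borel_measurable_lebesgue_integral) measurable
    then show ?thesis unfolding limit_kernel_def by measurable
  qed
  have m3: "(\<lambda>\<sigma>'. indicator {e<..} \<sigma>' *\<^sub>R (cnj (g \<sigma>') * F \<sigma>')) \<in> borel_measurable lborel"
    if [measurable]: "F \<in> borel_measurable borel" for F :: "real \<Rightarrow> complex"
    by measurable
  show ?thesis
    unfolding set_lebesgue_integral_def[of lborel _ "\<lambda>\<sigma>'. cnj (g \<sigma>') * _ \<sigma>'"]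
  proof (rule integral_dominated_convergence[OF _ _ iW])
    show "AE \<sigma>' in lborel. (\<lambda>n. indicator {e<..} \<sigma>' *\<^sub>R (cnj (g \<sigma>') *
        (LINT \<sigma>:{e<..}|lborel. g \<sigma> * (\<alpha> n \<sigma>' + \<beta> n \<sigma>' * of_real \<sigma>) powr (- 1 - of_real s)))) \<longlonglongrightarrow>
        indicator {e<..} \<sigma>' *\<^sub>R (cnj (g \<sigma>') * limit_kernel e \<sigma>')"
    proof (intro AE_I2)
      fix \<sigma>' :: real
      show "(\<lambda>n. indicator {e<..} \<sigma>' *\<^sub>R (cnj (g \<sigma>') *
        (LINT \<sigma>:{e<..}|lborel. g \<sigma> * (\<alpha> n \<sigma>' + \<beta> n \<sigma>' * of_real \<sigma>) powr (- 1 - of_real s)))) \<longlonglongrightarrow>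
        indicator {e<..} \<sigma>' *\<^sub>R (cnj (g \<sigma>') * limit_kernel e \<sigma>')"
      proof (cases "e < \<sigma>'")
        case True
        show ?thesis
          by (intro tendsto_intros kernel_limit(1)[where k = "\<lambda>n. k n \<sigma>'"]) (use True k im \<beta>1 lim in auto)
      qed simp
    qed
    show "AE \<sigma>' in lborel. norm (indicator {e<..} \<sigma>' *\<^sub>R (cnj (g \<sigma>') *
        (LINT \<sigma>:{e<..}|lborel. g \<sigma> * (\<alpha> n \<sigma>' + \<beta> n \<sigma>' * of_real \<sigma>) powr (- 1 - of_real s)))) \<le> W \<sigma>'" for n
    proof (intro AE_I2)
      fix \<sigma>' :: real
      have W0: "0 \<le> W \<sigma>'"
        using A_nonneg B by (intro order_trans[OF _ W]) (auto intro!: mult_nonneg_nonneg)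
      show "norm (indicator {e<..} \<sigma>' *\<^sub>R (cnj (g \<sigma>') *
        (LINT \<sigma>:{e<..}|lborel. g \<sigma> * (\<alpha> n \<sigma>' + \<beta> n \<sigma>' * of_real \<sigma>) powr (- 1 - of_real s)))) \<le> W \<sigma>'"
      proof (cases "e < \<sigma>'")
        case True
        have "cmod (LINT \<sigma>:{e<..}|lborel. g \<sigma> * (\<alpha> n \<sigma>' + \<beta> n \<sigma>' * of_real \<sigma>) powr (- 1 - of_real s)) \<le> B \<sigma>'"
          unfolding B_def R_def
          by (rule kernel_limit(2)[where k = "\<lambda>n. k n \<sigma>'" and \<alpha> = "\<lambda>n. \<alpha> n \<sigma>'" and \<beta> = "\<lambda>n. \<beta> n \<sigma>'"])
            (use True k im \<beta>1 lim in auto)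
        then have "cmod (cnj (g \<sigma>') * (LINT \<sigma>:{e<..}|lborel. g \<sigma> * (\<alpha> n \<sigma>' + \<beta> n \<sigma>' * of_real \<sigma>) powr (- 1 - of_real s)))
            \<le> A / (1 + \<sigma>'\<^sup>2) * B \<sigma>'"
          unfolding norm_mult complex_mod_cnj using bound(1)[of \<sigma>'] A_nonneg by (intro mult_mono) auto
        with W[of \<sigma>'] True show ?thesis by simp
      qed (use W0 in simp)
    qed
  qed (rule m3[OF m2], rule m3[OF m1])
qed

end

text \<open>The square of an oscillatory integral with phase \<open>\<theta>\<close>, integrated against \<open>\<omega>\<^sup>s e\<^sup>-\<^sup>\<eta>\<^sup>\<omega>\<close>: the Laplace
  transform of \<open>\<omega>\<^sup>s\<close> becomes the kernel of a quadratic form.\<close>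

lemma phase_quadratic_form:
  fixes h :: "real \<Rightarrow> complex" and \<theta> :: "real \<Rightarrow> real" and s \<eta> :: real
  assumes h: "integrable lborel h" and [measurable]: "\<theta> \<in> borel_measurable borel" and s: "0 < s" and \<eta>: "0 < \<eta>"
  defines "H \<equiv> \<lambda>\<omega>. \<integral>\<sigma>. cis (- \<omega> * \<theta> \<sigma>) * h \<sigma> \<partial>lborel"
  shows "integrable lborel (\<lambda>\<omega>. indicator {0<..} \<omega> * (\<omega> powr s * exp (- (\<eta> * \<omega>))) * (cmod (H \<omega>))\<^sup>2)"
    "of_real (\<integral>\<omega>. indicator {0<..} \<omega> * (\<omega> powr s * exp (- (\<eta> * \<omega>))) * (cmod (H \<omega>))\<^sup>2 \<partial>lborel) =
      of_real (Gamma (1 + s)) * (\<integral>\<sigma>'. cnj (h \<sigma>') *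
        (\<integral>\<sigma>. h \<sigma> * (of_real \<eta> + \<i> * of_real (\<theta> \<sigma> - \<theta> \<sigma>')) powr (- 1 - of_real s) \<partial>lborel) \<partial>lborel)"
proof -
  have [measurable]: "h \<in> borel_measurable borel" using borel_measurable_integrable[OF h] by simp
  define \<rho> where "\<rho> \<omega> = indicator {0<..} \<omega> * (\<omega> powr s * exp (- (\<eta> * \<omega>)))" for \<omega> :: real
  have [measurable]: "\<rho> \<in> borel_measurable borel" unfolding \<rho>_def by measurable
  have \<rho>0: "0 \<le> \<rho> \<omega>" for \<omega> by (simp add: \<rho>_def)
  have i\<rho>: "integrable lborel \<rho>"
    using set_integrable_powr_exp[of "1 + s" \<eta>] s \<eta> by (simp add: \<rho>_def[abs_def] set_integrable_def)
  define N where "N = density lborel (\<lambda>\<omega>. ennreal (\<rho> \<omega>))"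
  have "emeasure N (space N) < \<infinity>"
    using i\<rho> \<rho>0 by (simp add: N_def emeasure_density integrable_iff_bounded)
  then have fin: "finite_measure N" by (intro finite_measureI) simp
  have [measurable_cong]: "sets N = sets borel" by (simp add: N_def)
  have m: "(\<lambda>(\<omega>, \<sigma>). cis (- \<omega> * \<theta> \<sigma>)) \<in> borel_measurable (N \<Otimes>\<^sub>M lborel)" by measurable
  have n1: "cmod (cis (- \<omega> * \<theta> \<sigma>)) \<le> 1" for \<omega> \<sigma> by simp
  note osc = integral_norm_sq_oscillatory[OF fin lborel.sigma_finite_measure_axioms m n1 h]
  have [measurable]: "H \<in> borel_measurable borel" unfolding H_def by measurable
  have Hd: "H \<omega> = (\<integral>\<sigma>. cis (- \<omega> * \<theta> \<sigma>) * h \<sigma> \<partial>lborel)" for \<omega> by (simp only: H_def)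
  show "integrable lborel (\<lambda>\<omega>. indicator {0<..} \<omega> * (\<omega> powr s * exp (- (\<eta> * \<omega>))) * (cmod (H \<omega>))\<^sup>2)"
    using osc(2) \<rho>0 unfolding Hd[symmetric] \<rho>_def[symmetric] N_def by (subst (asm) integrable_density) auto
  have kern: "(\<integral>\<omega>. cis (- \<omega> * \<theta> \<sigma>) * cnj (cis (- \<omega> * \<theta> \<sigma>')) \<partial>N) =
      of_real (Gamma (1 + s)) * (of_real \<eta> + \<i> * of_real (\<theta> \<sigma> - \<theta> \<sigma>')) powr (- 1 - of_real s)" for \<sigma> \<sigma>'
  proof -
    let ?c = "of_real \<eta> + \<i> * complex_of_real (\<theta> \<sigma> - \<theta> \<sigma>')"
    have "(\<integral>\<omega>. cis (- \<omega> * \<theta> \<sigma>) * cnj (cis (- \<omega> * \<theta> \<sigma>')) \<partial>N) =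
        (\<integral>\<omega>. \<rho> \<omega> *\<^sub>R (cis (- \<omega> * \<theta> \<sigma>) * cnj (cis (- \<omega> * \<theta> \<sigma>'))) \<partial>lborel)"
      unfolding N_def by (rule integral_density) (use \<rho>0 in auto)
    also have "\<dots> = (LINT \<omega>:{0<..}|lborel. of_real (\<omega> powr (1 + s - 1)) * exp (- ?c * of_real \<omega>))"
      unfolding set_lebesgue_integral_def
    proof (intro Bochner_Integration.integral_cong refl)
      fix \<omega> :: real
      have "exp (- ?c * of_real \<omega>) = of_real (exp (- (\<eta> * \<omega>))) * (cis (- \<omega> * \<theta> \<sigma>) * cis (\<omega> * \<theta> \<sigma>'))"
        unfolding cis_mult cis_conv_exp exp_of_real[symmetric] exp_add[symmetric]
        by (intro arg_cong[where f = exp]) (simp add: algebra_simps)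
      then show "\<rho> \<omega> *\<^sub>R (cis (- \<omega> * \<theta> \<sigma>) * cnj (cis (- \<omega> * \<theta> \<sigma>'))) =
          indicator {0<..} \<omega> *\<^sub>R (of_real (\<omega> powr (1 + s - 1)) * exp (- ?c * of_real \<omega>))"
        by (simp add: \<rho>_def cis_cnj scaleR_conv_of_real indicator_def)
    qed
    also have "\<dots> = of_real (Gamma (1 + s)) * ?c powr (- of_real (1 + s))"
      using s \<eta> by (intro laplace_powr) auto
    finally show ?thesis by simp
  qed
  have "of_real (\<integral>\<omega>. \<rho> \<omega> * (cmod (H \<omega>))\<^sup>2 \<partial>lborel) = complex_of_real (\<integral>\<omega>. (cmod (H \<omega>))\<^sup>2 \<partial>N)"
    unfolding N_def by (subst integral_density) (use \<rho>0 in auto)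
  also have "\<dots> = (\<integral>\<sigma>'. cnj (h \<sigma>') * (\<integral>\<sigma>. h \<sigma> * (of_real (Gamma (1 + s)) *
      (of_real \<eta> + \<i> * of_real (\<theta> \<sigma> - \<theta> \<sigma>')) powr (- 1 - of_real s)) \<partial>lborel) \<partial>lborel)"
    unfolding H_def osc(1) kern ..
  also have "\<dots> = of_real (Gamma (1 + s)) * (\<integral>\<sigma>'. cnj (h \<sigma>') *
        (\<integral>\<sigma>. h \<sigma> * (of_real \<eta> + \<i> * of_real (\<theta> \<sigma> - \<theta> \<sigma>')) powr (- 1 - of_real s) \<partial>lborel) \<partial>lborel)"
    by (simp only: mult.left_commute[of _ "complex_of_real (Gamma (1 + s))"] integral_mult_right_zero)
  finally show "of_real (\<integral>\<omega>. indicator {0<..} \<omega> * (\<omega> powr s * exp (- (\<eta> * \<omega>))) * (cmod (H \<omega>))\<^sup>2 \<partial>lborel) =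
      of_real (Gamma (1 + s)) * (\<integral>\<sigma>'. cnj (h \<sigma>') *
        (\<integral>\<sigma>. h \<sigma> * (of_real \<eta> + \<i> * of_real (\<theta> \<sigma> - \<theta> \<sigma>')) powr (- 1 - of_real s) \<partial>lborel) \<partial>lborel)"
    by (simp only: \<rho>_def)
qed

lemma nn_integral_eq_of_laplace_regularized:
  fixes H :: "real \<Rightarrow> complex"
  assumes [measurable]: "H \<in> borel_measurable borel"
    and int: "\<And>n. integrable lborel (\<lambda>\<omega>. indicator {0<..} \<omega> * (\<omega> powr s * exp (- (1 / real (Suc n) * \<omega>))) * (cmod (H \<omega>))\<^sup>2)"
    and lim: "(\<lambda>n. complex_of_real (\<integral>\<omega>. indicator {0<..} \<omega> * (\<omega> powr s * exp (- (1 / real (Suc n) * \<omega>))) * (cmod (H \<omega>))\<^sup>2 \<partial>lborel)) \<longlonglongrightarrow> L"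
  shows "(\<integral>\<^sup>+\<omega>\<in>{0<..}. ennreal (\<omega> powr s * (cmod (H \<omega>))\<^sup>2) \<partial>lborel) = ennreal (Re L)"
proof -
  define \<rho> where "\<rho> n \<omega> = exp (- (1 / real (Suc n) * \<bar>\<omega>\<bar>))" for n \<omega>
  have [measurable]: "\<rho> n \<in> borel_measurable borel" for n unfolding \<rho>_def by measurable
  define F where "F \<omega> = indicator {0<..} \<omega> * (\<omega> powr s * (cmod (H \<omega>))\<^sup>2)" for \<omega>
  have [measurable]: "F \<in> borel_measurable borel" unfolding F_def by measurable
  have eq: "indicator {0<..} \<omega> * (\<omega> powr s * exp (- (1 / real (Suc n) * \<omega>))) * (cmod (H \<omega>))\<^sup>2 = \<rho> n \<omega> * F \<omega>" for n \<omega>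
    by (auto simp: \<rho>_def F_def indicator_def)
  have "(\<integral>\<^sup>+\<omega>. ennreal (F \<omega>) \<partial>lborel) = ennreal (Re L)"
  proof (rule nn_integral_eq_of_regularized)
    show "0 \<le> F \<omega>" for \<omega> by (simp add: F_def)
    show "incseq (\<lambda>n. \<rho> n \<omega>)" for \<omega>
      unfolding \<rho>_def incseq_def by (auto intro!: mult_right_mono divide_left_mono)
    have "(\<lambda>n. \<rho> n \<omega>) \<longlonglongrightarrow> exp (- (0 * \<bar>\<omega>\<bar>))" for \<omega>
      unfolding \<rho>_def by (intro tendsto_intros LIMSEQ_Suc[OF lim_const_over_n])
    then show "(\<lambda>n. \<rho> n \<omega>) \<longlonglongrightarrow> 1" for \<omega> by simp
    show "(\<lambda>n. \<integral>\<omega>. \<rho> n \<omega> * F \<omega> \<partial>lborel) \<longlonglongrightarrow> Re L"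
      using tendsto_Re[OF lim] unfolding eq by simp
    show "integrable lborel (\<lambda>\<omega>. \<rho> n \<omega> * F \<omega>)" for n
      using int[of n] unfolding eq .
  qed (auto simp: \<rho>_def)
  moreover have "ennreal (F \<omega>) = ennreal (\<omega> powr s * (cmod (H \<omega>))\<^sup>2) * indicator {0<..} \<omega>" for \<omega>
    by (auto simp: F_def indicator_def)
  ultimately show ?thesis by (simp only:)
qed

context mode_profile
begin

text \<open>For one Fourier mode these are, with the history cut off at \<open>e\<close>, the Poisson lifting as a function of
  \<open>r = z\<^sup>2 / 4\<close>, without its constant and the power of \<open>z\<close>, and the transform that enters the quadratic form.\<close>

definition mode_lifting :: "real \<Rightarrow> real \<Rightarrow> complex" where
  "mode_lifting e r = (LINT \<sigma>:{e<..}|lborel. of_real (\<sigma> powr (- 1 - s)) * cis (r / \<sigma>) * g \<sigma>)"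

definition time_transform :: "real \<Rightarrow> real \<Rightarrow> complex" where
  "time_transform e \<omega> = (LINT \<sigma>:{e<..}|lborel. cis (- \<omega> * \<sigma>) * g \<sigma>)"

lemma mode_lifting_measurable [measurable]: "mode_lifting e \<in> borel_measurable borel"
  unfolding mode_lifting_def set_lebesgue_integral_def by measurable

lemma time_transform_measurable [measurable]: "time_transform e \<in> borel_measurable borel"
  unfolding time_transform_def set_lebesgue_integral_def by measurable

text \<open>The two quadratic forms have the kernels \<open>(\<eta> + \<i> (\<sigma> - \<sigma>'))\<^sup>-\<^sup>1\<^sup>-\<^sup>s\<close> and, after the factors \<open>\<sigma>\<^sup>-\<^sup>1\<^sup>-\<^sup>s\<close> are
  absorbed by homogeneity, \<open>(\<eta> \<sigma> \<sigma>' + \<i> (\<sigma> - \<sigma>'))\<^sup>-\<^sup>1\<^sup>-\<^sup>s\<close>. They have the same limit as \<open>\<eta> \<rightarrow> 0\<close>.\<close>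

lemma truncated_identity:
  assumes e: "0 < e"
  shows "(\<integral>\<^sup>+r\<in>{0<..}. ennreal (r powr s * (cmod (mode_lifting e r))\<^sup>2) \<partial>lborel) =
    (\<integral>\<^sup>+\<omega>\<in>{0<..}. ennreal (\<omega> powr s * (cmod (time_transform e \<omega>))\<^sup>2) \<partial>lborel)"
proof -
  define \<eta> where "\<eta> n = 1 / real (Suc n)" for n
  have \<eta>: "0 < \<eta> n" for n by (simp add: \<eta>_def)
  have \<eta>0: "\<eta> \<longlonglongrightarrow> 0" unfolding \<eta>_def by (rule LIMSEQ_Suc[OF lim_const_over_n])
  have \<eta>c: "(\<lambda>n. complex_of_real (\<eta> n)) \<longlonglongrightarrow> 0" using tendsto_of_real[OF \<eta>0, where 'a = complex] by simp
  define L where "L = of_real (Gamma (1 + s)) * (LINT \<sigma>':{e<..}|lborel. cnj (g \<sigma>') * limit_kernel e \<sigma>')"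
  have "(\<integral>\<^sup>+\<omega>\<in>{0<..}. ennreal (\<omega> powr s * (cmod (time_transform e \<omega>))\<^sup>2) \<partial>lborel) = ennreal (Re L)"
  proof (rule nn_integral_eq_of_laplace_regularized)
    let ?h = "\<lambda>\<sigma>. indicator {e<..} \<sigma> *\<^sub>R g \<sigma>"
    have ih: "integrable lborel ?h"
      using integrable_mult_indicator[OF _ g_integrable(1), of "{e<..}"] by simp
    have H: "(\<integral>\<sigma>. cis (- \<omega> * \<sigma>) * ?h \<sigma> \<partial>lborel) = time_transform e \<omega>" for \<omega>
      unfolding time_transform_def set_lebesgue_integral_def by simp
    note q = phase_quadratic_form[OF ih measurable_ident_sets[OF refl] s(1) \<eta>, unfolded H]
    show "integrable lborel (\<lambda>\<omega>. indicator {0<..} \<omega> * (\<omega> powr s * exp (- (1 / real (Suc n) * \<omega>))) * (cmod (time_transform e \<omega>))\<^sup>2)" for n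
      using q(1)[of n] unfolding \<eta>_def .
    have "(\<lambda>n. of_real (Gamma (1 + s)) * (LINT \<sigma>':{e<..}|lborel. cnj (g \<sigma>') *
        (LINT \<sigma>:{e<..}|lborel. g \<sigma> * ((of_real (\<eta> n) - \<i> * of_real \<sigma>') + \<i> * of_real \<sigma>) powr (- 1 - of_real s)))) \<longlonglongrightarrow> L"
      unfolding L_def
    proof (intro tendsto_mult_left quadratic_form_limit[where k = "\<lambda>n \<sigma>'. \<eta> n"])
      show "(\<lambda>n. of_real (\<eta> n) - \<i> * of_real \<sigma>') \<longlonglongrightarrow> - \<i> * of_real \<sigma>'" for \<sigma>'
        using tendsto_diff[OF \<eta>c tendsto_const, of "\<i> * of_real \<sigma>'"] by simp
    qed (use \<eta> in auto)
    moreover have "complex_of_real (\<integral>\<omega>. indicator {0<..} \<omega> * (\<omega> powr s * exp (- (1 / real (Suc n) * \<omega>))) * (cmod (time_transform e \<omega>))\<^sup>2 \<partial>lborel) =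
      of_real (Gamma (1 + s)) * (LINT \<sigma>':{e<..}|lborel. cnj (g \<sigma>') *
        (LINT \<sigma>:{e<..}|lborel. g \<sigma> * ((of_real (\<eta> n) - \<i> * of_real \<sigma>') + \<i> * of_real \<sigma>) powr (- 1 - of_real s)))" for n
    proof -
      have base: "of_real (\<eta> n) + \<i> * of_real (\<sigma> - \<sigma>') = (of_real (\<eta> n) - \<i> * of_real \<sigma>') + \<i> * complex_of_real \<sigma>" for \<sigma> \<sigma>'
        by (simp add: algebra_simps)
      have "(\<integral>\<sigma>'. cnj (?h \<sigma>') * (\<integral>\<sigma>. ?h \<sigma> * (of_real (\<eta> n) + \<i> * of_real (\<sigma> - \<sigma>')) powr (- 1 - of_real s) \<partial>lborel) \<partial>lborel) =
        (LINT \<sigma>':{e<..}|lborel. cnj (g \<sigma>') *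
        (LINT \<sigma>:{e<..}|lborel. g \<sigma> * ((of_real (\<eta> n) - \<i> * of_real \<sigma>') + \<i> * of_real \<sigma>) powr (- 1 - of_real s)))"
        unfolding set_lebesgue_integral_def base by simp
      with q(2)[of n] show ?thesis by (simp only: \<eta>_def)
    qed
    ultimately show "(\<lambda>n. complex_of_real (\<integral>\<omega>. indicator {0<..} \<omega> * (\<omega> powr s * exp (- (1 / real (Suc n) * \<omega>))) * (cmod (time_transform e \<omega>))\<^sup>2 \<partial>lborel)) \<longlonglongrightarrow> L"
      by (simp only:)
  qed measurable
  moreover have "(\<integral>\<^sup>+r\<in>{0<..}. ennreal (r powr s * (cmod (mode_lifting e r))\<^sup>2) \<partial>lborel) = ennreal (Re L)"
  proof (rule nn_integral_eq_of_laplace_regularized)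
    let ?h = "\<lambda>\<sigma>. indicator {e<..} \<sigma> *\<^sub>R (g \<sigma> * of_real (\<sigma> powr (- 1 - s)))"
    have "set_integrable lborel {e<..} (\<lambda>\<sigma>. g \<sigma> * of_real (\<sigma> powr (- 1 - s)))"
    proof (rule set_integrable_bounded_factor[OF g_integrable(1)])
      show "cmod (of_real (\<sigma> powr (- 1 - s))) \<le> e powr (- 1 - s)" if "\<sigma> \<in> {e<..}" for \<sigma>
        using that e s powr_mono2'[of "- 1 - s" e \<sigma>] by simp
    qed measurable
    then have ih: "integrable lborel ?h" by (simp add: set_integrable_def)
    have H: "(\<integral>\<sigma>. cis (- r * (- 1 / \<sigma>)) * ?h \<sigma> \<partial>lborel) = mode_lifting e r" for r
      unfolding mode_lifting_def set_lebesgue_integral_def by (intro Bochner_Integration.integral_cong refl) (simp add: ac_simps)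
    have m: "(\<lambda>\<sigma>::real. - 1 / \<sigma>) \<in> borel_measurable borel" by measurable
    note q = phase_quadratic_form[OF ih m s(1) \<eta>, unfolded H]
    show "integrable lborel (\<lambda>r. indicator {0<..} r * (r powr s * exp (- (1 / real (Suc n) * r))) * (cmod (mode_lifting e r))\<^sup>2)" for n
      using q(1)[of n] unfolding \<eta>_def .
    have "(\<lambda>n. of_real (Gamma (1 + s)) * (LINT \<sigma>':{e<..}|lborel. cnj (g \<sigma>') *
        (LINT \<sigma>:{e<..}|lborel. g \<sigma> * ((- \<i> * of_real \<sigma>') + (of_real (\<eta> n * \<sigma>') + \<i>) * of_real \<sigma>) powr (- 1 - of_real s)))) \<longlonglongrightarrow> L"
      unfolding L_def
    proof (intro tendsto_mult_left quadratic_form_limit[where k = "\<lambda>n \<sigma>'. \<eta> n * \<sigma>' * e"])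
      show "(\<lambda>n. of_real (\<eta> n * \<sigma>') + \<i>) \<longlonglongrightarrow> \<i>" for \<sigma>'
        using tendsto_add[OF tendsto_mult[OF \<eta>c tendsto_const[of "of_real \<sigma>'"]] tendsto_const[of \<i>]] by simp
      show "\<eta> n * \<sigma>' * e \<le> Re (- \<i> * of_real \<sigma>' + (of_real (\<eta> n * \<sigma>') + \<i>) * of_real \<sigma>)"
        if "e \<le> \<sigma>" "e < \<sigma>'" for n \<sigma> \<sigma>'
        using that \<eta>[of n] e by simp
    qed (use \<eta> e in auto)
    moreover have "complex_of_real (\<integral>r. indicator {0<..} r * (r powr s * exp (- (1 / real (Suc n) * r))) * (cmod (mode_lifting e r))\<^sup>2 \<partial>lborel) =
      of_real (Gamma (1 + s)) * (LINT \<sigma>':{e<..}|lborel. cnj (g \<sigma>') *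
        (LINT \<sigma>:{e<..}|lborel. g \<sigma> * ((- \<i> * of_real \<sigma>') + (of_real (\<eta> n * \<sigma>') + \<i>) * of_real \<sigma>) powr (- 1 - of_real s)))" for n
    proof -
      have hom: "of_real (\<sigma>' powr (- 1 - s)) * (of_real (\<sigma> powr (- 1 - s)) * (of_real (\<eta> n) + \<i> * of_real (- 1 / \<sigma> - - 1 / \<sigma>')) powr (- 1 - of_real s)) =
          ((- \<i> * of_real \<sigma>') + (of_real (\<eta> n * \<sigma>') + \<i>) * of_real \<sigma>) powr (- 1 - complex_of_real s)"
        if "e < \<sigma>" "e < \<sigma>'" for \<sigma> \<sigma>'
      proof -
        have pos: "0 < \<sigma>" "0 < \<sigma>'" using that e by auto
        have "(- \<i> * of_real \<sigma>') + (of_real (\<eta> n * \<sigma>') + \<i>) * of_real \<sigma> =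
            of_real (\<sigma>' * \<sigma>) * (of_real (\<eta> n) + \<i> * complex_of_real (- 1 / \<sigma> - - 1 / \<sigma>'))"
          using pos by (simp add: field_simps)
        also have "\<dots> powr (- 1 - of_real s) = of_real (\<sigma>' * \<sigma>) powr (- 1 - of_real s) *
            (of_real (\<eta> n) + \<i> * complex_of_real (- 1 / \<sigma> - - 1 / \<sigma>')) powr (- 1 - of_real s)"
          using pos by (intro powr_times_real_left) auto
        also have "complex_of_real (\<sigma>' * \<sigma>) powr (- 1 - of_real s) = of_real ((\<sigma>' * \<sigma>) powr (- 1 - s))"
          using pos powr_of_real[of "\<sigma>' * \<sigma>" "- 1 - s"] by simp
        also have "(\<sigma>' * \<sigma>) powr (- 1 - s) = \<sigma>' powr (- 1 - s) * \<sigma> powr (- 1 - s)"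
          using pos by (simp add: powr_mult)
        finally show ?thesis by simp
      qed
      have "(\<integral>\<sigma>'. cnj (?h \<sigma>') * (\<integral>\<sigma>. ?h \<sigma> * (of_real (\<eta> n) + \<i> * of_real (- 1 / \<sigma> - - 1 / \<sigma>')) powr (- 1 - of_real s) \<partial>lborel) \<partial>lborel) =
        (LINT \<sigma>':{e<..}|lborel. cnj (g \<sigma>') *
        (LINT \<sigma>:{e<..}|lborel. g \<sigma> * ((- \<i> * of_real \<sigma>') + (of_real (\<eta> n * \<sigma>') + \<i>) * of_real \<sigma>) powr (- 1 - of_real s)))"
        unfolding set_lebesgue_integral_def
      proof (intro Bochner_Integration.integral_cong refl)
        fix \<sigma>' :: real
        show "cnj (?h \<sigma>') * (\<integral>\<sigma>. ?h \<sigma> * (of_real (\<eta> n) + \<i> * of_real (- 1 / \<sigma> - - 1 / \<sigma>')) powr (- 1 - of_real s) \<partial>lborel) =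
          indicator {e<..} \<sigma>' *\<^sub>R (cnj (g \<sigma>') * (\<integral>\<sigma>. indicator {e<..} \<sigma> *\<^sub>R
            (g \<sigma> * ((- \<i> * of_real \<sigma>') + (of_real (\<eta> n * \<sigma>') + \<i>) * of_real \<sigma>) powr (- 1 - of_real s)) \<partial>lborel))"
        proof (cases "e < \<sigma>'")
          case True
          have "of_real (\<sigma>' powr (- 1 - s)) * (\<integral>\<sigma>. ?h \<sigma> * (of_real (\<eta> n) + \<i> * of_real (- 1 / \<sigma> - - 1 / \<sigma>')) powr (- 1 - of_real s) \<partial>lborel) =
              (\<integral>\<sigma>. of_real (\<sigma>' powr (- 1 - s)) * (?h \<sigma> * (of_real (\<eta> n) + \<i> * of_real (- 1 / \<sigma> - - 1 / \<sigma>')) powr (- 1 - of_real s)) \<partial>lborel)"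
            by (rule integral_mult_right_zero[symmetric])
          also have "\<dots> = (\<integral>\<sigma>. indicator {e<..} \<sigma> *\<^sub>R
            (g \<sigma> * ((- \<i> * of_real \<sigma>') + (of_real (\<eta> n * \<sigma>') + \<i>) * of_real \<sigma>) powr (- 1 - of_real s)) \<partial>lborel)"
          proof (intro Bochner_Integration.integral_cong refl)
            fix \<sigma> :: real
            show "of_real (\<sigma>' powr (- 1 - s)) * (?h \<sigma> * (of_real (\<eta> n) + \<i> * of_real (- 1 / \<sigma> - - 1 / \<sigma>')) powr (- 1 - of_real s)) =
              indicator {e<..} \<sigma> *\<^sub>R (g \<sigma> * ((- \<i> * of_real \<sigma>') + (of_real (\<eta> n * \<sigma>') + \<i>) * of_real \<sigma>) powr (- 1 - of_real s))"
            proof (cases "e < \<sigma>")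
              case False
              then show ?thesis by simp
            next
              case \<sigma>: True
              show ?thesis
                unfolding hom[OF \<sigma> True, symmetric] using \<sigma> by (simp only: indicator_simps greaterThan_iff scaleR_one ac_simps)
            qed
          qed
          finally show ?thesis
            using True by (simp only: indicator_simps greaterThan_iff scaleR_one complex_cnj_mult complex_cnj_complex_of_real mult.assoc)
        qed simp
      qed
      with q(2)[of n] show ?thesis by (simp only: \<eta>_def)
    qed
    ultimately show "(\<lambda>n. complex_of_real (\<integral>r. indicator {0<..} r * (r powr s * exp (- (1 / real (Suc n) * r))) * (cmod (mode_lifting e r))\<^sup>2 \<partial>lborel)) \<longlonglongrightarrow> L"
      by (simp only:)
  qed measurable
  ultimately show ?thesis by simp
qed

subsection \<open>Removing the truncation\<close>

text \<open>The derivative of the amplitude \<open>\<sigma>\<^sup>1\<^sup>-\<^sup>s g(\<sigma>)\<close>.\<close>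

definition amplitude_deriv :: "real \<Rightarrow> complex" where
  "amplitude_deriv \<sigma> = of_real ((1 - s) * \<sigma> powr (- s)) * g \<sigma> + of_real (\<sigma> powr (1 - s)) * g' \<sigma>"

lemma amplitude_deriv_measurable [measurable]: "amplitude_deriv \<in> borel_measurable borel"
  unfolding amplitude_deriv_def by measurable

lemma amplitude_deriv_bound:
  assumes \<sigma>: "0 < \<sigma>"
  shows "cmod (amplitude_deriv \<sigma>) \<le> 2 * A * \<sigma> powr (- s)" "cmod (amplitude_deriv \<sigma>) \<le> 2 * A * \<sigma> powr (- 1 - s)"
proof -
  have p: "\<sigma> powr (1 - s) = \<sigma> powr (- s) * \<sigma>" "\<sigma> powr (- s) = \<sigma> powr (- 1 - s) * \<sigma>"
    using \<sigma> by (simp_all add: powr_diff powr_minus field_simps)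
  have d: "0 < 1 + \<sigma>\<^sup>2" by (simp add: add_pos_nonneg)
  have "cmod (amplitude_deriv \<sigma>) \<le> (1 - s) * \<sigma> powr (- s) * cmod (g \<sigma>) + \<sigma> powr (1 - s) * cmod (g' \<sigma>)"
    unfolding amplitude_deriv_def using s by (intro order_trans[OF norm_triangle_ineq]) (simp only: norm_mult norm_of_real, simp)
  also have "\<dots> \<le> 1 * \<sigma> powr (- s) * (A / (1 + \<sigma>\<^sup>2)) + \<sigma> powr (1 - s) * (A / (1 + \<sigma>\<^sup>2))"
    using s bound by (intro add_mono mult_mono mult_right_mono) auto
  also have "\<dots> = A * \<sigma> powr (- s) * ((1 + \<sigma>) / (1 + \<sigma>\<^sup>2))"
    unfolding p(1) by (simp add: add_divide_distrib distrib_left ac_simps)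
  finally have 1: "cmod (amplitude_deriv \<sigma>) \<le> A * \<sigma> powr (- s) * ((1 + \<sigma>) / (1 + \<sigma>\<^sup>2))" .
  have "0 \<le> (\<sigma> - 1)\<^sup>2" by simp
  then have q: "2 * \<sigma> \<le> 1 + \<sigma>\<^sup>2" by (simp add: power2_eq_square algebra_simps)
  have "(1 + \<sigma>) / (1 + \<sigma>\<^sup>2) \<le> 2"
  proof -
    have "1 + \<sigma> \<le> 2 * (1 + \<sigma>\<^sup>2)" using q \<sigma> zero_le_power2[of \<sigma>] by argo
    then show ?thesis using d by (simp only: divide_le_eq if_True)
  qed
  then have "A * \<sigma> powr (- s) * ((1 + \<sigma>) / (1 + \<sigma>\<^sup>2)) \<le> A * \<sigma> powr (- s) * 2"
    using A_nonneg by (intro mult_left_mono) auto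
  with 1 show "cmod (amplitude_deriv \<sigma>) \<le> 2 * A * \<sigma> powr (- s)" by simp
  have "\<sigma> * ((1 + \<sigma>) / (1 + \<sigma>\<^sup>2)) \<le> 2"
    using d q \<sigma> zero_le_power2[of \<sigma>] by (simp add: divide_le_eq power2_eq_square algebra_simps)
  then have "A * \<sigma> powr (- 1 - s) * (\<sigma> * ((1 + \<sigma>) / (1 + \<sigma>\<^sup>2))) \<le> A * \<sigma> powr (- 1 - s) * 2"
    using A_nonneg by (intro mult_left_mono) auto
  with 1 show "cmod (amplitude_deriv \<sigma>) \<le> 2 * A * \<sigma> powr (- 1 - s)"
    unfolding p(2) by (simp add: mult.assoc)
qed

lemma norm_amplitude_deriv_wave_AE:
  "AE \<sigma> in lborel. \<sigma> \<in> {0<..} \<longrightarrow> cmod (amplitude_deriv \<sigma> * cis (r / \<sigma>)) \<le> 2 * A * power_hat s s \<sigma>"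
  by (rule le_power_hat_AE) (auto simp: norm_mult amplitude_deriv_bound)

lemma set_integrable_hat: "set_integrable lborel {0<..} (\<lambda>\<sigma>. 2 * A * power_hat s s \<sigma>)"
  unfolding set_integrable_def
  using integrable_mult_indicator[OF _ integrable_mult_right[OF integrable_power_hat[OF s(2,1)], of "2 * A"], of "{0<..}"] by simp

lemma
  assumes "0 \<le> e"
  shows amplitude_deriv_wave_integrable: "set_integrable lborel {e<..} (\<lambda>\<sigma>. amplitude_deriv \<sigma> * cis (r / \<sigma>))"
    and amplitude_deriv_wave_le: "cmod (LINT \<sigma>:{e<..}|lborel. amplitude_deriv \<sigma> * cis (r / \<sigma>)) \<le> 2 * A * (1 / (1 - s) + 1 / s)"
proof -
  have m: "(\<lambda>\<sigma>. indicator {e<..} \<sigma> *\<^sub>R (amplitude_deriv \<sigma> * cis (r / \<sigma>))) \<in> borel_measurable borel" by measurable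
  have i: "set_integrable lborel {e<..} (\<lambda>\<sigma>. 2 * A * power_hat s s \<sigma>)"
    by (rule set_integrable_subset[OF set_integrable_hat]) (use assms in auto)
  have b: "AE \<sigma> in lborel. \<sigma> \<in> {e<..} \<longrightarrow> cmod (amplitude_deriv \<sigma> * cis (r / \<sigma>)) \<le> 2 * A * power_hat s s \<sigma>"
    using norm_amplitude_deriv_wave_AE[of r] by eventually_elim (use assms in auto)
  show "set_integrable lborel {e<..} (\<lambda>\<sigma>. amplitude_deriv \<sigma> * cis (r / \<sigma>))"
    by (rule set_integral_dominated(1)[OF m i b])
  have "cmod (LINT \<sigma>:{e<..}|lborel. amplitude_deriv \<sigma> * cis (r / \<sigma>)) \<le> (LINT \<sigma>:{e<..}|lborel. 2 * A * power_hat s s \<sigma>)"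
    by (rule set_integral_dominated(2)[OF m i b])
  also have "\<dots> \<le> (\<integral>\<sigma>. 2 * A * power_hat s s \<sigma> \<partial>lborel)"
    unfolding set_lebesgue_integral_def
    by (rule integral_mono'[OF integrable_mult_right[OF integrable_power_hat[OF s(2,1)]]])
      (use A_nonneg power_hat_nonneg[of s s] in \<open>auto simp: indicator_def\<close>)
  also have "\<dots> = 2 * A * (1 / (1 - s) + 1 / s)"
    by (simp add: integral_power_hat[OF s(2,1)])
  finally show "cmod (LINT \<sigma>:{e<..}|lborel. amplitude_deriv \<sigma> * cis (r / \<sigma>)) \<le> 2 * A * (1 / (1 - s) + 1 / s)" .
qed

lemma has_vector_derivative_wave:
  assumes "0 < \<sigma>"
  shows "((\<lambda>\<sigma>. of_real (\<sigma> powr (1 - s)) * g \<sigma> * cis (r / \<sigma>)) has_vector_derivative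
      amplitude_deriv \<sigma> * cis (r / \<sigma>) - \<i> * of_real r * (of_real (\<sigma> powr (- 1 - s)) * cis (r / \<sigma>) * g \<sigma>)) (at \<sigma>)"
proof -
  have 1: "((\<lambda>\<sigma>. complex_of_real (\<sigma> powr (1 - s))) has_vector_derivative of_real ((1 - s) * \<sigma> powr (- s))) (at \<sigma>)"
    using has_real_derivative_powr[OF assms, of "1 - s"]
    by (intro has_vector_derivative_of_real) (simp add: has_real_derivative_iff_has_vector_derivative)
  have "((\<lambda>\<sigma>. r / \<sigma>) has_real_derivative - r / \<sigma>\<^sup>2) (at \<sigma>)"
    using assms by (auto intro!: derivative_eq_intros simp: power2_eq_square)
  note 2 = has_vector_derivative_cis[OF this]
  have p: "\<sigma> powr (1 - s) / \<sigma>\<^sup>2 = \<sigma> powr (- 1 - s)"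
    using assms powr_diff[of \<sigma> "1 - s" 2] by simp
  have "((\<lambda>\<sigma>. of_real (\<sigma> powr (1 - s)) * g \<sigma> * cis (r / \<sigma>)) has_vector_derivative
      of_real (\<sigma> powr (1 - s)) * g \<sigma> * ((- r / \<sigma>\<^sup>2) *\<^sub>R (\<i> * cis (r / \<sigma>))) + amplitude_deriv \<sigma> * cis (r / \<sigma>)) (at \<sigma>)"
    by (rule has_vector_derivative_eq_rhs[OF has_vector_derivative_mult[OF has_vector_derivative_mult[OF 1 deriv] 2]])
      (simp add: amplitude_deriv_def algebra_simps)
  moreover have "of_real (\<sigma> powr (1 - s)) * g \<sigma> * ((- r / \<sigma>\<^sup>2) *\<^sub>R (\<i> * cis (r / \<sigma>))) =
      - (\<i> * of_real r * (of_real (\<sigma> powr (- 1 - s)) * cis (r / \<sigma>) * g \<sigma>))"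
    unfolding p[symmetric] by (simp add: scaleR_conv_of_real field_simps)
  ultimately show ?thesis by simp
qed

lemma mode_lifting_integrable:
  assumes "0 < e"
  shows "set_integrable lborel {e<..} (\<lambda>\<sigma>. of_real (\<sigma> powr (- 1 - s)) * cis (r / \<sigma>) * g \<sigma>)"
proof -
  have "set_integrable lborel {e<..} (\<lambda>\<sigma>. g \<sigma> * (of_real (\<sigma> powr (- 1 - s)) * cis (r / \<sigma>)))"
  proof (rule set_integrable_bounded_factor[OF g_integrable(1)])
    show "cmod (of_real (\<sigma> powr (- 1 - s)) * cis (r / \<sigma>)) \<le> e powr (- 1 - s)" if "\<sigma> \<in> {e<..}" for \<sigma>
      using that assms s powr_mono2'[of "- 1 - s" e \<sigma>] by (simp add: norm_mult)
  qed measurable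
  then show ?thesis by (simp only: mult.commute[of "g _"])
qed

text \<open>As \<open>\<sigma>\<^sup>-\<^sup>1\<^sup>-\<^sup>s = \<sigma>\<^sup>1\<^sup>-\<^sup>s \<sigma>\<^sup>-\<^sup>2\<close> and \<open>- r / \<sigma>\<^sup>2\<close> is the derivative of the phase, parts can be integrated. The new
  integrand is of order \<open>\<sigma>\<^sup>-\<^sup>s\<close> at \<open>0\<close>, which makes the improper integral converge as \<open>e \<rightarrow> 0\<close>.\<close>

lemma mode_lifting_by_parts:
  assumes e: "0 < e" and r: "0 < r"
  shows "mode_lifting e r = - (\<i> / of_real r) *
    (of_real (e powr (1 - s)) * g e * cis (r / e) + (LINT \<sigma>:{e<..}|lborel. amplitude_deriv \<sigma> * cis (r / \<sigma>)))"
proof -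
  note i1 = amplitude_deriv_wave_integrable[OF less_imp_le[OF e], of r]
  note i2 = mode_lifting_integrable[OF e, of r]
  let ?F = "\<lambda>\<sigma>. of_real (\<sigma> powr (1 - s)) * g \<sigma> * cis (r / \<sigma>)"
  have "(LINT \<sigma>:{e<..}|lborel. amplitude_deriv \<sigma> * cis (r / \<sigma>) - \<i> * of_real r * (of_real (\<sigma> powr (- 1 - s)) * cis (r / \<sigma>) * g \<sigma>)) =
      0 - ?F e"
  proof (rule integral_derivative_atLeast)
    show "(?F has_vector_derivative amplitude_deriv \<sigma> * cis (r / \<sigma>) -
        \<i> * of_real r * (of_real (\<sigma> powr (- 1 - s)) * cis (r / \<sigma>) * g \<sigma>)) (at \<sigma>)" if "e < \<sigma>" for \<sigma>
      using that e by (intro has_vector_derivative_wave) auto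
    have cg: "continuous_on {e<..} g" "continuous_on {e<..} g'"
      by (auto intro: continuous_on_subset[OF continuous_g] continuous_on_subset[OF cont'])
    have cp: "continuous_on {e<..} (\<lambda>\<sigma>. \<sigma> powr q)" for q
      using e by (intro continuous_intros) auto
    have cc: "continuous_on {e<..} (\<lambda>\<sigma>. cis (r / \<sigma>))"
      using e by (intro continuous_intros) auto
    show "continuous_on {e<..} (\<lambda>\<sigma>. amplitude_deriv \<sigma> * cis (r / \<sigma>) - \<i> * of_real r * (of_real (\<sigma> powr (- 1 - s)) * cis (r / \<sigma>) * g \<sigma>))"
      unfolding amplitude_deriv_def
      by (intro continuous_on_diff continuous_on_mult continuous_on_add continuous_on_of_real continuous_on_const cg cp cc)
    show "set_integrable lborel {e<..} (\<lambda>\<sigma>. amplitude_deriv \<sigma> * cis (r / \<sigma>) - \<i> * of_real r * (of_real (\<sigma> powr (- 1 - s)) * cis (r / \<sigma>) * g \<sigma>))"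
      by (intro set_integral_diff set_integrable_mult_right i1 i2)
    have "isCont ?F e"
      by (rule has_vector_derivative_continuous[OF has_vector_derivative_wave[OF e]])
    then show "(?F \<longlongrightarrow> ?F e) (at_right e)"
      by (simp add: continuous_within filterlim_at_split)
    show "(?F \<longlongrightarrow> 0) at_top"
    proof (rule Lim_null_comparison)
      show "\<forall>\<^sub>F \<sigma> in at_top. norm (?F \<sigma>) \<le> \<sigma> powr (1 - s) * (A / (1 + \<sigma>\<^sup>2))"
        by (intro always_eventually allI) (use mult_left_mono[OF bound(1) powr_ge_zero] in \<open>simp add: norm_mult\<close>)
      show "((\<lambda>\<sigma>. \<sigma> powr (1 - s) * (A / (1 + \<sigma>\<^sup>2))) \<longlongrightarrow> 0) at_top"
        using s by real_asymp
    qed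
  qed
  then have "\<i> * of_real r * mode_lifting e r = ?F e + (LINT \<sigma>:{e<..}|lborel. amplitude_deriv \<sigma> * cis (r / \<sigma>))"
    unfolding set_integral_diff(2)[OF i1 set_integrable_mult_right[OF i2]] set_integral_mult_right mode_lifting_def[symmetric]
    by (simp add: diff_eq_eq)
  then have "- \<i> * (\<i> * of_real r * mode_lifting e r) = - \<i> * (?F e + (LINT \<sigma>:{e<..}|lborel. amplitude_deriv \<sigma> * cis (r / \<sigma>)))"
    by (simp only:)
  then show ?thesis using r by (simp add: field_simps)
qed

definition mode_lifting_limit :: "real \<Rightarrow> complex" where
  "mode_lifting_limit r = - (\<i> / of_real r) * (LINT \<sigma>:{0<..}|lborel. amplitude_deriv \<sigma> * cis (r / \<sigma>))"

lemma tendsto_set_integral_at_right_0: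
  fixes f :: "real \<Rightarrow> complex"
  assumes f: "set_integrable lborel {0<..} f"
  shows "((\<lambda>e. LINT \<sigma>:{e<..}|lborel. f \<sigma>) \<longlongrightarrow> (LINT \<sigma>:{0<..}|lborel. f \<sigma>)) (at_right 0)"
  unfolding set_lebesgue_integral_def
proof (rule integral_dominated_convergence_within)
  show m: "(\<lambda>\<sigma>. indicator {0<..} \<sigma> *\<^sub>R f \<sigma>) \<in> borel_measurable lborel"
    using f by (simp add: set_integrable_def)
  show "(\<lambda>\<sigma>. indicator {e<..} \<sigma> *\<^sub>R f \<sigma>) \<in> borel_measurable lborel" if "e \<in> {0<..}" for e
  proof -
    have "set_integrable lborel {e<..} f"
      by (rule set_integrable_subset[OF f]) (use that in auto)
    then show ?thesis by (simp add: set_integrable_def)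
  qed
  show "integrable lborel (\<lambda>\<sigma>. norm (indicator {0<..} \<sigma> *\<^sub>R f \<sigma>))"
    using f by (intro integrable_norm) (simp add: set_integrable_def)
  show "AE \<sigma> in lborel. ((\<lambda>e. indicator {e<..} \<sigma> *\<^sub>R f \<sigma>) \<longlongrightarrow> indicator {0<..} \<sigma> *\<^sub>R f \<sigma>) (at_right 0)"
  proof (intro AE_I2 tendsto_eventually)
    fix \<sigma> :: real
    show "\<forall>\<^sub>F e in at_right 0. indicator {e<..} \<sigma> *\<^sub>R f \<sigma> = indicator {0<..} \<sigma> *\<^sub>R f \<sigma>"
    proof (cases "0 < \<sigma>")
      case True
      show ?thesis
        using eventually_at_right_less[of "0::real"] eventually_at_right_real[OF True]
        by eventually_elim auto
    next
      case False
      show ?thesis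
        using eventually_at_right_less[of "0::real"] by eventually_elim (use False in auto)
    qed
  qed
  show "AE \<sigma> in lborel. norm (indicator {e<..} \<sigma> *\<^sub>R f \<sigma>) \<le> norm (indicator {0<..} \<sigma> *\<^sub>R f \<sigma>)"
    if "e \<in> {0<..}" "e \<noteq> 0" for e
    using that by (auto simp: indicator_def)
qed

lemma tendsto_mode_lifting:
  assumes r: "0 < r"
  shows "((\<lambda>e. mode_lifting e r) \<longlongrightarrow> mode_lifting_limit r) (at_right 0)"
proof -
  have "((\<lambda>e. of_real (e powr (1 - s)) * g e * cis (r / e)) \<longlongrightarrow> 0) (at_right 0)"
  proof (rule Lim_null_comparison)
    show "\<forall>\<^sub>F e in at_right 0. norm (of_real (e powr (1 - s)) * g e * cis (r / e)) \<le> e powr (1 - s) * A"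
      using bound_A by (intro always_eventually allI) (simp add: norm_mult mult_left_mono)
    show "((\<lambda>e. e powr (1 - s) * A) \<longlongrightarrow> 0) (at_right 0)"
      using s by real_asymp
  qed
  then have "((\<lambda>e. - (\<i> / of_real r) * (of_real (e powr (1 - s)) * g e * cis (r / e) +
      (LINT \<sigma>:{e<..}|lborel. amplitude_deriv \<sigma> * cis (r / \<sigma>)))) \<longlongrightarrow>
    - (\<i> / of_real r) * (0 + (LINT \<sigma>:{0<..}|lborel. amplitude_deriv \<sigma> * cis (r / \<sigma>)))) (at_right 0)"
    by (intro tendsto_mult_left tendsto_add tendsto_set_integral_at_right_0 amplitude_deriv_wave_integrable) auto
  then show ?thesis
    unfolding mode_lifting_limit_def add_0_left
  proof (rule Lim_transform_eventually)
    show "\<forall>\<^sub>F e in at_right 0. - (\<i> / of_real r) * (of_real (e powr (1 - s)) * g e * cis (r / e) +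
      (LINT \<sigma>:{e<..}|lborel. amplitude_deriv \<sigma> * cis (r / \<sigma>))) = mode_lifting e r"
      using eventually_at_right_less[of "0::real"]
      by eventually_elim (simp only: mode_lifting_by_parts[OF _ r])
  qed
qed

text \<open>Large enough for the bounds by \<open>1 / r\<close> and by \<open>r\<^sup>-\<^sup>s\<close> at the same time.\<close>

definition lifting_const :: real where "lifting_const = 2 + 2 / (1 - s) + 2 / s"

lemma lifting_const_nonneg: "0 \<le> lifting_const"
  using s by (simp add: lifting_const_def)

lemma mode_lifting_bound_inverse:
  assumes e: "0 < e" and r: "0 < r"
  shows "cmod (mode_lifting e r) \<le> lifting_const * A / r"
proof -
  have "cmod (of_real (e powr (1 - s)) * g e * cis (r / e)) \<le> e powr (1 - s) * (A / (1 + e\<^sup>2))"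
    using mult_left_mono[OF bound(1)[of e], of "e powr (1 - s)"] by (simp add: norm_mult)
  also have "\<dots> = A * (e powr (1 - s) / (1 + e\<^sup>2))" by simp
  also have "\<dots> \<le> A * 1"
    using A_nonneg power_times_cauchy_le[OF e s] by (intro mult_left_mono) auto
  finally have "cmod (of_real (e powr (1 - s)) * g e * cis (r / e) + (LINT \<sigma>:{e<..}|lborel. amplitude_deriv \<sigma> * cis (r / \<sigma>))) \<le>
      A + 2 * A * (1 / (1 - s) + 1 / s)"
    using amplitude_deriv_wave_le[OF less_imp_le[OF e], of r]
    by (intro order_trans[OF norm_triangle_ineq]) auto
  also have "\<dots> \<le> lifting_const * A"
    using A_nonneg by (simp add: lifting_const_def algebra_simps)
  finally show ?thesis
    unfolding mode_lifting_by_parts[OF e r] norm_mult using r by (simp add: norm_divide divide_right_mono)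
qed

lemma mode_lifting_tail:
  assumes "0 < e"
  shows "cmod (mode_lifting e r) \<le> A * e powr (- s) / s"
proof -
  have "cmod (mode_lifting e r) \<le> (LINT \<sigma>:{e<..}|lborel. A * \<sigma> powr (- 1 - s))"
    unfolding mode_lifting_def
  proof (rule set_integral_dominated(2))
    show "set_integrable lborel {e<..} (\<lambda>\<sigma>. A * \<sigma> powr (- 1 - s))"
      by (intro set_integrable_mult_right power_integral_at_top(1) s assms)
    show "AE \<sigma> in lborel. \<sigma> \<in> {e<..} \<longrightarrow> cmod (of_real (\<sigma> powr (- 1 - s)) * cis (r / \<sigma>) * g \<sigma>) \<le> A * \<sigma> powr (- 1 - s)"
      using bound_A by (auto simp: norm_mult mult.commute[of A] intro!: mult_left_mono)
  qed measurable
  also have "\<dots> = A * e powr (- s) / s"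
    using power_integral_at_top(2)[OF s(1) assms] by simp
  finally show ?thesis .
qed

text \<open>Near \<open>r = 0\<close> the integral is split at \<open>\<sigma> = r\<close>: beyond \<open>r\<close> the integrand is absolutely integrable, and
  before \<open>r\<close> the phase oscillates and parts are integrated.\<close>

lemma mode_lifting_bound_power:
  assumes e: "0 < e" and r: "0 < r"
  shows "cmod (mode_lifting e r) \<le> lifting_const * A * r powr (- s)"
proof (cases "e < r")
  case False
  then have "e powr (- s) \<le> r powr (- s)" using s r by (intro powr_mono2') auto
  then have "A * e powr (- s) / s \<le> A * r powr (- s) / s"
    using A_nonneg s by (intro divide_right_mono mult_left_mono) auto
  also have "\<dots> = 1 / s * (A * r powr (- s))" by simp
  also have "\<dots> \<le> lifting_const * (A * r powr (- s))"
    using A_nonneg s by (intro mult_right_mono) (auto simp: lifting_const_def add_nonneg_nonneg divide_right_mono add_increasing)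
  finally show ?thesis using mode_lifting_tail[OF e, of r] by (simp add: mult.assoc)
next
  case True
  let ?I = "\<lambda>S. LINT \<sigma>:S|lborel. amplitude_deriv \<sigma> * cis (r / \<sigma>)"
  let ?b = "\<lambda>e. of_real (e powr (1 - s)) * g e * cis (r / e)"
  have i: "set_integrable lborel {e<..} (\<lambda>\<sigma>. amplitude_deriv \<sigma> * cis (r / \<sigma>))"
    using e by (intro amplitude_deriv_wave_integrable) auto
  have "{e<..} = {e<..r} \<union> {r<..}" using True by auto
  then have "?I {e<..} = ?I ({e<..r} \<union> {r<..})" by (simp only:)
  also have "\<dots> = ?I {e<..r} + ?I {r<..}"
    using True by (intro set_integral_Un set_integrable_subset[OF i]) auto
  finally have I: "?I {e<..} = ?I {e<..r} + ?I {r<..}" .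
  have "mode_lifting e r = mode_lifting r r + - (\<i> / of_real r) * (?b e - ?b r + ?I {e<..r})"
    unfolding mode_lifting_by_parts[OF e r] mode_lifting_by_parts[OF r r] I by (simp add: algebra_simps)
  then have 1: "cmod (mode_lifting e r) \<le> cmod (mode_lifting r r) + cmod (?b e - ?b r + ?I {e<..r}) / r"
    using norm_triangle_ineq[of "mode_lifting r r" "- (\<i> / of_real r) * (?b e - ?b r + ?I {e<..r})"] r
    by (simp add: norm_mult norm_divide)
  have b: "cmod (?b x) \<le> A * r powr (1 - s)" if "0 < x" "x \<le> r" for x
  proof -
    have "cmod (?b x) \<le> r powr (1 - s) * A"
      using that s bound_A[of x] A_nonneg unfolding norm_mult norm_cis mult_1_right
      by (intro mult_mono) (auto intro!: powr_mono2)
    then show ?thesis by (simp add: mult.commute)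
  qed
  have "cmod (?I {e<..r}) \<le> (LINT \<sigma>:{e<..r}|lborel. 2 * A * (indicator {0<..<r} \<sigma> * \<sigma> powr (- s)))"
  proof (rule set_integral_dominated(2))
    have "integrable lborel (\<lambda>\<sigma>. 2 * A * (indicator {0<..<r} \<sigma> * \<sigma> powr (- s)))"
      using power_integral_near_0(1)[OF s(2) r] by (intro integrable_mult_right) (simp add: set_integrable_def)
    then show "set_integrable lborel {e<..r} (\<lambda>\<sigma>. 2 * A * (indicator {0<..<r} \<sigma> * \<sigma> powr (- s)))"
      unfolding set_integrable_def by (intro integrable_mult_indicator) auto
    show "AE \<sigma> in lborel. \<sigma> \<in> {e<..r} \<longrightarrow> cmod (amplitude_deriv \<sigma> * cis (r / \<sigma>)) \<le> 2 * A * (indicator {0<..<r} \<sigma> * \<sigma> powr (- s))"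
      using AE_lborel_singleton[of r]
      by eventually_elim (use e amplitude_deriv_bound(1) in \<open>auto simp: norm_mult indicator_def\<close>)
  qed measurable
  also have "\<dots> \<le> (\<integral>\<sigma>. 2 * A * (indicator {0<..<r} \<sigma> * \<sigma> powr (- s)) \<partial>lborel)"
    unfolding set_lebesgue_integral_def
  proof (rule integral_mono')
    show "integrable lborel (\<lambda>\<sigma>. 2 * A * (indicator {0<..<r} \<sigma> * \<sigma> powr (- s)))"
      using power_integral_near_0(1)[OF s(2) r] by (intro integrable_mult_right) (simp add: set_integrable_def)
  qed (use A_nonneg in \<open>auto simp: indicator_def\<close>)
  also have "\<dots> = 2 * A * (r powr (1 - s) / (1 - s))"
    using power_integral_near_0(2)[OF s(2) r] by (simp add: set_lebesgue_integral_def)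
  finally have "cmod (?b e - ?b r + ?I {e<..r}) \<le> A * r powr (1 - s) + A * r powr (1 - s) + 2 * A * (r powr (1 - s) / (1 - s))"
    using b[of e] b[of r] e r True
    by (intro order_trans[OF norm_triangle_ineq] add_mono order_trans[OF norm_triangle_ineq4]) auto
  also have "\<dots> = (2 + 2 / (1 - s)) * A * r powr (- s) * r"
  proof -
    have p: "r powr (1 - s) = r powr (- s) * r"
      using r by (simp add: powr_diff powr_minus field_simps)
    show ?thesis unfolding p by (simp add: algebra_simps)
  qed
  finally have "cmod (?b e - ?b r + ?I {e<..r}) / r \<le> (2 + 2 / (1 - s)) * A * r powr (- s)"
    using r by (simp add: divide_le_eq)
  moreover have "A * r powr (- s) / s \<le> 2 / s * A * r powr (- s)"
    using A_nonneg s by (simp add: divide_right_mono)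
  ultimately show ?thesis
    using 1 mode_lifting_tail[OF r, of r] by (simp add: lifting_const_def algebra_simps)
qed

lemma mode_lifting_limit_bound:
  assumes r: "0 < r"
  shows "cmod (mode_lifting_limit r) \<le> lifting_const * A / r" "cmod (mode_lifting_limit r) \<le> lifting_const * A * r powr (- s)"
proof -
  have lim: "((\<lambda>e. cmod (mode_lifting e r)) \<longlongrightarrow> cmod (mode_lifting_limit r)) (at_right 0)"
    by (intro tendsto_norm tendsto_mode_lifting r)
  show "cmod (mode_lifting_limit r) \<le> lifting_const * A / r"
  proof (rule tendsto_upperbound[OF lim])
    show "\<forall>\<^sub>F e in at_right 0. cmod (mode_lifting e r) \<le> lifting_const * A / r"
      using eventually_at_right_less[of "0::real"] by eventually_elim (rule mode_lifting_bound_inverse[OF _ r])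
  qed simp
  show "cmod (mode_lifting_limit r) \<le> lifting_const * A * r powr (- s)"
  proof (rule tendsto_upperbound[OF lim])
    show "\<forall>\<^sub>F e in at_right 0. cmod (mode_lifting e r) \<le> lifting_const * A * r powr (- s)"
      using eventually_at_right_less[of "0::real"] by eventually_elim (rule mode_lifting_bound_power[OF _ r])
  qed simp
qed

lemma time_transform_bound:
  assumes "0 \<le> e"
  shows "cmod (time_transform e \<omega>) \<le> A * K" "0 < \<omega> \<Longrightarrow> cmod (time_transform e \<omega>) \<le> (1 + K) * A / \<omega>"
proof -
  have iA: "set_integrable lborel {e<..} (\<lambda>\<sigma>. A / (1 + \<sigma>\<^sup>2))"
    unfolding set_integrable_def using integrable_mult_indicator[OF _ integrable_A_cauchy, of "{e<..}"] by simp
  have le: "(LINT \<sigma>:{e<..}|lborel. A / (1 + \<sigma>\<^sup>2)) \<le> A * K"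
  proof -
    have "(LINT \<sigma>:{e<..}|lborel. A / (1 + \<sigma>\<^sup>2)) \<le> (\<integral>\<sigma>. A / (1 + \<sigma>\<^sup>2) \<partial>lborel)"
      unfolding set_lebesgue_integral_def
      by (rule integral_mono'[OF integrable_A_cauchy]) (use A_nonneg in \<open>auto simp: indicator_def\<close>)
    also have "\<dots> = A * K"
      using integral_mult_right_zero[of lborel A "\<lambda>x. 1 / (1 + x\<^sup>2)"] by (simp add: K_def)
    finally show ?thesis .
  qed
  have "cmod (time_transform e \<omega>) \<le> (LINT \<sigma>:{e<..}|lborel. A / (1 + \<sigma>\<^sup>2))"
    unfolding time_transform_def
    by (rule set_integral_dominated(2)[OF _ iA]) (use bound(1) in \<open>auto simp: norm_mult\<close>)
  with le show "cmod (time_transform e \<omega>) \<le> A * K" by linarith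
  assume \<omega>: "0 < \<omega>"
  have i1: "set_integrable lborel {e<..} (\<lambda>\<sigma>. cis (- \<omega> * \<sigma>) * g \<sigma>)"
    by (rule set_integral_dominated(1)[OF _ iA]) (use bound(1) in \<open>auto simp: norm_mult\<close>)
  have i2: "set_integrable lborel {e<..} (\<lambda>\<sigma>. cis (- \<omega> * \<sigma>) * g' \<sigma>)"
    by (rule set_integral_dominated(1)[OF _ iA]) (use bound(2) in \<open>auto simp: norm_mult\<close>)
  have n2: "cmod (LINT \<sigma>:{e<..}|lborel. cis (- \<omega> * \<sigma>) * g' \<sigma>) \<le> A * K"
    by (rule order_trans[OF set_integral_dominated(2)[OF _ iA] le]) (use bound(2) in \<open>auto simp: norm_mult\<close>)
  have d: "((\<lambda>\<sigma>. cis (- \<omega> * \<sigma>) * g \<sigma>) has_vector_derivative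
      cis (- \<omega> * \<sigma>) * g' \<sigma> - \<i> * of_real \<omega> * (cis (- \<omega> * \<sigma>) * g \<sigma>)) (at \<sigma>)" for \<sigma>
  proof -
    have "((\<lambda>\<sigma>. - \<omega> * \<sigma>) has_real_derivative - \<omega>) (at \<sigma>)"
      by (auto intro!: derivative_eq_intros)
    from has_vector_derivative_mult[OF has_vector_derivative_cis[OF this] deriv]
    show ?thesis by (rule has_vector_derivative_eq_rhs) (simp add: scaleR_conv_of_real)
  qed
  have "(LINT \<sigma>:{e<..}|lborel. cis (- \<omega> * \<sigma>) * g' \<sigma> - \<i> * of_real \<omega> * (cis (- \<omega> * \<sigma>) * g \<sigma>)) = 0 - cis (- \<omega> * e) * g e"
  proof (rule integral_derivative_atLeast[OF d])
    show "continuous_on {e<..} (\<lambda>\<sigma>. cis (- \<omega> * \<sigma>) * g' \<sigma> - \<i> * of_real \<omega> * (cis (- \<omega> * \<sigma>) * g \<sigma>))"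
      by (intro continuous_intros continuous_on_subset[OF continuous_g] continuous_on_subset[OF cont']) auto
    show "set_integrable lborel {e<..} (\<lambda>\<sigma>. cis (- \<omega> * \<sigma>) * g' \<sigma> - \<i> * of_real \<omega> * (cis (- \<omega> * \<sigma>) * g \<sigma>))"
      by (intro set_integral_diff set_integrable_mult_right i1 i2)
    have "isCont (\<lambda>\<sigma>. cis (- \<omega> * \<sigma>) * g \<sigma>) e"
      by (rule has_vector_derivative_continuous[OF d])
    then show "((\<lambda>\<sigma>. cis (- \<omega> * \<sigma>) * g \<sigma>) \<longlongrightarrow> cis (- \<omega> * e) * g e) (at_right e)"
      by (simp add: continuous_within filterlim_at_split)
    show "((\<lambda>\<sigma>. cis (- \<omega> * \<sigma>) * g \<sigma>) \<longlongrightarrow> 0) at_top"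
    proof (rule Lim_null_comparison)
      show "\<forall>\<^sub>F \<sigma> in at_top. norm (cis (- \<omega> * \<sigma>) * g \<sigma>) \<le> A / (1 + \<sigma>\<^sup>2)"
        using bound(1) by (intro always_eventually allI) (simp add: norm_mult)
      show "((\<lambda>\<sigma>. A / (1 + \<sigma>\<^sup>2)) \<longlongrightarrow> 0) at_top" by real_asymp
    qed
  qed
  then have "\<i> * of_real \<omega> * time_transform e \<omega> = cis (- \<omega> * e) * g e + (LINT \<sigma>:{e<..}|lborel. cis (- \<omega> * \<sigma>) * g' \<sigma>)"
    unfolding set_integral_diff(2)[OF i2 set_integrable_mult_right[OF i1]] set_integral_mult_right time_transform_def[symmetric]
    by (simp add: diff_eq_eq)
  then have "cmod (\<i> * of_real \<omega> * time_transform e \<omega>) = cmod (cis (- \<omega> * e) * g e + (LINT \<sigma>:{e<..}|lborel. cis (- \<omega> * \<sigma>) * g' \<sigma>))"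
    by (simp only:)
  also have "\<dots> \<le> A + A * K"
    using bound_A[of e] n2 by (intro order_trans[OF norm_triangle_ineq] add_mono) (auto simp: norm_mult)
  finally show "cmod (time_transform e \<omega>) \<le> (1 + K) * A / \<omega>"
    using \<omega> by (simp add: norm_mult field_simps)
qed

lemma tendsto_time_transform: "((\<lambda>e. time_transform e \<omega>) \<longlongrightarrow> time_transform 0 \<omega>) (at_right 0)"
  unfolding time_transform_def
proof (rule tendsto_set_integral_at_right_0)
  have "set_integrable lborel {0<..} (\<lambda>\<sigma>. g \<sigma> * cis (- \<omega> * \<sigma>))"
    by (rule set_integrable_bounded_factor[OF g_integrable(1), where C = 1]) auto
  then show "set_integrable lborel {0<..} (\<lambda>\<sigma>. cis (- \<omega> * \<sigma>) * g \<sigma>)" by (simp only: mult.commute)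
qed

text \<open>The bounds make \<open>x\<^sup>s |F|\<^sup>2\<close> of order \<open>x\<^sup>-\<^sup>s\<close> near \<open>0\<close> and \<open>x\<^sup>s\<^sup>-\<^sup>2\<close> near \<open>\<infinity>\<close>, both integrable since \<open>0 < s < 1\<close>.\<close>

lemma weighted_square_le_power_hat_AE:
  fixes F :: "real \<Rightarrow> complex"
  assumes bound: "\<And>x. 0 < x \<Longrightarrow> x < 1 \<Longrightarrow> cmod (F x) \<le> C * x powr (- s)" "\<And>x. 1 < x \<Longrightarrow> cmod (F x) \<le> C / x"
  shows "AE x in lborel. x \<in> {0<..} \<longrightarrow> x powr s * (cmod (F x))\<^sup>2 \<le> C\<^sup>2 * power_hat s (1 - s) x"
proof (rule le_power_hat_AE)
  fix x :: real assume x: "0 < x" "x < 1"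
  have "(cmod (F x))\<^sup>2 \<le> (C * x powr (- s))\<^sup>2"
    by (intro power_mono bound(1)[OF x]) auto
  then have "x powr s * (cmod (F x))\<^sup>2 \<le> x powr s * (C * x powr (- s))\<^sup>2"
    by (intro mult_left_mono) auto
  also have "\<dots> = C\<^sup>2 * x powr (- s)"
    using x by (simp add: power2_eq_square powr_minus field_simps)
  finally show "x powr s * (cmod (F x))\<^sup>2 \<le> C\<^sup>2 * x powr (- s)" .
next
  fix x :: real assume x: "1 < x"
  have "(cmod (F x))\<^sup>2 \<le> (C / x)\<^sup>2"
    by (intro power_mono bound(2)[OF x]) auto
  then have "x powr s * (cmod (F x))\<^sup>2 \<le> x powr s * (C / x)\<^sup>2"
    by (intro mult_left_mono) auto
  also have "\<dots> = C\<^sup>2 * (x powr s / x powr 2)"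
    using x by (simp add: power_divide)
  also have "x powr s / x powr 2 = x powr (- 1 - (1 - s))"
    using x powr_diff[of x s 2] by simp
  finally show "x powr s * (cmod (F x))\<^sup>2 \<le> C\<^sup>2 * x powr (- 1 - (1 - s))" .
qed

lemma nn_integral_tendsto_dominated:
  fixes H :: "real \<Rightarrow> real \<Rightarrow> complex" and H0 :: "real \<Rightarrow> complex"
  assumes [measurable]: "\<And>e. H e \<in> borel_measurable borel" "H0 \<in> borel_measurable borel"
    and lim: "\<And>x. 0 < x \<Longrightarrow> ((\<lambda>e. H e x) \<longlongrightarrow> H0 x) (at_right 0)"
    and bound: "\<And>e x. 0 < e \<Longrightarrow> 0 < x \<Longrightarrow> x < 1 \<Longrightarrow> cmod (H e x) \<le> C * x powr (- s)"
      "\<And>e x. 0 < e \<Longrightarrow> 1 < x \<Longrightarrow> cmod (H e x) \<le> C / x"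
    and C: "0 \<le> C"
  shows "(\<lambda>n. \<integral>\<^sup>+x\<in>{0<..}. ennreal (x powr s * (cmod (H (1 / real (Suc n)) x))\<^sup>2) \<partial>lborel) \<longlonglongrightarrow>
    (\<integral>\<^sup>+x\<in>{0<..}. ennreal (x powr s * (cmod (H0 x))\<^sup>2) \<partial>lborel)"
proof (rule nn_integral_dominated_convergence)
  have i: "integrable lborel (power_hat s (1 - s))"
    using s by (intro integrable_power_hat) auto
  show "(\<integral>\<^sup>+x. ennreal (C\<^sup>2 * power_hat s (1 - s) x) \<partial>lborel) < \<infinity>"
    using nn_integral_eq_integral[OF integrable_mult_right[OF i, of "C\<^sup>2"]] power_hat_nonneg[of s "1 - s"]
    by simp
  show "AE x in lborel. ennreal (x powr s * (cmod (H (1 / real (Suc n)) x))\<^sup>2) * indicator {0<..} x \<le>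
      ennreal (C\<^sup>2 * power_hat s (1 - s) x)" for n
  proof -
    have e: "0 < 1 / real (Suc n)" by simp
    have "AE x in lborel. x \<in> {0<..} \<longrightarrow> x powr s * (cmod (H (1 / real (Suc n)) x))\<^sup>2 \<le> C\<^sup>2 * power_hat s (1 - s) x"
      by (intro weighted_square_le_power_hat_AE bound e)
    then show ?thesis
      by eventually_elim (auto simp: indicator_def intro!: ennreal_leI)
  qed
  show "AE x in lborel. (\<lambda>n. ennreal (x powr s * (cmod (H (1 / real (Suc n)) x))\<^sup>2) * indicator {0<..} x) \<longlonglongrightarrow>
      ennreal (x powr s * (cmod (H0 x))\<^sup>2) * indicator {0<..} x"
  proof (intro AE_I2)
    fix x :: real
    show "(\<lambda>n. ennreal (x powr s * (cmod (H (1 / real (Suc n)) x))\<^sup>2) * indicator {0<..} x) \<longlonglongrightarrow>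
      ennreal (x powr s * (cmod (H0 x))\<^sup>2) * indicator {0<..} x"
    proof (cases "0 < x")
      case True
      have "filterlim (\<lambda>n. 1 / real (Suc n)) (at_right 0) sequentially"
        using LIMSEQ_Suc[OF lim_const_over_n[of 1]] by (auto simp: filterlim_at simp del: of_nat_Suc)
      then have "(\<lambda>n. H (1 / real (Suc n)) x) \<longlonglongrightarrow> H0 x"
        by (rule filterlim_compose[OF lim[OF True]])
      then have "(\<lambda>n. ennreal (x powr s * (cmod (H (1 / real (Suc n)) x))\<^sup>2)) \<longlonglongrightarrow> ennreal (x powr s * (cmod (H0 x))\<^sup>2)"
        by (intro tendsto_ennrealI tendsto_mult_left tendsto_power tendsto_norm)
      then show ?thesis using True by simp
    qed simp
  qed
qed measurable

lemma mode_lifting_limit_measurable [measurable]: "mode_lifting_limit \<in> borel_measurable borel"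
  unfolding mode_lifting_limit_def set_lebesgue_integral_def by measurable

text \<open>Both sides of the truncated identity converge by domination, uniformly in the truncation.\<close>

lemma mode_identity:
  "(\<integral>\<^sup>+r\<in>{0<..}. ennreal (r powr s * (cmod (mode_lifting_limit r))\<^sup>2) \<partial>lborel) =
    (\<integral>\<^sup>+\<omega>\<in>{0<..}. ennreal (\<omega> powr s * (cmod (time_transform 0 \<omega>))\<^sup>2) \<partial>lborel)"
proof (rule LIMSEQ_unique)
  show "(\<lambda>n. \<integral>\<^sup>+r\<in>{0<..}. ennreal (r powr s * (cmod (mode_lifting (1 / real (Suc n)) r))\<^sup>2) \<partial>lborel) \<longlonglongrightarrow>
      (\<integral>\<^sup>+r\<in>{0<..}. ennreal (r powr s * (cmod (mode_lifting_limit r))\<^sup>2) \<partial>lborel)"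
    by (rule nn_integral_tendsto_dominated[where C = "lifting_const * A"])
      (auto intro: tendsto_mode_lifting mode_lifting_bound_power mode_lifting_bound_inverse mult_nonneg_nonneg lifting_const_nonneg A_nonneg)
  have "(\<lambda>n. \<integral>\<^sup>+\<omega>\<in>{0<..}. ennreal (\<omega> powr s * (cmod (time_transform (1 / real (Suc n)) \<omega>))\<^sup>2) \<partial>lborel) \<longlonglongrightarrow>
      (\<integral>\<^sup>+\<omega>\<in>{0<..}. ennreal (\<omega> powr s * (cmod (time_transform 0 \<omega>))\<^sup>2) \<partial>lborel)"
  proof (rule nn_integral_tendsto_dominated[where C = "(1 + K) * A"])
    fix e \<omega> :: real assume e: "0 < e" and \<omega>: "0 < \<omega>" "\<omega> < 1"
    have "cmod (time_transform e \<omega>) \<le> A * K"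
      using time_transform_bound(1) e by simp
    also have "\<dots> \<le> (1 + K) * A * 1" using A_nonneg by (simp add: algebra_simps)
    also have "\<dots> \<le> (1 + K) * A * \<omega> powr (- s)"
    proof (rule mult_left_mono)
      have "\<omega> powr s \<le> 1 powr s" using s \<omega> by (intro powr_mono2) auto
      then show "1 \<le> \<omega> powr (- s)" using \<omega> by (simp add: powr_minus one_le_inverse_iff)
    qed (use A_nonneg K_nonneg in simp)
    finally show "cmod (time_transform e \<omega>) \<le> (1 + K) * A * \<omega> powr (- s)" .
  qed (use A_nonneg K_nonneg time_transform_bound(2) tendsto_time_transform in auto)
  then show "(\<lambda>n. \<integral>\<^sup>+r\<in>{0<..}. ennreal (r powr s * (cmod (mode_lifting (1 / real (Suc n)) r))\<^sup>2) \<partial>lborel) \<longlonglongrightarrow>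
      (\<integral>\<^sup>+\<omega>\<in>{0<..}. ennreal (\<omega> powr s * (cmod (time_transform 0 \<omega>))\<^sup>2) \<partial>lborel)"
    by (subst truncated_identity) auto
qed

lemma mode_lifting_limit_square_bound:
  "(\<integral>\<^sup>+r\<in>{0<..}. ennreal (r powr s * (cmod (mode_lifting_limit r))\<^sup>2) \<partial>lborel) \<le>
    ennreal ((lifting_const * A)\<^sup>2 * (1 / (1 - s) + 1 / (1 - s)))"
proof -
  let ?C = "lifting_const * A"
  have i: "integrable lborel (power_hat s (1 - s))"
    using s by (intro integrable_power_hat) auto
  have "AE x in lborel. x \<in> {0<..} \<longrightarrow> x powr s * (cmod (mode_lifting_limit x))\<^sup>2 \<le> ?C\<^sup>2 * power_hat s (1 - s) x"
    by (intro weighted_square_le_power_hat_AE mode_lifting_limit_bound) auto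
  then have "(\<integral>\<^sup>+r\<in>{0<..}. ennreal (r powr s * (cmod (mode_lifting_limit r))\<^sup>2) \<partial>lborel) \<le>
      (\<integral>\<^sup>+x. ennreal (?C\<^sup>2 * power_hat s (1 - s) x) \<partial>lborel)"
    by (intro nn_integral_mono_AE) (auto elim!: eventually_mono simp: indicator_def intro!: ennreal_leI)
  also have "\<dots> = ennreal (?C\<^sup>2 * (1 / (1 - s) + 1 / (1 - s)))"
    using i s power_hat_nonneg[of s "1 - s"] by (subst nn_integral_eq_integral) (auto simp: integral_power_hat)
  finally show ?thesis .
qed

end

section \<open>The Poisson lifting in Fourier variables\<close>

text \<open>The substitution \<open>r = z\<^sup>2 / 4\<close> on bounded intervals, followed by monotone convergence.\<close>

lemma nn_integral_quadratic_substitution: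
  fixes H :: "real \<Rightarrow> real" and s :: real
  assumes [measurable]: "H \<in> borel_measurable borel" and H: "\<And>r. 0 \<le> H r"
  shows "(\<integral>\<^sup>+z\<in>{0<..}. ennreal (z powr (1 + 2 * s) * H (z\<^sup>2 / 4)) \<partial>lborel) =
    ennreal (2 powr (1 + 2 * s)) * (\<integral>\<^sup>+r\<in>{0<..}. ennreal (r powr s * H r) \<partial>lborel)"
proof (rule LIMSEQ_unique)
  define f where "f r = 2 powr (1 + 2 * s) * (indicator {0<..} r * (r powr s * H r))" for r
  have [measurable]: "f \<in> borel_measurable borel" unfolding f_def by measurable
  have f0: "0 \<le> f r" for r using H by (simp add: f_def)
  have sub: "(\<integral>\<^sup>+r. ennreal (f r * indicator {0..(real n)\<^sup>2 / 4} r) \<partial>lborel) =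
      (\<integral>\<^sup>+z. ennreal (f (z\<^sup>2 / 4) * (z / 2) * indicator {0..real n} z) \<partial>lborel)" for n
  proof -
    have "(\<integral>\<^sup>+r. ennreal (f r * indicator {0\<^sup>2 / 4..(real n)\<^sup>2 / 4} r) \<partial>lborel) =
        (\<integral>\<^sup>+z. ennreal (f (z\<^sup>2 / 4) * (z / 2) * indicator {0..real n} z) \<partial>lborel)"
    proof (rule nn_integral_substitution)
      show "((\<lambda>z. z\<^sup>2 / 4) has_real_derivative z / 2) (at z)" for z :: real
        by (auto intro!: derivative_eq_intros)
      show "continuous_on {0..real n} (\<lambda>z. z / 2)" by (intro continuous_intros) auto
    qed (auto simp: set_borel_measurable_def)
    then show ?thesis by simp
  qed
  have fz: "f (z\<^sup>2 / 4) * (z / 2) = z powr (1 + 2 * s) * H (z\<^sup>2 / 4)" if z: "0 < z" for z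
  proof -
    have "(z\<^sup>2 / 4) powr s = z powr (2 * s) / 2 powr (2 * s)"
    proof -
      have "z\<^sup>2 / 4 = (z / 2) powr 2" using z by (simp add: power_divide)
      then show ?thesis using z by (simp only: powr_powr) (simp add: powr_divide mult.commute)
    qed
    then show ?thesis
      using z by (simp add: f_def powr_add)
  qed
  have "(\<lambda>n. \<integral>\<^sup>+r. ennreal (f r * indicator {0..(real n)\<^sup>2 / 4} r) \<partial>lborel) \<longlonglongrightarrow> (\<integral>\<^sup>+r. ennreal (f r) \<partial>lborel)"
  proof (rule nn_integral_LIMSEQ)
    show "incseq (\<lambda>n r. ennreal (f r * indicator {0..(real n)\<^sup>2 / 4} r))"
    proof (intro incseq_SucI le_funI ennreal_leI mult_left_mono f0)
      fix n and r :: real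
      have mono: "indicat_real {0..c} r \<le> indicator {0..d} r" if "c \<le> d" for c d :: real
        using that by (auto simp: indicator_def)
      show "indicat_real {0..(real n)\<^sup>2 / 4} r \<le> indicator {0..(real (Suc n))\<^sup>2 / 4} r"
        by (intro mono divide_right_mono power_mono) auto
    qed
    show "(\<lambda>n. ennreal (f r * indicator {0..(real n)\<^sup>2 / 4} r)) \<longlonglongrightarrow> ennreal (f r)" for r
    proof (rule tendsto_eventually)
      have "filterlim (\<lambda>n. (real n)\<^sup>2 / 4) at_top sequentially" by real_asymp
      then have "\<forall>\<^sub>F n in sequentially. r \<le> (real n)\<^sup>2 / 4" by (simp add: filterlim_at_top)
      then show "\<forall>\<^sub>F n in sequentially. ennreal (f r * indicator {0..(real n)\<^sup>2 / 4} r) = ennreal (f r)"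
        by eventually_elim (auto simp: f_def indicator_def)
    qed
  qed measurable
  also have "(\<integral>\<^sup>+r. ennreal (f r) \<partial>lborel) = ennreal (2 powr (1 + 2 * s)) * (\<integral>\<^sup>+r\<in>{0<..}. ennreal (r powr s * H r) \<partial>lborel)"
  proof -
    have "ennreal (f r) = ennreal (2 powr (1 + 2 * s)) * (ennreal (r powr s * H r) * indicator {0<..} r)" for r
      using H by (auto simp: f_def indicator_def ennreal_mult)
    then show ?thesis by (simp add: nn_integral_cmult)
  qed
  finally show "(\<lambda>n. \<integral>\<^sup>+r. ennreal (f r * indicator {0..(real n)\<^sup>2 / 4} r) \<partial>lborel) \<longlonglongrightarrow>
    ennreal (2 powr (1 + 2 * s)) * (\<integral>\<^sup>+r\<in>{0<..}. ennreal (r powr s * H r) \<partial>lborel)" .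
  show "(\<lambda>n. \<integral>\<^sup>+r. ennreal (f r * indicator {0..(real n)\<^sup>2 / 4} r) \<partial>lborel) \<longlonglongrightarrow>
    (\<integral>\<^sup>+z\<in>{0<..}. ennreal (z powr (1 + 2 * s) * H (z\<^sup>2 / 4)) \<partial>lborel)"
    unfolding sub
  proof (rule nn_integral_LIMSEQ)
    show "incseq (\<lambda>n z. ennreal (f (z\<^sup>2 / 4) * (z / 2) * indicator {0..real n} z))"
      using f0 by (intro incseq_SucI le_funI ennreal_leI) (auto simp: indicator_def)
    show "(\<lambda>n. ennreal (f (z\<^sup>2 / 4) * (z / 2) * indicator {0..real n} z)) \<longlonglongrightarrow>
        ennreal (z powr (1 + 2 * s) * H (z\<^sup>2 / 4)) * indicator {0<..} z" for z
    proof (rule tendsto_eventually)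
      have "\<forall>\<^sub>F n in sequentially. z \<le> real n"
        using filterlim_real_sequentially by (simp add: filterlim_at_top)
      then show "\<forall>\<^sub>F n in sequentially. ennreal (f (z\<^sup>2 / 4) * (z / 2) * indicator {0..real n} z) =
          ennreal (z powr (1 + 2 * s) * H (z\<^sup>2 / 4)) * indicator {0<..} z"
      proof eventually_elim
        case (elim n)
        then show ?case
        proof (cases "0 < z")
          case True
          with elim have "z \<in> {0..real n}" "z \<in> {0<..}" by auto
          then show ?thesis by (simp only: indicator_simps fz[OF True] mult_1_right)
        next
          case False
          then show ?thesis by (auto simp: indicator_def f_def)
        qed
      qed
    qed
  qed measurable
qed

text \<open>A Schwartz function \<open>\<phi>\<close> that extends a history, together with the function \<open>\<psi>\<close> whose modes are the time
  derivatives of those of \<open>\<phi>\<close>, and a common constant for the decay of both.\<close>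

locale schwartz_history =
  fixes s :: real and \<phi> \<psi> :: "(real ^ 'd) \<times> real \<Rightarrow> complex" and C :: real
  assumes s: "0 < s" "s < 1"
    and \<phi>: "\<phi> \<in> schwartz" and \<psi>: "\<psi> \<in> schwartz" and C: "0 \<le> C"
    and mode_deriv: "\<And>\<xi> \<sigma>. (mode \<phi> \<xi> has_vector_derivative mode \<psi> \<xi> \<sigma>) (at \<sigma>)"
    and mode_bound: "\<And>\<xi> \<sigma>. cmod (mode \<phi> \<xi> \<sigma>) \<le> C * weight \<xi> / (1 + \<sigma>\<^sup>2)"
      "\<And>\<xi> \<sigma>. cmod (mode \<psi> \<xi> \<sigma>) \<le> C * weight \<xi> / (1 + \<sigma>\<^sup>2)"
begin

sublocale P: mode_profile s "mode \<phi> \<xi>" "mode \<psi> \<xi>" "C * weight \<xi>" for \<xi>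
  using s mode_deriv mode_bound continuous_mode_time[OF \<psi>] by unfold_locales auto

definition history :: "(real ^ 'd) \<times> real \<Rightarrow> complex" where
  "history X = (if snd X \<le> 0 then \<phi> X else 0)"

lemma mode_measurable [measurable]:
  "(\<lambda>(\<xi>, \<sigma>). mode \<phi> \<xi> \<sigma>) \<in> borel_measurable (borel \<Otimes>\<^sub>M borel)"
  "(\<lambda>(\<xi>, \<sigma>). mode \<psi> \<xi> \<sigma>) \<in> borel_measurable (borel \<Otimes>\<^sub>M borel)"
  by (rule borel_measurable_mode[OF \<phi>], rule borel_measurable_mode[OF \<psi>])

lemma G_fun_history: "G_fun history \<xi> \<omega> = P.time_transform \<xi> 0 \<omega>"
  unfolding G_fun_def P.time_transform_def set_lebesgue_integral_def
proof (intro Bochner_Integration.integral_cong refl)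
  fix \<sigma> :: real
  show "cis (- \<omega> * \<sigma>) * g_fun history \<xi> \<sigma> = indicator {0<..} \<sigma> *\<^sub>R (cis (- \<omega> * \<sigma>) * mode \<phi> \<xi> \<sigma>)"
    by (cases "0 < \<sigma>") (simp_all add: g_fun_def mode_def fourier_space_def history_def)
qed

text \<open>The factor of the Poisson kernel that depends neither on \<open>z\<close> nor on \<open>\<sigma>\<close>; its modulus
  combines with the substitution \<open>r = z\<^sup>2 / 4\<close> to the constant of the quadratic form.\<close>

definition poisson_const :: complex where
  "poisson_const = cis (- (s * pi / 2)) / of_real (2 powr (2 * s) * Gamma s)"

lemma poisson_kernel_eq:
  assumes "0 < \<sigma>"
  shows "poisson_kernel (1 - 2 * s) z \<sigma> =
    poisson_const * of_real (z powr (2 * s)) * (of_real (\<sigma> powr (- 1 - s)) * cis (z\<^sup>2 / 4 / \<sigma>))"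
proof -
  have "(1 - 2 * s - 1) * pi / 4 = - (s * pi / 2)" "1 - (1 - 2 * s) = 2 * s" "(1 - (1 - 2 * s)) / 2 = s"
    "(3 - (1 - 2 * s)) / 2 = 1 + s" "z\<^sup>2 / (4 * \<sigma>) = z\<^sup>2 / 4 / \<sigma>"
    by (simp_all add: field_simps)
  moreover have "\<sigma> powr (- 1 - s) = 1 / \<sigma> powr (1 + s)"
    using assms powr_minus_divide[of \<sigma> "1 + s"] by simp
  ultimately show ?thesis
    unfolding poisson_kernel_def poisson_const_def by (simp only:) simp
qed

lemma norm_poisson_const_sq: "(cmod poisson_const)\<^sup>2 * 2 powr (1 + 2 * s) = 2 powr (1 - 2 * s) / (Gamma s)\<^sup>2"
proof -
  have "(cmod poisson_const)\<^sup>2 = 1 / ((2 powr (2 * s))\<^sup>2 * (Gamma s)\<^sup>2)"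
    by (simp add: poisson_const_def norm_divide norm_mult power_divide power_mult_distrib)
  also have "(2 powr (2 * s))\<^sup>2 = 2 powr (4 * s)"
    by (simp add: power2_eq_square powr_add[symmetric])
  finally have "(cmod poisson_const)\<^sup>2 * 2 powr (1 + 2 * s) = (2 powr (1 + 2 * s) / 2 powr (4 * s)) / (Gamma s)\<^sup>2"
    by simp
  also have "2 powr (1 + 2 * s) / 2 powr (4 * s) = 2 powr (1 - 2 * s)"
    by (simp add: powr_diff[symmetric])
  finally show ?thesis .
qed

lemma integrable_poisson_integrand:
  assumes "0 < \<sigma>"
  shows "integrable lborel (poisson_integrand s history x z \<sigma>)"
proof -
  let ?k = "poisson_kernel (1 - 2 * s) z \<sigma> * (4 * of_real pi * \<i> * of_real \<sigma>) powr (- of_nat CARD('d) / 2)"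
  have [measurable]: "\<phi> \<in> borel_measurable borel" by (rule borel_measurable_schwartz[OF \<phi>])
  have "integrable lborel (\<lambda>y. cis ((norm (x - y))\<^sup>2 / (4 * \<sigma>)) * \<phi> (y, - \<sigma>))"
    by (rule Bochner_Integration.integrable_bound[OF integrable_norm[OF integrable_schwartz_slice[OF \<phi>, of "- \<sigma>"]]])
      (auto simp: norm_mult)
  then have "integrable lborel (\<lambda>y. ?k * (cis ((norm (x - y))\<^sup>2 / (4 * \<sigma>)) * \<phi> (y, - \<sigma>)))"
    by (rule integrable_mult_right)
  moreover have "poisson_integrand s history x z \<sigma> = (\<lambda>y. ?k * (cis ((norm (x - y))\<^sup>2 / (4 * \<sigma>)) * \<phi> (y, - \<sigma>)))"
    using assms by (auto simp: poisson_integrand_def schrodinger_kernel_def history_def ac_simps)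
  ultimately show ?thesis by simp
qed

lemma integral_poisson_integrand:
  assumes \<sigma>: "0 < \<sigma>"
  shows "(\<integral>y. poisson_integrand s history x z \<sigma> y \<partial>lborel) =
    poisson_kernel (1 - 2 * s) z \<sigma> * (\<integral>\<xi>. cis (2 * pi * (x \<bullet> \<xi>)) * mode \<phi> \<xi> \<sigma> \<partial>lborel)"
proof -
  obtain D where D: "0 \<le> D" "\<And>\<xi> t. cmod (fourier_space \<phi> \<xi> t) \<le> D * weight \<xi> / (1 + t\<^sup>2)"
    using fourier_space_decay[OF \<phi>] by blast
  have [measurable]: "(\<lambda>\<xi>. fourier_space \<phi> \<xi> (- \<sigma>)) \<in> borel_measurable borel"
    by (intro borel_measurable_continuous_onI continuous_fourier_space[OF \<phi>])
  have "integrable lborel (\<lambda>\<xi>. fourier_space \<phi> \<xi> (- \<sigma>))"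
  proof (rule Bochner_Integration.integrable_bound)
    show "integrable lborel (\<lambda>\<xi>. D / (1 + \<sigma>\<^sup>2) * weight (\<xi> :: real ^ 'd))"
      by (intro integrable_mult_right integrable_weight)
    show "AE \<xi> in lborel. norm (fourier_space \<phi> \<xi> (- \<sigma>)) \<le> norm (D / (1 + \<sigma>\<^sup>2) * weight \<xi>)"
      using D(2)[of _ "- \<sigma>"] D(1) by (intro AE_I2) (simp add: abs_mult abs_of_pos[OF weight_pos])
  qed measurable
  then have fh: "integrable lborel (\<lambda>\<xi>. \<integral>y. cis (- 2 * pi * (\<xi> \<bullet> y)) * \<phi> (y, - \<sigma>) \<partial>lborel)"
    by (simp only: fourier_space_def)
  have "poisson_integrand s history x z \<sigma> y = poisson_kernel (1 - 2 * s) z \<sigma> *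
      ((4 * of_real pi * \<i> * of_real \<sigma>) powr (- of_nat DIM(real ^ 'd) / 2) * cis ((norm (x - y))\<^sup>2 / (4 * \<sigma>)) * \<phi> (y, - \<sigma>))" for y
    using \<sigma> by (simp add: poisson_integrand_def schrodinger_kernel_def history_def)
  then have "(\<integral>y. poisson_integrand s history x z \<sigma> y \<partial>lborel) = poisson_kernel (1 - 2 * s) z \<sigma> *
      (\<integral>y. (4 * of_real pi * \<i> * of_real \<sigma>) powr (- of_nat DIM(real ^ 'd) / 2) * cis ((norm (x - y))\<^sup>2 / (4 * \<sigma>)) * \<phi> (y, - \<sigma>) \<partial>lborel)"
    by (simp only: integral_mult_right_zero)
  also have "\<dots> = poisson_kernel (1 - 2 * s) z \<sigma> * (\<integral>\<xi>. cis (2 * pi * (x \<bullet> \<xi>)) * mode \<phi> \<xi> \<sigma> \<partial>lborel)"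
    unfolding schrodinger_kernel_fourier[OF integrable_schwartz_slice[OF \<phi>] fh \<sigma>]
    by (simp only: mode_def fourier_space_def)
  finally show ?thesis .
qed

text \<open>The cutoff makes the singular power of \<open>\<sigma>\<close> bounded, so that the integrals over frequency and time can be
  exchanged.\<close>

lemma integrable_space_time:
  assumes e: "0 < e"
  shows "integrable (lborel \<Otimes>\<^sub>M lborel) (\<lambda>(\<xi>, \<sigma>). cis (2 * pi * (x \<bullet> \<xi>)) *
    (indicator {e<..} \<sigma> *\<^sub>R (of_real (\<sigma> powr (- 1 - s)) * cis (r / \<sigma>) * mode \<phi> \<xi> \<sigma>)))"
proof (rule Bochner_Integration.integrable_bound)
  show "integrable (lborel \<Otimes>\<^sub>M lborel) (\<lambda>(\<xi> :: real ^ 'd, \<sigma> :: real). e powr (- 1 - s) * C * weight \<xi> * (1 / (1 + \<sigma>\<^sup>2)))"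
  proof (rule lborel_pair.Fubini_integrable)
    have "(\<integral>\<sigma>. norm (e powr (- 1 - s) * C * weight \<xi> * (1 / (1 + \<sigma>\<^sup>2))) \<partial>(lborel :: real measure)) =
        e powr (- 1 - s) * C * P.K * weight \<xi>" for \<xi> :: "real ^ 'd"
    proof -
      have "norm (e powr (- 1 - s) * C * weight \<xi> * (1 / (1 + \<sigma>\<^sup>2))) = e powr (- 1 - s) * C * weight \<xi> * (1 / (1 + \<sigma>\<^sup>2))" for \<sigma> :: real
        using C weight_pos[of \<xi>] by (simp add: abs_mult abs_of_pos[OF weight_pos])
      then show ?thesis by (simp only: integral_mult_right_zero P.K_def) simp
    qed
    then show "integrable lborel (\<lambda>\<xi>. \<integral>\<sigma>. norm (case (\<xi> :: real ^ 'd, \<sigma> :: real) of (\<xi>, \<sigma>) \<Rightarrow> e powr (- 1 - s) * C * weight \<xi> * (1 / (1 + \<sigma>\<^sup>2))) \<partial>lborel)"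
      by (simp only: prod.case) (intro integrable_mult_right integrable_weight)
    show "AE \<xi> in lborel. integrable lborel (\<lambda>\<sigma>. case (\<xi> :: real ^ 'd, \<sigma> :: real) of (\<xi>, \<sigma>) \<Rightarrow> e powr (- 1 - s) * C * weight \<xi> * (1 / (1 + \<sigma>\<^sup>2)))"
      by (simp only: prod.case) (intro AE_I2 integrable_mult_right integrable_inverse_1_plus_sq)
  qed measurable
  show "(\<lambda>(\<xi>, \<sigma>). cis (2 * pi * (x \<bullet> \<xi>)) *
    (indicator {e<..} \<sigma> *\<^sub>R (of_real (\<sigma> powr (- 1 - s)) * cis (r / \<sigma>) * mode \<phi> \<xi> \<sigma>))) \<in> borel_measurable (lborel \<Otimes>\<^sub>M lborel)"
    by measurable
  show "AE p in lborel \<Otimes>\<^sub>M lborel. norm (case p of (\<xi>, \<sigma>) \<Rightarrow> cis (2 * pi * (x \<bullet> \<xi>)) *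
    (indicator {e<..} \<sigma> *\<^sub>R (of_real (\<sigma> powr (- 1 - s)) * cis (r / \<sigma>) * mode \<phi> \<xi> \<sigma>))) \<le>
      norm (case p of (\<xi>, \<sigma>) \<Rightarrow> e powr (- 1 - s) * C * weight \<xi> * (1 / (1 + \<sigma>\<^sup>2)))"
  proof (rule AE_I2, clarify)
    fix \<xi> :: "real ^ 'd" and \<sigma> :: real
    have w: "\<bar>weight \<xi>\<bar> = weight \<xi>" using weight_pos[of \<xi>] by simp
    show "norm (cis (2 * pi * (x \<bullet> \<xi>)) *
      (indicator {e<..} \<sigma> *\<^sub>R (of_real (\<sigma> powr (- 1 - s)) * cis (r / \<sigma>) * mode \<phi> \<xi> \<sigma>))) \<le>
      norm (e powr (- 1 - s) * C * weight \<xi> * (1 / (1 + \<sigma>\<^sup>2)))"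
    proof (cases "e < \<sigma>")
      case True
      then have "\<sigma> powr (- 1 - s) \<le> e powr (- 1 - s)" using e s by (intro powr_mono2') auto
      then have "\<sigma> powr (- 1 - s) * cmod (mode \<phi> \<xi> \<sigma>) \<le> e powr (- 1 - s) * (C * weight \<xi> / (1 + \<sigma>\<^sup>2))"
        by (intro mult_mono mode_bound) auto
      with w C True show ?thesis by (simp add: norm_mult mult.assoc abs_mult)
    qed simp
  qed
qed

lemma truncated_integrand_eq:
  assumes e: "0 < e"
  shows "indicator {e<..} \<sigma> *\<^sub>R (\<integral>y. poisson_integrand s history x z \<sigma> y \<partial>lborel) =
    poisson_const * of_real (z powr (2 * s)) * (\<integral>\<xi>. cis (2 * pi * (x \<bullet> \<xi>)) *
      (indicator {e<..} \<sigma> *\<^sub>R (of_real (\<sigma> powr (- 1 - s)) * cis (z\<^sup>2 / 4 / \<sigma>) * mode \<phi> \<xi> \<sigma>)) \<partial>lborel)"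
proof (cases "e < \<sigma>")
  case True
  with e have \<sigma>: "0 < \<sigma>" by simp
  have "(\<integral>\<xi>. cis (2 * pi * (x \<bullet> \<xi>)) *
      (indicator {e<..} \<sigma> *\<^sub>R (of_real (\<sigma> powr (- 1 - s)) * cis (z\<^sup>2 / 4 / \<sigma>) * mode \<phi> \<xi> \<sigma>)) \<partial>lborel) =
    of_real (\<sigma> powr (- 1 - s)) * cis (z\<^sup>2 / 4 / \<sigma>) * (\<integral>\<xi>. cis (2 * pi * (x \<bullet> \<xi>)) * mode \<phi> \<xi> \<sigma> \<partial>lborel)"
    unfolding integral_mult_right_zero[symmetric]
    using True by (intro Bochner_Integration.integral_cong refl) (simp add: ac_simps)
  then show ?thesis
    using True by (simp only: integral_poisson_integrand[OF \<sigma>] poisson_kernel_eq[OF \<sigma>]) (simp add: ac_simps)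
qed simp

lemma truncated_poisson_lifting_eq:
  assumes e: "0 < e"
  shows "set_integrable lborel {e<..} (\<lambda>\<sigma>. \<integral>y. poisson_integrand s history x z \<sigma> y \<partial>lborel)"
    "truncated_poisson_lifting s history x z e = poisson_const * of_real (z powr (2 * s)) *
      (\<integral>\<xi>. cis (2 * pi * (x \<bullet> \<xi>)) * P.mode_lifting \<xi> e (z\<^sup>2 / 4) \<partial>lborel)"
proof -
  let ?f = "\<lambda>\<xi> \<sigma>. cis (2 * pi * (x \<bullet> \<xi>)) *
      (indicator {e<..} \<sigma> *\<^sub>R (of_real (\<sigma> powr (- 1 - s)) * cis (z\<^sup>2 / 4 / \<sigma>) * mode \<phi> \<xi> \<sigma>))"
  note int = integrable_space_time[OF e, of x "z\<^sup>2 / 4"]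
  show "set_integrable lborel {e<..} (\<lambda>\<sigma>. \<integral>y. poisson_integrand s history x z \<sigma> y \<partial>lborel)"
    unfolding set_integrable_def truncated_integrand_eq[OF e]
    by (intro integrable_mult_right lborel_pair.integrable_snd int)
  have "truncated_poisson_lifting s history x z e =
      poisson_const * of_real (z powr (2 * s)) * (\<integral>\<sigma>. (\<integral>\<xi>. ?f \<xi> \<sigma> \<partial>lborel) \<partial>lborel)"
    unfolding truncated_poisson_lifting_def set_lebesgue_integral_def truncated_integrand_eq[OF e]
    by (rule integral_mult_right_zero)
  also have "(\<integral>\<sigma>. (\<integral>\<xi>. ?f \<xi> \<sigma> \<partial>lborel) \<partial>lborel) = (\<integral>\<xi>. (\<integral>\<sigma>. ?f \<xi> \<sigma> \<partial>lborel) \<partial>lborel)"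
    by (rule lborel_pair.Fubini_integral[OF int])
  also have "\<dots> = (\<integral>\<xi>. cis (2 * pi * (x \<bullet> \<xi>)) * P.mode_lifting \<xi> e (z\<^sup>2 / 4) \<partial>lborel)"
    unfolding P.mode_lifting_def set_lebesgue_integral_def by (simp only: integral_mult_right_zero)
  finally show "truncated_poisson_lifting s history x z e = poisson_const * of_real (z powr (2 * s)) *
      (\<integral>\<xi>. cis (2 * pi * (x \<bullet> \<xi>)) * P.mode_lifting \<xi> e (z\<^sup>2 / 4) \<partial>lborel)" .
qed

lemma mode_lifting_frequency_measurable [measurable]: "(\<lambda>\<xi>. P.mode_lifting \<xi> e r) \<in> borel_measurable borel"
  unfolding P.mode_lifting_def set_lebesgue_integral_def by measurable

lemma mode_lifting_limit_joint_measurable [measurable]: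
  "(\<lambda>(\<xi>, r). P.mode_lifting_limit \<xi> r) \<in> borel_measurable (borel \<Otimes>\<^sub>M borel)"
  unfolding P.mode_lifting_limit_def P.amplitude_deriv_def set_lebesgue_integral_def by measurable

definition lifting :: "real ^ 'd \<Rightarrow> real \<Rightarrow> complex" where
  "lifting x z = poisson_const * of_real (z powr (2 * s)) *
      (\<integral>\<xi>. cis (2 * pi * (x \<bullet> \<xi>)) * P.mode_lifting_limit \<xi> (z\<^sup>2 / 4) \<partial>lborel)"

lemma lifting_measurable [measurable (raw)]:
  assumes "f \<in> M \<rightarrow>\<^sub>M borel" "g \<in> M \<rightarrow>\<^sub>M borel"
  shows "(\<lambda>w. lifting (f w) (g w)) \<in> borel_measurable M"
proof -
  have "(\<lambda>(x, z). lifting x z) \<in> borel_measurable (borel \<Otimes>\<^sub>M borel)"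
    unfolding lifting_def by measurable
  from measurable_compose[OF measurable_Pair[OF assms] this] show ?thesis by simp
qed

text \<open>For fixed \<open>z\<close> the bound by \<open>1 / r\<close> is uniform in the cutoff and carries the weight in \<open>\<xi>\<close>, which dominates
  the integral over all frequencies.\<close>

lemma tendsto_truncated_poisson_lifting:
  assumes z: "0 < z"
  shows "(truncated_poisson_lifting s history x z \<longlongrightarrow> lifting x z) (at_right 0)"
proof -
  have r: "0 < z\<^sup>2 / 4" using z by simp
  have "((\<lambda>e. \<integral>\<xi>. cis (2 * pi * (x \<bullet> \<xi>)) * P.mode_lifting \<xi> e (z\<^sup>2 / 4) \<partial>lborel) \<longlongrightarrow>
      (\<integral>\<xi>. cis (2 * pi * (x \<bullet> \<xi>)) * P.mode_lifting_limit \<xi> (z\<^sup>2 / 4) \<partial>lborel)) (at_right 0)"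
  proof (rule integral_dominated_convergence_within)
    show "integrable lborel (\<lambda>\<xi>. P.lifting_const / (z\<^sup>2 / 4) * C * weight (\<xi> :: real ^ 'd))"
      by (intro integrable_mult_right integrable_weight)
    show "AE \<xi> in lborel. ((\<lambda>e. cis (2 * pi * (x \<bullet> \<xi>)) * P.mode_lifting \<xi> e (z\<^sup>2 / 4)) \<longlongrightarrow>
        cis (2 * pi * (x \<bullet> \<xi>)) * P.mode_lifting_limit \<xi> (z\<^sup>2 / 4)) (at_right 0)"
      by (intro AE_I2 tendsto_mult_left P.tendsto_mode_lifting r)
    show "AE \<xi> in lborel. norm (cis (2 * pi * (x \<bullet> \<xi>)) * P.mode_lifting \<xi> e (z\<^sup>2 / 4)) \<le> P.lifting_const / (z\<^sup>2 / 4) * C * weight \<xi>"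
      if "e \<in> {0<..}" for e
    proof (rule AE_I2)
      fix \<xi> :: "real ^ 'd"
      show "norm (cis (2 * pi * (x \<bullet> \<xi>)) * P.mode_lifting \<xi> e (z\<^sup>2 / 4)) \<le> P.lifting_const / (z\<^sup>2 / 4) * C * weight \<xi>"
        using P.mode_lifting_bound_inverse[of e "z\<^sup>2 / 4" \<xi>] that r by (simp add: norm_mult ac_simps)
    qed
  qed measurable
  then have "((\<lambda>e. poisson_const * of_real (z powr (2 * s)) *
      (\<integral>\<xi>. cis (2 * pi * (x \<bullet> \<xi>)) * P.mode_lifting \<xi> e (z\<^sup>2 / 4) \<partial>lborel)) \<longlongrightarrow> lifting x z) (at_right 0)"
    unfolding lifting_def by (rule tendsto_mult_left)
  then show ?thesis
  proof (rule Lim_transform_eventually)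
    show "\<forall>\<^sub>F e in at_right 0. poisson_const * of_real (z powr (2 * s)) *
      (\<integral>\<xi>. cis (2 * pi * (x \<bullet> \<xi>)) * P.mode_lifting \<xi> e (z\<^sup>2 / 4) \<partial>lborel) = truncated_poisson_lifting s history x z e"
      using eventually_at_right_less[of "0::real"] by eventually_elim (simp only: truncated_poisson_lifting_eq(2))
  qed
qed

lemma poisson_integral_exists_history:
  assumes "0 < z"
  shows "poisson_integral_exists s history x z"
  unfolding poisson_integral_exists_def
  using integrable_poisson_integrand truncated_poisson_lifting_eq(1) tendsto_truncated_poisson_lifting[OF assms] by blast

lemma poisson_lifting_eq:
  assumes "0 < z"
  shows "poisson_lifting s history (x, z) = lifting x z"
  using tendsto_Lim[OF _ tendsto_truncated_poisson_lifting[OF assms, of x]] by (simp add: poisson_lifting_def)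

lemma continuous_mode_lifting_limit: "continuous_on UNIV (\<lambda>\<xi>. P.mode_lifting_limit \<xi> r)"
proof -
  have "((\<lambda>\<xi>. LINT \<sigma>:{0<..}|lborel. P.amplitude_deriv \<xi> \<sigma> * cis (r / \<sigma>)) \<longlongrightarrow>
      (LINT \<sigma>:{0<..}|lborel. P.amplitude_deriv \<xi>0 \<sigma> * cis (r / \<sigma>))) (at \<xi>0)" for \<xi>0
    unfolding set_lebesgue_integral_def
  proof (rule integral_dominated_convergence_within)
    show "integrable lborel (\<lambda>\<sigma>. indicator {0<..} \<sigma> *\<^sub>R (2 * C * power_hat s s \<sigma>))"
      using integrable_mult_indicator[OF _ integrable_mult_right[OF integrable_power_hat[OF s(2,1)], of "2 * C"], of "{0<..}"] by simp
    show "AE \<sigma> in lborel. ((\<lambda>\<xi>. indicator {0<..} \<sigma> *\<^sub>R (P.amplitude_deriv \<xi> \<sigma> * cis (r / \<sigma>))) \<longlongrightarrow>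
        indicator {0<..} \<sigma> *\<^sub>R (P.amplitude_deriv \<xi>0 \<sigma> * cis (r / \<sigma>))) (at \<xi>0)"
    proof (intro AE_I2 tendsto_intros)
      fix \<sigma> :: real
      have "((\<lambda>\<xi>. mode \<phi> \<xi> \<sigma>) \<longlongrightarrow> mode \<phi> \<xi>0 \<sigma>) (at \<xi>0)" "((\<lambda>\<xi>. mode \<psi> \<xi> \<sigma>) \<longlongrightarrow> mode \<psi> \<xi>0 \<sigma>) (at \<xi>0)"
        using continuous_mode_frequency[OF \<phi>, of \<sigma>] continuous_mode_frequency[OF \<psi>, of \<sigma>] by (auto simp: continuous_on_def)
      then show "((\<lambda>\<xi>. P.amplitude_deriv \<xi> \<sigma>) \<longlongrightarrow> P.amplitude_deriv \<xi>0 \<sigma>) (at \<xi>0)"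
        unfolding P.amplitude_deriv_def by (intro tendsto_intros)
    qed
    show "AE \<sigma> in lborel. norm (indicator {0<..} \<sigma> *\<^sub>R (P.amplitude_deriv \<xi> \<sigma> * cis (r / \<sigma>))) \<le> indicator {0<..} \<sigma> *\<^sub>R (2 * C * power_hat s s \<sigma>)" for \<xi>
      using P.norm_amplitude_deriv_wave_AE[of \<xi> r]
    proof eventually_elim
      case (elim \<sigma>)
      have "2 * (C * weight \<xi>) * power_hat s s \<sigma> \<le> 2 * (C * 1) * power_hat s s \<sigma>"
        using C weight_le_1[of \<xi>] power_hat_nonneg[of s s \<sigma>] by (intro mult_right_mono mult_left_mono) auto
      with elim show ?case by (auto simp: indicator_def)
    qed
  qed measurable
  then have "continuous_on UNIV (\<lambda>\<xi>. LINT \<sigma>:{0<..}|lborel. P.amplitude_deriv \<xi> \<sigma> * cis (r / \<sigma>))"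
    by (auto simp: continuous_on_def)
  then show ?thesis
    unfolding P.mode_lifting_limit_def by (intro continuous_intros)
qed

lemma plancherel_lifting:
  assumes z: "0 < z"
  shows "(\<integral>\<^sup>+x. ennreal ((cmod (lifting x z))\<^sup>2) \<partial>lborel) =
    ennreal ((cmod poisson_const)\<^sup>2 * z powr (4 * s)) * (\<integral>\<^sup>+\<xi>. ennreal ((cmod (P.mode_lifting_limit \<xi> (z\<^sup>2 / 4)))\<^sup>2) \<partial>lborel)"
proof -
  define r where "r = z\<^sup>2 / 4"
  have r: "0 < r" using z by (simp add: r_def)
  define B where "B = P.lifting_const * C / r"
  have B: "0 \<le> B" using C r P.lifting_const_nonneg by (simp add: B_def)
  have b: "cmod (P.mode_lifting_limit \<xi> r) \<le> B * weight \<xi>" for \<xi>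
    using P.mode_lifting_limit_bound(1)[OF r, of \<xi>] by (simp add: B_def)
  have "integrable lborel (\<lambda>\<xi>. P.mode_lifting_limit \<xi> r)"
  proof (rule Bochner_Integration.integrable_bound)
    show "integrable lborel (\<lambda>\<xi>. B * weight (\<xi> :: real ^ 'd))"
      by (intro integrable_mult_right integrable_weight)
    show "AE \<xi> in lborel. norm (P.mode_lifting_limit \<xi> r) \<le> norm (B * weight \<xi>)"
      using b by (auto intro: order_trans[OF _ abs_ge_self])
  qed measurable
  moreover have "cmod (P.mode_lifting_limit \<xi> r) \<le> B" for \<xi>
    using b[of \<xi>] mult_left_mono[OF weight_le_1[of \<xi>] B] by simp
  ultimately have p: "(\<integral>\<^sup>+x. ennreal ((cmod (\<integral>\<xi>. cis (2 * pi * (x \<bullet> \<xi>)) * P.mode_lifting_limit \<xi> r \<partial>lborel))\<^sup>2) \<partial>lborel) =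
      (\<integral>\<^sup>+\<xi>. ennreal ((cmod (P.mode_lifting_limit \<xi> r))\<^sup>2) \<partial>lborel)"
    by (intro plancherel[OF continuous_mode_lifting_limit]) auto
  have c: "(cmod (poisson_const * of_real (z powr (2 * s))))\<^sup>2 = (cmod poisson_const)\<^sup>2 * z powr (4 * s)"
    by (simp add: norm_mult power_mult_distrib power2_eq_square powr_add[symmetric])
  have "ennreal ((cmod (lifting x z))\<^sup>2) = ennreal ((cmod poisson_const)\<^sup>2 * z powr (4 * s)) *
      ennreal ((cmod (\<integral>\<xi>. cis (2 * pi * (x \<bullet> \<xi>)) * P.mode_lifting_limit \<xi> r \<partial>lborel))\<^sup>2)" for x
    unfolding lifting_def r_def[symmetric] norm_mult[of "poisson_const * of_real (z powr (2 * s))"] power_mult_distrib c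
    by (rule ennreal_mult) auto
  then show ?thesis
    unfolding r_def[symmetric] p[symmetric] by (simp only:) (rule nn_integral_cmult, measurable)
qed

text \<open>The half-space integral is exchanged to frequency space for each height \<open>z\<close>, and then \<open>z\<close> is integrated
  first, for each frequency. The exponents add up to \<open>(1 - 2 s) + 4 s = 1 + 2 s\<close>.\<close>

lemma nn_integral_lifting:
  "(\<integral>\<^sup>+X. ennreal (snd X powr (1 - 2 * s)) * ennreal ((cmod (lifting (fst X) (snd X)))\<^sup>2) * indicator {X. 0 < snd X} X \<partial>lborel) =
    Q_form s history"
proof -
  let ?F = "\<lambda>\<xi> z. P.mode_lifting_limit \<xi> (z\<^sup>2 / 4)"
  let ?c = "(cmod poisson_const)\<^sup>2"
  have "(\<integral>\<^sup>+X. ennreal (snd X powr (1 - 2 * s)) * ennreal ((cmod (lifting (fst X) (snd X)))\<^sup>2) * indicator {X. 0 < snd X} X \<partial>lborel) =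
      (\<integral>\<^sup>+X. (case X of (x, z) \<Rightarrow> ennreal (z powr (1 - 2 * s)) * ennreal ((cmod (lifting x z))\<^sup>2) * indicator {0<..} z) \<partial>(lborel \<Otimes>\<^sub>M lborel))"
    unfolding lborel_prod by (intro nn_integral_cong) (auto simp: indicator_def)
  also have "\<dots> = (\<integral>\<^sup>+z. (\<integral>\<^sup>+x. ennreal (z powr (1 - 2 * s)) * ennreal ((cmod (lifting x z))\<^sup>2) * indicator {0<..} z \<partial>lborel) \<partial>lborel)"
    using lborel_pair.nn_integral_snd[where f = "\<lambda>(x, z). ennreal (z powr (1 - 2 * s)) * ennreal ((cmod (lifting x z))\<^sup>2) * indicator {0<..} z"]
    by (simp add: measurable_split_conv)
  also have "\<dots> = (\<integral>\<^sup>+z. (\<integral>\<^sup>+\<xi>. ennreal ?c * (ennreal (z powr (1 + 2 * s) * (cmod (?F \<xi> z))\<^sup>2) * indicator {0<..} z) \<partial>lborel) \<partial>lborel)"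
  proof (rule nn_integral_cong)
    fix z :: real
    show "(\<integral>\<^sup>+x. ennreal (z powr (1 - 2 * s)) * ennreal ((cmod (lifting x z))\<^sup>2) * indicator {0<..} z \<partial>lborel) =
        (\<integral>\<^sup>+\<xi>. ennreal ?c * (ennreal (z powr (1 + 2 * s) * (cmod (?F \<xi> z))\<^sup>2) * indicator {0<..} z) \<partial>lborel)"
    proof (cases "0 < z")
      case True
      have e: "ennreal (z powr (1 - 2 * s)) * ennreal (?c * z powr (4 * s)) = ennreal (?c * z powr (1 + 2 * s))"
        using True by (simp add: ennreal_mult[symmetric] powr_add[symmetric] mult.left_commute add.commute)
      have "(\<integral>\<^sup>+x. ennreal (z powr (1 - 2 * s)) * ennreal ((cmod (lifting x z))\<^sup>2) * indicator {0<..} z \<partial>lborel) =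
          ennreal (z powr (1 - 2 * s)) * (\<integral>\<^sup>+x. ennreal ((cmod (lifting x z))\<^sup>2) \<partial>lborel)"
        using True by (simp add: nn_integral_cmult)
      also have "\<dots> = ennreal (?c * z powr (1 + 2 * s)) * (\<integral>\<^sup>+\<xi>. ennreal ((cmod (?F \<xi> z))\<^sup>2) \<partial>lborel)"
        unfolding plancherel_lifting[OF True] mult.assoc[symmetric] e ..
      also have "\<dots> = (\<integral>\<^sup>+\<xi>. ennreal (?c * z powr (1 + 2 * s)) * ennreal ((cmod (?F \<xi> z))\<^sup>2) \<partial>lborel)"
        by (rule nn_integral_cmult[symmetric]) measurable
      also have "\<dots> = (\<integral>\<^sup>+\<xi>. ennreal ?c * (ennreal (z powr (1 + 2 * s) * (cmod (?F \<xi> z))\<^sup>2) * indicator {0<..} z) \<partial>lborel)"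
        using True by (intro nn_integral_cong) (simp add: ennreal_mult mult.assoc)
      finally show ?thesis .
    qed simp
  qed
  also have "\<dots> = (\<integral>\<^sup>+\<xi>. (\<integral>\<^sup>+z. ennreal ?c * (ennreal (z powr (1 + 2 * s) * (cmod (?F \<xi> z))\<^sup>2) * indicator {0<..} z) \<partial>lborel) \<partial>lborel)"
    by (rule lborel_pair.Fubini') measurable
  also have "\<dots> = (\<integral>\<^sup>+\<xi>. ennreal (2 powr (1 - 2 * s) / (Gamma s)\<^sup>2) *
      (\<integral>\<^sup>+\<omega>\<in>{0<..}. ennreal (\<omega> powr s * (cmod (G_fun history \<xi> \<omega>))\<^sup>2) \<partial>lborel) \<partial>lborel)"
  proof (rule nn_integral_cong)
    fix \<xi> :: "real ^ 'd"
    have "(\<integral>\<^sup>+z. ennreal ?c * (ennreal (z powr (1 + 2 * s) * (cmod (?F \<xi> z))\<^sup>2) * indicator {0<..} z) \<partial>lborel) =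
        ennreal ?c * (\<integral>\<^sup>+z\<in>{0<..}. ennreal (z powr (1 + 2 * s) * (cmod (?F \<xi> z))\<^sup>2) \<partial>lborel)"
      by (rule nn_integral_cmult) measurable
    also have "\<dots> = ennreal ?c * (ennreal (2 powr (1 + 2 * s)) *
        (\<integral>\<^sup>+r\<in>{0<..}. ennreal (r powr s * (cmod (P.mode_lifting_limit \<xi> r))\<^sup>2) \<partial>lborel))"
      by (subst nn_integral_quadratic_substitution[of "\<lambda>r. (cmod (P.mode_lifting_limit \<xi> r))\<^sup>2"]) auto
    also have "\<dots> = ennreal (?c * 2 powr (1 + 2 * s)) *
        (\<integral>\<^sup>+r\<in>{0<..}. ennreal (r powr s * (cmod (P.mode_lifting_limit \<xi> r))\<^sup>2) \<partial>lborel)"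
      by (simp add: ennreal_mult mult.assoc)
    finally show "(\<integral>\<^sup>+z. ennreal ?c * (ennreal (z powr (1 + 2 * s) * (cmod (?F \<xi> z))\<^sup>2) * indicator {0<..} z) \<partial>lborel) =
        ennreal (2 powr (1 - 2 * s) / (Gamma s)\<^sup>2) *
        (\<integral>\<^sup>+\<omega>\<in>{0<..}. ennreal (\<omega> powr s * (cmod (G_fun history \<xi> \<omega>))\<^sup>2) \<partial>lborel)"
      by (simp only: norm_poisson_const_sq P.mode_identity G_fun_history)
  qed
  also have "\<dots> = Q_form s history"
    unfolding Q_form_def G_fun_history P.mode_identity[symmetric]
    by (rule nn_integral_cmult) measurable
  finally show ?thesis .
qed

text \<open>Finiteness is read off from the lifting side: the square of a mode is bounded by the square of the weight.\<close>

lemma Q_form_finite: "Q_form s history < \<infinity>"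
proof -
  let ?D = "(P.lifting_const * C)\<^sup>2 * (1 / (1 - s) + 1 / (1 - s))"
  have D: "0 \<le> ?D" using s by simp
  have "(\<integral>\<^sup>+\<xi>. (\<integral>\<^sup>+r\<in>{0<..}. ennreal (r powr s * (cmod (P.mode_lifting_limit \<xi> r))\<^sup>2) \<partial>lborel) \<partial>lborel) \<le>
      (\<integral>\<^sup>+\<xi>. ennreal (?D * weight (\<xi> :: real ^ 'd)) \<partial>lborel)"
  proof (rule nn_integral_mono)
    fix \<xi> :: "real ^ 'd"
    have "(P.lifting_const * (C * weight \<xi>))\<^sup>2 * (1 / (1 - s) + 1 / (1 - s)) = ?D * (weight \<xi>)\<^sup>2"
      by (simp add: power_mult_distrib)
    also have "\<dots> \<le> ?D * weight \<xi>"
      using weight_pos[of \<xi>] weight_le_1[of \<xi>] D by (intro mult_left_mono) (auto simp: power2_eq_square mult_left_le)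
    finally show "(\<integral>\<^sup>+r\<in>{0<..}. ennreal (r powr s * (cmod (P.mode_lifting_limit \<xi> r))\<^sup>2) \<partial>lborel) \<le> ennreal (?D * weight \<xi>)"
      using P.mode_lifting_limit_square_bound[of \<xi>] by (meson ennreal_leI order_trans)
  qed
  also have "\<dots> = ennreal (\<integral>\<xi>. ?D * weight (\<xi> :: real ^ 'd) \<partial>lborel)"
    by (intro nn_integral_eq_integral integrable_mult_right integrable_weight AE_I2 mult_nonneg_nonneg[OF D]
        less_imp_le[OF weight_pos])
  also have "\<dots> < \<infinity>" by simp
  finally show ?thesis
    unfolding Q_form_def G_fun_history P.mode_identity[symmetric]
    by (simp add: ennreal_mult_less_top)
qed

lemma poisson_lifting_measurable: "poisson_lifting s history \<in> borel_measurable (half_space_measure (1 - 2 * s))"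
proof -
  have "(\<lambda>X. lifting (fst X) (snd X)) \<in> borel_measurable (borel \<Otimes>\<^sub>M borel)"
    by measurable
  then have "(\<lambda>X. lifting (fst X) (snd X)) \<in> borel_measurable (restrict_space lborel {X. 0 < snd X})"
    by (intro measurable_restrict_space1) (simp add: borel_prod)
  then have "poisson_lifting s history \<in> borel_measurable (restrict_space lborel {X. 0 < snd X})"
    by (rule measurable_cong[THEN iffD2, rotated]) (auto simp: space_restrict_space poisson_lifting_eq)
  then show ?thesis by (simp add: half_space_measure_def)
qed

lemma l2_norm_sq_poisson_lifting:
  "l2_norm_sq (half_space_measure (1 - 2 * s)) (poisson_lifting s history) = Q_form s history"
proof -
  have S: "{X :: (real ^ 'd) \<times> real. 0 < snd X} \<in> sets lborel"
    by (simp add: open_Collect_less continuous_on_snd)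
  have m: "poisson_lifting s history \<in> borel_measurable (restrict_space lborel {X. 0 < snd X})"
    using poisson_lifting_measurable by (simp add: half_space_measure_def)
  have "l2_norm_sq (half_space_measure (1 - 2 * s)) (poisson_lifting s history) =
      (\<integral>\<^sup>+X. ennreal (snd X powr (1 - 2 * s)) * ennreal ((cmod (poisson_lifting s history X))\<^sup>2) \<partial>restrict_space lborel {X. 0 < snd X})"
    unfolding l2_norm_sq_def half_space_measure_def
  proof (rule nn_integral_density)
    have "(\<lambda>X :: (real ^ 'd) \<times> real. ennreal (snd X powr (1 - 2 * s))) \<in> borel_measurable (borel \<Otimes>\<^sub>M borel)"
      by measurable
    then show "(\<lambda>X :: (real ^ 'd) \<times> real. ennreal (snd X powr (1 - 2 * s))) \<in>
        borel_measurable (restrict_space lborel {X. 0 < snd X})"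
      by (intro measurable_restrict_space1) (simp add: borel_prod)
  qed (use m in measurable)
  also have "\<dots> = (\<integral>\<^sup>+X. ennreal (snd X powr (1 - 2 * s)) * ennreal ((cmod (poisson_lifting s history X))\<^sup>2) * indicator {X. 0 < snd X} X \<partial>lborel)"
    using S by (subst nn_integral_restrict_space) auto
  also have "\<dots> = (\<integral>\<^sup>+X. ennreal (snd X powr (1 - 2 * s)) * ennreal ((cmod (lifting (fst X) (snd X)))\<^sup>2) * indicator {X. 0 < snd X} X \<partial>lborel)"
    by (intro nn_integral_cong) (auto simp: indicator_def poisson_lifting_eq)
  finally show ?thesis by (simp only: nn_integral_lifting)
qed

end

lemma poisson_lifting_isometry:
  fixes u :: "(real ^ 'd) \<times> real \<Rightarrow> complex"
  assumes s: "0 < s" "s < 1" and u: "u \<in> schwartz_minus"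
  shows "\<And>x z. 0 < z \<Longrightarrow> poisson_integral_exists s u x z"
    and "poisson_lifting s u \<in> l2_funs (half_space_measure (1 - 2 * s))"
    and "l2_norm_sq (half_space_measure (1 - 2 * s)) (poisson_lifting s u) = Q_form s u"
proof -
  obtain \<phi> where \<phi>: "\<phi> \<in> schwartz" and u_eq: "u = (\<lambda>X. if snd X \<le> 0 then \<phi> X else 0)"
    using u by (auto simp: schwartz_minus_def)
  obtain \<psi> where \<psi>: "\<psi> \<in> schwartz" "\<And>\<xi> \<sigma>. (mode \<phi> \<xi> has_vector_derivative mode \<psi> \<xi> \<sigma>) (at \<sigma>)"
    using mode_derivative[OF \<phi>] by blast
  obtain C1 where C1: "0 \<le> C1" "\<And>\<xi> \<sigma>. cmod (mode \<phi> \<xi> \<sigma>) \<le> C1 * weight \<xi> / (1 + \<sigma>\<^sup>2)"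
    using mode_decay[OF \<phi>] by blast
  obtain C2 where C2: "0 \<le> C2" "\<And>\<xi> \<sigma>. cmod (mode \<psi> \<xi> \<sigma>) \<le> C2 * weight \<xi> / (1 + \<sigma>\<^sup>2)"
    using mode_decay[OF \<psi>(1)] by blast
  interpret schwartz_history s \<phi> \<psi> "max C1 C2"
  proof
    have le: "C' * weight \<xi> / (1 + \<sigma>\<^sup>2) \<le> max C1 C2 * weight \<xi> / (1 + \<sigma>\<^sup>2)" if "C' \<le> max C1 C2" for C' and \<xi> :: "real ^ 'd" and \<sigma> :: real
      using that weight_pos[of \<xi>] by (intro divide_right_mono mult_right_mono) auto
    show "cmod (mode \<phi> \<xi> \<sigma>) \<le> max C1 C2 * weight \<xi> / (1 + \<sigma>\<^sup>2)" for \<xi> \<sigma>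
      using C1(2)[of \<xi> \<sigma>] le[of C1 \<xi> \<sigma>] by simp
    show "cmod (mode \<psi> \<xi> \<sigma>) \<le> max C1 C2 * weight \<xi> / (1 + \<sigma>\<^sup>2)" for \<xi> \<sigma>
      using C2(2)[of \<xi> \<sigma>] le[of C2 \<xi> \<sigma>] by simp
  qed (use s \<phi> \<psi> C1 C2 in auto)
  have "u = history" by (auto simp: u_eq history_def)
  then show "\<And>x z. 0 < z \<Longrightarrow> poisson_integral_exists s u x z"
    and "poisson_lifting s u \<in> l2_funs (half_space_measure (1 - 2 * s))"
    and "l2_norm_sq (half_space_measure (1 - 2 * s)) (poisson_lifting s u) = Q_form s u"
    using poisson_integral_exists_history l2_norm_sq_poisson_lifting poisson_lifting_measurable Q_form_finite
    by (auto simp: l2_funs_def)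
qed

section \<open>Linearity of the lifting\<close>

lemma schwartz_minus_add:
  assumes "u \<in> schwartz_minus" "v \<in> schwartz_minus"
  shows "(\<lambda>X. u X + v X) \<in> schwartz_minus"
proof -
  obtain \<phi> \<psi> where "\<phi> \<in> schwartz" "u = (\<lambda>X. if snd X \<le> 0 then \<phi> X else 0)"
    and "\<psi> \<in> schwartz" "v = (\<lambda>X. if snd X \<le> 0 then \<psi> X else 0)"
    using assms by (auto simp: schwartz_minus_def)
  then show ?thesis
    unfolding schwartz_minus_def by (intro image_eqI[where x = "\<lambda>X. \<phi> X + \<psi> X"] schwartz_add) auto
qed

lemma schwartz_minus_scale:
  assumes "u \<in> schwartz_minus"
  shows "(\<lambda>X. c * u X) \<in> schwartz_minus"
proof -
  obtain \<phi> where "\<phi> \<in> schwartz" "u = (\<lambda>X. if snd X \<le> 0 then \<phi> X else 0)"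
    using assms by (auto simp: schwartz_minus_def)
  then show ?thesis
    unfolding schwartz_minus_def by (intro image_eqI[where x = "\<lambda>X. c * \<phi> X"] schwartz_scale) auto
qed

lemma tendsto_poisson_lifting:
  assumes "poisson_integral_exists s u x z"
  shows "(truncated_poisson_lifting s u x z \<longlongrightarrow> poisson_lifting s u (x, z)) (at_right 0)"
proof -
  obtain w where w: "(truncated_poisson_lifting s u x z \<longlongrightarrow> w) (at_right 0)"
    using assms by (auto simp: poisson_integral_exists_def)
  with tendsto_Lim[OF _ w] show ?thesis by (simp add: poisson_lifting_def)
qed

lemma poisson_lifting_unique:
  assumes lim: "(T \<longlongrightarrow> w) (at_right 0)"
    and eq: "\<And>e. 0 < e \<Longrightarrow> truncated_poisson_lifting s u x z e = T e"
  shows "poisson_lifting s u (x, z) = w"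
proof -
  have "(truncated_poisson_lifting s u x z \<longlongrightarrow> w) (at_right 0)"
    using lim
  proof (rule Lim_transform_eventually)
    show "\<forall>\<^sub>F e in at_right 0. T e = truncated_poisson_lifting s u x z e"
      using eventually_at_right_less[of "0::real"] by eventually_elim (simp only: eq)
  qed
  then show ?thesis
    using tendsto_Lim[of "at_right (0::real)"] by (simp add: poisson_lifting_def)
qed

lemma poisson_lifting_add:
  assumes u: "poisson_integral_exists s u x z" and v: "poisson_integral_exists s v x z"
  shows "poisson_lifting s (\<lambda>X. u X + v X) (x, z) = poisson_lifting s u (x, z) + poisson_lifting s v (x, z)"
proof (rule poisson_lifting_unique)
  show "((\<lambda>e. truncated_poisson_lifting s u x z e + truncated_poisson_lifting s v x z e) \<longlongrightarrow>
      poisson_lifting s u (x, z) + poisson_lifting s v (x, z)) (at_right 0)"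
    by (intro tendsto_add tendsto_poisson_lifting u v)
  fix e :: real assume e: "0 < e"
  have "(\<integral>y. poisson_integrand s (\<lambda>X. u X + v X) x z \<sigma> y \<partial>lborel) =
      (\<integral>y. poisson_integrand s u x z \<sigma> y \<partial>lborel) + (\<integral>y. poisson_integrand s v x z \<sigma> y \<partial>lborel)" if "0 < \<sigma>" for \<sigma>
  proof -
    have "poisson_integrand s (\<lambda>X. u X + v X) x z \<sigma> y = poisson_integrand s u x z \<sigma> y + poisson_integrand s v x z \<sigma> y" for y
      by (simp add: poisson_integrand_def distrib_left)
    then show ?thesis
      using u v that by (simp add: poisson_integral_exists_def)
  qed
  then have "truncated_poisson_lifting s (\<lambda>X. u X + v X) x z e = (LINT \<sigma>:{e<..}|lborel.
      (\<integral>y. poisson_integrand s u x z \<sigma> y \<partial>lborel) + (\<integral>y. poisson_integrand s v x z \<sigma> y \<partial>lborel))"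
    unfolding truncated_poisson_lifting_def using e by (intro set_lebesgue_integral_cong) auto
  also have "\<dots> = truncated_poisson_lifting s u x z e + truncated_poisson_lifting s v x z e"
    unfolding truncated_poisson_lifting_def using u v e by (intro set_integral_add) (auto simp: poisson_integral_exists_def)
  finally show "truncated_poisson_lifting s (\<lambda>X. u X + v X) x z e = truncated_poisson_lifting s u x z e + truncated_poisson_lifting s v x z e" .
qed

lemma poisson_lifting_scale:
  assumes u: "poisson_integral_exists s u x z"
  shows "poisson_lifting s (\<lambda>X. c * u X) (x, z) = c * poisson_lifting s u (x, z)"
proof (rule poisson_lifting_unique)
  show "((\<lambda>e. c * truncated_poisson_lifting s u x z e) \<longlongrightarrow> c * poisson_lifting s u (x, z)) (at_right 0)"
    by (intro tendsto_mult_left tendsto_poisson_lifting u)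
  show "truncated_poisson_lifting s (\<lambda>X. c * u X) x z e = c * truncated_poisson_lifting s u x z e" for e
  proof -
    have "poisson_integrand s (\<lambda>X. c * u X) x z \<sigma> = (\<lambda>y. c * poisson_integrand s u x z \<sigma> y)" for \<sigma>
      by (simp add: poisson_integrand_def fun_eq_iff)
    then show ?thesis
      unfolding truncated_poisson_lifting_def by simp
  qed
qed

lemma AE_half_space:
  assumes "\<And>x z. 0 < z \<Longrightarrow> P (x, z)"
  shows "AE X in half_space_measure a. P X"
  by (rule AE_I2) (use assms in \<open>auto simp: half_space_measure_def space_restrict_space\<close>)

lemma l2_valued_isometry_poisson:
  assumes s: "0 < s" "s < 1"
  shows "l2_valued_isometry (schwartz_minus_space s :: ((real ^ 'd) \<times> real \<Rightarrow> complex) normed_cspace)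
    (half_space_measure (1 - 2 * s)) (poisson_lifting s)"
proof
  note iso = poisson_lifting_isometry[OF s, where 'd = 'd]
  let ?E = "schwartz_minus_space s :: ((real ^ 'd) \<times> real \<Rightarrow> complex) normed_cspace"
  let ?M = "half_space_measure (1 - 2 * s)"
  fix u v :: "(real ^ 'd) \<times> real \<Rightarrow> complex" and c
  assume "u \<in> vcarrier ?E"
  then have u: "u \<in> schwartz_minus" by (simp add: schwartz_minus_space_def)
  show "poisson_lifting s u \<in> l2_funs ?M" by (rule iso(2)[OF u])
  show "vscale ?E c u \<in> vcarrier ?E"
    using schwartz_minus_scale[OF u] by (simp add: schwartz_minus_space_def)
  show "AE X in ?M. poisson_lifting s (vscale ?E c u) X = c * poisson_lifting s u X"
    unfolding schwartz_minus_space_def normed_cspace.simps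
    by (intro AE_half_space poisson_lifting_scale iso(1)[OF u])
  show "vnorm ?E u = l2_norm ?M (poisson_lifting s u)"
    by (simp add: schwartz_minus_space_def l2_norm_def iso(3)[OF u])
  assume "v \<in> vcarrier ?E"
  then have v: "v \<in> schwartz_minus" by (simp add: schwartz_minus_space_def)
  show "vadd ?E u v \<in> vcarrier ?E"
    using schwartz_minus_add[OF u v] by (simp add: schwartz_minus_space_def)
  show "AE X in ?M. poisson_lifting s (vadd ?E u v) X = poisson_lifting s u X + poisson_lifting s v X"
    unfolding schwartz_minus_space_def normed_cspace.simps
    by (intro AE_half_space poisson_lifting_add iso(1)[OF u] iso(1)[OF v])
qed

theorem theoremC:
  fixes s a :: real
  assumes "0 < s" and "s < 1" and "a = 1 - 2 * s"
  shows "(\<forall>u \<in> (schwartz_minus :: ((real ^ 'd) \<times> real \<Rightarrow> complex) set).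
            (\<forall>x z. z > 0 \<longrightarrow> poisson_integral_exists s u x z) \<and>
            poisson_lifting s u \<in> l2_funs (half_space_measure a) \<and>
            l2_norm_sq (half_space_measure a) (poisson_lifting s u) = Q_form s u) \<and>
         (\<exists>P :: (nat \<Rightarrow> (real ^ 'd) \<times> real \<Rightarrow> complex) set \<Rightarrow> ((real ^ 'd) \<times> real \<Rightarrow> complex) set.
            linear_map (H_space s) (L2_space (half_space_measure a)) P \<and>
            isometric_map (H_space s) (L2_space (half_space_measure a)) P \<and>
            extends_poisson_lifting s P \<and>
            (\<forall>P'. isometric_map (H_space s) (L2_space (half_space_measure a)) P' \<and>
                  extends_poisson_lifting s P' \<longrightarrow> P' = P))"
proof -
  note iso = poisson_lifting_isometry[OF assms(1,2), where 'd = 'd]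
  interpret l2_valued_isometry "schwartz_minus_space s :: ((real ^ 'd) \<times> real \<Rightarrow> complex) normed_cspace"
    "half_space_measure (1 - 2 * s)" "poisson_lifting s"
    by (rule l2_valued_isometry_poisson[OF assms(1,2)])
  have carrier: "vcarrier (schwartz_minus_space s :: ((real ^ 'd) \<times> real \<Rightarrow> complex) normed_cspace) = schwartz_minus"
    by (simp add: schwartz_minus_space_def)
  show ?thesis
    unfolding assms(3)
  proof (intro conjI ballI exI[of _ extension] allI impI)
    show "extends_poisson_lifting s extension"
      unfolding extends_poisson_lifting_def by (simp add: extension_to_completion carrier)
    fix P' :: "(nat \<Rightarrow> (real ^ 'd) \<times> real \<Rightarrow> complex) set \<Rightarrow> ((real ^ 'd) \<times> real \<Rightarrow> complex) set"
    assume "isometric_map (H_space s) (L2_space (half_space_measure (1 - 2 * s))) P' \<and> extends_poisson_lifting s P'"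
    then show "P' = extension"
      by (intro extension_unique) (auto simp: extends_poisson_lifting_def carrier)
  qed (use iso linear_map_extension isometric_map_extension in auto)
qed

end
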